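(* Let $\mathcal Q$ be the set of all rationalizable pairs $q=(q_1,q_2)$ of nondecreasing left-continuous functions $q_i:[0,1]\to[0,1]$. Let $\psi_1,\psi_2$ be essentially bounded functions on $[0,1]$, let $\eta\in\mathbb R$, and let $$\overline{\mathcal Q}=\Big\{q\in\mathcal Q:\ \int_0^1 q_1(x_1)\psi_1(x_1)\,dx_1+\int_0^1 q_2(x_2)\psi_2(x_2)\,dx_2\le\eta\Big\}.$$ Then every extreme point of $\overline{\mathcal Q}$ is rationalized by a mixture (convex combination) of $\mathbf 1_A$ and $\mathbf 1_{A'}$, where $A'\subseteq A\subseteq[0,1]^2$ are nested up-sets that differ by at most a rectangle. Moreover, every extreme point of $\overline{\mathcal Q}$ is uniquely rationalized among all monotone functions, i.e. any two monotone functions $[0,1]^2\to[0,1]$ that rationalize it are equal almost everywhere.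
   Context: A pair $q=(q_1,q_2)$ is rationalized by a (measurable) function $f:[0,1]^2\to[0,1]$ if $q_1(x_1)=\int_0^1 f(x_1,x_2)\,dx_2$ and $q_2(x_2)=\int_0^1 f(x_1,x_2)\,dx_1$ for all $x_1,x_2$; $q$ is rationalizable if some such (not necessarily monotone) $f$ exists. Functions are viewed as elements of $L^1$, i.e. identified when equal almost everywhere (so the value of $q_i$ at $0$ is immaterial and the rationalization identities are understood almost everywhere); likewise sets are considered up to null sets. A function $f:[0,1]^2\to[0,1]$ is monotone if $x\le y$ component-wise implies $f(x)\le f(y)$. A set $A\subseteq[0,1]^2$ is an up-set if $x\in A$, $y\ge x$ imply $y\in A$. A set $B\subseteq[0,1]^2$ is a rectangle if $\mathrm{cl}(B)=[\underline x_1,\overline x_1]\times[\underline x_2,\overline x_2]$ with $\underline x_1\le\overline x_1$, $\underline x_2\le\overline x_2$. Nested up-sets $A'\subseteq A$ differ by $B$ if $A\setminus A'=B$; they differ by at most a rectangle if $A\setminus A'$ is empty or a rectangle. *)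

theory Defs
  imports "HOL-Analysis.Analysis"
begin

text \<open>
  Functions on the unit interval and on the unit square are total functions on the reals and on
  pairs of reals, of which only the restriction to the interval or square matters.  The order on
  pairs of reals is the component-wise one.
\<close>

abbreviation unit_interval :: "real set" where
  "unit_interval \<equiv> {0..1}"

abbreviation unit_square :: "(real \<times> real) set" where
  "unit_square \<equiv> {0..1} \<times> {0..1}"

type_synonym fun_pair = "(real \<Rightarrow> real) \<times> (real \<Rightarrow> real)"

text \<open>
  Measurability is Lebesgue measurability, so that monotone functions on the square are not
  excluded.  Almost every section of such an \<open>f\<close> is integrable, hence the value \<open>0\<close> of the
  integral of a non-integrable function plays no role.
\<close>

definition rationalizes :: "(real \<times> real \<Rightarrow> real) \<Rightarrow> fun_pair \<Rightarrow> bool" where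
  "rationalizes f q \<longleftrightarrow>
     f \<in> borel_measurable (lebesgue_on unit_square) \<and>
     f ` unit_square \<subseteq> {0..1} \<and>
     (AE x1 in lebesgue_on unit_interval.
        fst q x1 = (LINT x2|lebesgue_on unit_interval. f (x1, x2))) \<and>
     (AE x2 in lebesgue_on unit_interval.
        snd q x2 = (LINT x1|lebesgue_on unit_interval. f (x1, x2)))"

definition rationalizable :: "fun_pair \<Rightarrow> bool" where
  "rationalizable q \<longleftrightarrow> (\<exists>f. rationalizes f q)"

text \<open>Left-continuity is vacuous at the left end point of the domain.\<close>

definition nondecreasing_left_cont :: "(real \<Rightarrow> real) \<Rightarrow> bool" where
  "nondecreasing_left_cont g \<longleftrightarrow>
     g ` unit_interval \<subseteq> {0..1} \<and>
     mono_on unit_interval g \<and>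
     (\<forall>x\<in>{0<..1}. continuous (at_left x) g)"

definition Q :: "fun_pair set" where
  "Q = {q. nondecreasing_left_cont (fst q) \<and> nondecreasing_left_cont (snd q) \<and> rationalizable q}"

definition essentially_bounded :: "(real \<Rightarrow> real) \<Rightarrow> bool" where
  "essentially_bounded \<psi> \<longleftrightarrow>
     \<psi> \<in> borel_measurable (lebesgue_on unit_interval) \<and>
     (\<exists>C. AE x in lebesgue_on unit_interval. \<bar>\<psi> x\<bar> \<le> C)"

definition Qbar :: "(real \<Rightarrow> real) \<Rightarrow> (real \<Rightarrow> real) \<Rightarrow> real \<Rightarrow> fun_pair set" where
  "Qbar \<psi>1 \<psi>2 \<eta> =
     {q \<in> Q. (LINT x|lebesgue_on unit_interval. fst q x * \<psi>1 x)
           + (LINT x|lebesgue_on unit_interval. snd q x * \<psi>2 x) \<le> \<eta>}"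

definition ae_eq :: "fun_pair \<Rightarrow> fun_pair \<Rightarrow> bool" where
  "ae_eq p q \<longleftrightarrow>
     (AE x in lebesgue_on unit_interval. fst p x = fst q x) \<and>
     (AE x in lebesgue_on unit_interval. snd p x = snd q x)"

definition convex_comb :: "real \<Rightarrow> fun_pair \<Rightarrow> fun_pair \<Rightarrow> fun_pair" where
  "convex_comb u p r =
     ((\<lambda>x. (1 - u) * fst p x + u * fst r x), (\<lambda>x. (1 - u) * snd p x + u * snd r x))"

text \<open>
  Extreme points are taken in the space of pairs of \<open>L\<^sup>1\<close> classes.  This is \<^const>\<open>extreme_point_of\<close>
  with \<^const>\<open>open_segment\<close> unfolded and equality read as equality almost everywhere.
\<close>

definition extreme_point_ae :: "fun_pair \<Rightarrow> fun_pair set \<Rightarrow> bool" where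
  "extreme_point_ae q S \<longleftrightarrow>
     q \<in> S \<and>
     (\<forall>p\<in>S. \<forall>r\<in>S. \<not> (\<not> ae_eq p r \<and> (\<exists>u. 0 < u \<and> u < 1 \<and> ae_eq q (convex_comb u p r))))"

definition up_set :: "(real \<times> real) set \<Rightarrow> bool" where
  "up_set A \<longleftrightarrow> A \<subseteq> unit_square \<and> (\<forall>x\<in>A. \<forall>y\<in>unit_square. x \<le> y \<longrightarrow> y \<in> A)"

definition rectangle :: "(real \<times> real) set \<Rightarrow> bool" where
  "rectangle B \<longleftrightarrow>
     B \<subseteq> unit_square \<and>
     (\<exists>a1 b1 a2 b2. a1 \<le> b1 \<and> a2 \<le> b2 \<and> closure B = {a1..b1} \<times> {a2..b2})"

definition differ_by_at_most_rectangle :: "(real \<times> real) set \<Rightarrow> (real \<times> real) set \<Rightarrow> bool" where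
  "differ_by_at_most_rectangle A' A \<longleftrightarrow> A - A' = {} \<or> rectangle (A - A')"

end

theory Submission
  imports Defs
begin

text \<open>
  Every \<open>q \<in> Q\<close> has a monotone rationalization: on an \<open>n \<times> n\<close> grid, the matrix with the same row and
  column sums as the cell averages and with least sum of squares is monotone, since otherwise an
  exchange of mass between two rows would decrease the sum of squares; a limit exists by Tychonoff.

  If \<open>f\<close> rationalizes an extreme point \<open>q\<close> and \<open>G\<close>, \<open>H\<close> are perturbations whose margins move more slowly
  than those of \<open>f\<close>, then some nontrivial combination of \<open>G\<close> and \<open>H\<close> does not change the constrained
  functional, so by extremality its margins vanish.  Tent functions of a monotone \<open>f\<close> supported below and above a level
  \<open>s\<close> are such perturbations; integrating their combination against \<open>1\<close> or against the additive function
  \<open>y + u x\<close> that separates \<open>f < s\<close> from \<open>f \<ge> s\<close> shows that one of them vanishes.  Hence \<open>f\<close> takes only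
  values \<open>0\<close>, \<open>t\<close>, \<open>1\<close>.  Applied to the midpoint of two monotone rationalizations \<open>f\<close>, \<open>g\<close>, this makes
  \<open>f - g\<close> constant on each section of the level set \<open>t\<close>, hence zero.

  Finally, for \<open>f = t 1\<^sub>A + (1 - t) 1\<^sub>B\<close> with \<open>B \<subseteq> A\<close> and section lengths \<open>\<alpha>(y)\<close>, \<open>\<beta>(y)\<close> of \<open>A\<close>, \<open>B\<close>, the
  perturbations \<open>(1\<^sub>A - 1\<^sub>B) w(y)\<close> with \<open>w \<in> {1, \<alpha>, \<beta>}\<close> show that \<open>\<alpha>\<close> and \<open>\<beta>\<close> are constant where they
  differ, so that \<open>A - B\<close> is a rectangle up to a null set.
\<close>

section \<open>Lebesgue measure on the unit square\<close>

text \<open>Membership in \<open>Qbar\<close> constrains margins only. A perturbed function may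
  therefore lose monotonicity, as long as its values stay in the unit interval and its margins stay
  nondecreasing; this freedom makes tent functions and weighted level sets available as
  perturbations. The price is that extremality yields only vanishing margins of a perturbation, so
  that each use needs a further argument, usually an integrand of constant sign. The linear
  constraint costs one dimension: moving along a single perturbation may violate it in one
  direction, while two perturbations always have a combination that leaves the functional unchanged.
  Hence a level splits the values of \<open>f\<close> in two, and one intermediate value
  \<open>t\<close> can survive. In the existence proof the obstacle is that integration is not
  continuous for pointwise convergence over an uncountable index set, the topology in which
  Tychonoff gives compactness. Approximate margins are therefore expressed by Riemann sums of
  monotone sections.\<close>

abbreviation LI :: "real measure" where "LI \<equiv> lebesgue_on unit_interval"
abbreviation LS :: "(real \<times> real) measure" where "LS \<equiv> lebesgue_on unit_square"

interpretation LI: finite_measure LI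
  by (rule finite_measure_lebesgue_on) simp

lemma unit_square_cbox: "unit_square = cbox (0, 0) (1, 1 :: real)"
  by (simp add: cbox_Pair_eq)

lemma unit_square_lmeasurable [simp]: "unit_square \<in> lmeasurable"
  unfolding unit_square_cbox by (rule lmeasurable_cbox)

lemma unit_square_sets [measurable, simp]: "unit_square \<in> sets lebesgue" "unit_square \<in> sets borel"
  using unit_square_lmeasurable unfolding unit_square_cbox by (auto simp del: unit_square_lmeasurable)

interpretation LS: finite_measure LS
  by (rule finite_measure_lebesgue_on) simp

section \<open>Fubini for Lebesgue measurable functions on the square\<close>

lemma measurable_AE_eq_completion:
  fixes f g :: "'a \<Rightarrow> 'b::topological_space"
  assumes g: "g \<in> borel_measurable (completion M)" and ae: "AE x in completion M. f x = g x"
  shows "f \<in> borel_measurable (completion M)"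
proof (rule measurableI)
  fix A :: "'b set" assume A: "A \<in> sets borel"
  show "f -` A \<inter> space (completion M) \<in> sets (completion M)"
  proof (rule completion.in_sets_AE)
    show "AE x in completion M. (x \<in> g -` A \<inter> space (completion M)) \<longleftrightarrow> (x \<in> f -` A \<inter> space (completion M))"
      using ae by eventually_elim auto
    show "g -` A \<inter> space (completion M) \<in> sets (completion M)"
      using g A by (rule measurable_sets)
  qed auto
qed auto

lemma AE_LI_iff: "(AE x in LI. P x) \<longleftrightarrow> (AE x in lborel. x \<in> unit_interval \<longrightarrow> P x)"
  by (subst AE_restrict_space_iff) (auto simp: AE_completion_iff)

lemma AE_LS_iff: "(AE x in LS. P x) \<longleftrightarrow> (AE x in lborel. x \<in> unit_square \<longrightarrow> P x)"
  by (subst AE_restrict_space_iff) (auto simp: AE_completion_iff)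

lemma AE_LI_neq: "AE x in LI. x \<noteq> c"
  unfolding AE_LI_iff using AE_lborel_singleton[of c] by auto

lemma AE_LI_countable: "countable C \<Longrightarrow> AE x in LI. x \<notin> C"
  unfolding AE_LI_iff
  by (rule AE_mp[OF AE_not_in[OF countable_imp_null_set_lborel]]) auto

lemma AE_lborel_Pair:
  assumes "AE x in (lborel :: (real \<times> real) measure). P x"
  shows "AE x in lborel. AE y in lborel. P (x, y)" "AE y in lborel. AE x in lborel. P (x, y)"
proof -
  have *: "AE x in lborel \<Otimes>\<^sub>M lborel. P x"
    using assms unfolding lborel_prod .
  show "AE x in lborel. AE y in lborel. P (x, y)"
    by (rule lborel_pair.AE_pair[OF *])
  have "AE z in distr (lborel \<Otimes>\<^sub>M lborel) (lborel \<Otimes>\<^sub>M lborel) (\<lambda>(x, y). (y, x)). P z"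
    using * unfolding lborel_pair.distr_pair_swap[symmetric] .
  then have "AE z in lborel \<Otimes>\<^sub>M lborel. P (case z of (x, y) \<Rightarrow> (y, x))"
    by (rule AE_distrD[rotated]) (rule measurable_pair_swap')
  from lborel_pair.AE_pair[OF this]
  show "AE y in lborel. AE x in lborel. P (x, y)" by simp
qed

lemma AE_LS_sections:
  assumes "AE x in LS. P x"
  shows "AE x in LI. AE y in LI. P (x, y)" "AE y in LI. AE x in LI. P (x, y)"
proof -
  note * = AE_lborel_Pair[OF assms[unfolded AE_LS_iff]]
  show "AE x in LI. AE y in LI. P (x, y)"
    unfolding AE_LI_iff using *(1) by eventually_elim auto
  show "AE y in LI. AE x in LI. P (x, y)"
    unfolding AE_LI_iff using *(2) by eventually_elim auto
qed

text \<open>Fubini is applied to products of \<open>lborel\<close>, since a Lebesgue measurable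
  \<open>f\<close> may have non-measurable sections. A Borel version obeys the bound only almost
  everywhere; truncation and cut-off restore it everywhere.\<close>

lemma borel_version:
  fixes f :: "real \<times> real \<Rightarrow> real"
  assumes f: "f \<in> borel_measurable LS" and B: "\<And>x. x \<in> unit_square \<Longrightarrow> \<bar>f x\<bar> \<le> B"
  obtains g where "g \<in> borel_measurable borel" "\<And>x. \<bar>g x\<bar> \<le> \<bar>B\<bar>" "\<And>x. x \<notin> unit_square \<Longrightarrow> g x = 0"
    "AE x in lborel. x \<in> unit_square \<longrightarrow> f x = g x"
proof -
  have "(\<lambda>x. if x \<in> unit_square then f x else 0) \<in> borel_measurable lebesgue"
    using f by (rule borel_measurable_if_I) simp
  from completion_ex_borel_measurable_real[OF this]
  obtain h where h[measurable]: "h \<in> borel_measurable lborel"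
    and ae: "AE x in lborel. (if x \<in> unit_square then f x else 0) = h x" by auto
  define g where "g x = indicator unit_square x * max (-\<bar>B\<bar>) (min \<bar>B\<bar> (h x))" for x
  show ?thesis
  proof
    have [measurable]: "h \<in> borel_measurable borel" using h by simp
    show "g \<in> borel_measurable borel" unfolding g_def by measurable
    show "\<bar>g x\<bar> \<le> \<bar>B\<bar>" for x by (auto simp: g_def indicator_def)
    show "x \<notin> unit_square \<Longrightarrow> g x = 0" for x by (auto simp: g_def)
    show "AE x in lborel. x \<in> unit_square \<longrightarrow> f x = g x"
      using ae
    proof eventually_elim
      case (elim x)
      show ?case
      proof
        assume x: "x \<in> unit_square"
        with elim have "f x = h x" by simp
        with B[OF x] x show "f x = g x" by (auto simp: g_def)
      qed
    qed
  qed
qed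

lemma LI_integral_version:
  fixes g h :: "real \<Rightarrow> real"
  assumes h: "h \<in> borel_measurable borel" and "\<And>y. y \<notin> unit_interval \<Longrightarrow> h y = 0"
    and ae: "AE y in lborel. y \<in> unit_interval \<longrightarrow> g y = h y"
  shows "g \<in> borel_measurable LI" "(LINT y|LI. g y) = (LINT y|lborel. h y)"
proof -
  have ae': "AE y in lebesgue. indicator unit_interval y *\<^sub>R g y = h y"
    using ae assms(2) by (subst AE_completion_iff) (auto elim!: eventually_mono simp: indicator_def)
  have hm: "h \<in> borel_measurable lebesgue" using h by (intro measurable_completion) simp
  have gm: "(\<lambda>y. indicator unit_interval y *\<^sub>R g y) \<in> borel_measurable lebesgue"
    by (rule measurable_AE_eq_completion[OF hm ae'])
  have "(LINT y|LI. g y) = (LINT y|lebesgue. indicator unit_interval y *\<^sub>R g y)"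
    by (subst integral_restrict_space) auto
  also have "\<dots> = (LINT y|lebesgue. h y)"
    by (rule integral_cong_AE[OF gm hm ae'])
  also have "\<dots> = (LINT y|lborel. h y)"
    using h by (subst integral_completion) auto
  finally show "(LINT y|LI. g y) = (LINT y|lborel. h y)" .
  show "g \<in> borel_measurable LI"
    using gm by (subst borel_measurable_restrict_space_iff) auto
qed

text \<open>For almost every \<open>x\<close> the section of \<open>f\<close> agrees almost
  everywhere with that of a Borel version. On the exceptional null set the inner integral may be the
  default 0; by completeness this affects neither measurability nor the outer integral.\<close>

lemma fubini_unit_square:
  fixes f :: "real \<times> real \<Rightarrow> real"
  assumes f: "f \<in> borel_measurable LS" and B: "\<And>x. x \<in> unit_square \<Longrightarrow> \<bar>f x\<bar> \<le> B"
  shows "(\<lambda>x. LINT y|LI. f (x, y)) \<in> borel_measurable LI"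
    "(\<lambda>y. LINT x|LI. f (x, y)) \<in> borel_measurable LI"
    "integral\<^sup>L LS f = (LINT x|LI. LINT y|LI. f (x, y))"
    "integral\<^sup>L LS f = (LINT y|LI. LINT x|LI. f (x, y))"
proof -
  obtain g where g[measurable]: "g \<in> borel_measurable borel"
    and gB: "\<And>x. \<bar>g x\<bar> \<le> \<bar>B\<bar>" and g0: "\<And>x. x \<notin> unit_square \<Longrightarrow> g x = 0"
    and ae: "AE x in lborel. x \<in> unit_square \<longrightarrow> f x = g x"
    using f B by (rule borel_version) (assumption | rule that)+
  have gp[measurable]: "g \<in> borel_measurable (lborel \<Otimes>\<^sub>M lborel)"
    using g by (simp add: lborel_prod)
  have gi: "integrable lborel g"
  proof (rule Bochner_Integration.integrable_bound)
    show "integrable lborel (\<lambda>x::real\<times>real. \<bar>B\<bar> * indicator unit_square x)"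
      unfolding unit_square_cbox
      by (intro integrable_mult_right integrable_real_indicator emeasure_lborel_cbox_finite) auto
    show "g \<in> borel_measurable lborel" by simp
    show "AE x in lborel. norm (g x) \<le> norm (\<bar>B\<bar> * indicator unit_square x)"
      using gB g0 by (intro AE_I2) (auto simp: indicator_def)
  qed
  have gi': "integrable (lborel \<Otimes>\<^sub>M lborel) (case_prod (\<lambda>x y. g (x, y)))"
    using gi by (simp add: lborel_prod)
  have aex: "AE x in lborel. x \<in> unit_interval \<longrightarrow> (LINT y|LI. f (x, y)) = (LINT y|lborel. g (x, y))"
    using AE_lborel_Pair(1)[OF ae]
  proof eventually_elim
    case (elim x)
    show ?case
      by (intro impI LI_integral_version(2)) (use elim g0 in auto)
  qed
  have aey: "AE y in lborel. y \<in> unit_interval \<longrightarrow> (LINT x|LI. f (x, y)) = (LINT x|lborel. g (x, y))"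
    using AE_lborel_Pair(2)[OF ae]
  proof eventually_elim
    case (elim y)
    show ?case
      by (intro impI LI_integral_version(2)) (use elim g0 in auto)
  qed
  have mx: "(\<lambda>x. LINT y|lborel. g (x, y)) \<in> borel_measurable borel"
  proof -
    have "(\<lambda>x. LINT y|lborel. g (x, y)) \<in> borel_measurable lborel"
      by (rule lborel.borel_measurable_lebesgue_integral) (simp add: lborel_prod)
    then show ?thesis by simp
  qed
  have my: "(\<lambda>y. LINT x|lborel. g (x, y)) \<in> borel_measurable borel"
  proof -
    have "(\<lambda>(y, x). g (x, y)) \<in> borel_measurable (lborel \<Otimes>\<^sub>M lborel)"
      by measurable
    then have "(\<lambda>y. LINT x|lborel. g (x, y)) \<in> borel_measurable lborel"
      by (rule lborel.borel_measurable_lebesgue_integral)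
    then show ?thesis by simp
  qed
  have zx: "(LINT y|lborel. g (x, y)) = 0" if "x \<notin> unit_interval" for x
  proof -
    have "g (x, y) = 0" for y using that by (intro g0) auto
    then show ?thesis by simp
  qed
  have zy: "(LINT x|lborel. g (x, y)) = 0" if "y \<notin> unit_interval" for y
  proof -
    have "g (x, y) = 0" for x using that by (intro g0) auto
    then show ?thesis by simp
  qed
  note vx = LI_integral_version[OF mx zx aex] and vy = LI_integral_version[OF my zy aey]
  show "(\<lambda>x. LINT y|LI. f (x, y)) \<in> borel_measurable LI"
    "(\<lambda>y. LINT x|LI. f (x, y)) \<in> borel_measurable LI"
    using vx(1) vy(1) by auto
  have "integral\<^sup>L LS f = (LINT z|lebesgue. indicator unit_square z *\<^sub>R f z)"
    by (subst integral_restrict_space) auto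
  also have "\<dots> = (LINT z|lebesgue. g z)"
  proof (rule integral_cong_AE)
    show m: "g \<in> borel_measurable lebesgue" using g by (intro measurable_completion) simp
    show ae': "AE z in lebesgue. indicator unit_square z *\<^sub>R f z = g z"
      using ae g0 by (subst AE_completion_iff) (auto elim!: eventually_mono simp: indicator_def)
    show "(\<lambda>z. indicator unit_square z *\<^sub>R f z) \<in> borel_measurable lebesgue"
      by (rule measurable_AE_eq_completion[OF m ae'])
  qed
  also have "\<dots> = (LINT z|lborel. g z)"
    using g by (subst integral_completion) auto
  finally have S: "integral\<^sup>L LS f = (LINT z|lborel. g z)" .
  show "integral\<^sup>L LS f = (LINT x|LI. LINT y|LI. f (x, y))"
    using lborel_pair.integral_fst[OF gi'] vx(2) S by (simp add: lborel_prod)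
  show "integral\<^sup>L LS f = (LINT y|LI. LINT x|LI. f (x, y))"
    using lborel_pair.integral_snd[OF gi'] vy(2) S by (simp add: lborel_prod)
qed

lemma LS_integrable_bounded:
  fixes f :: "real \<times> real \<Rightarrow> real"
  assumes "f \<in> borel_measurable LS" "\<And>x. x \<in> unit_square \<Longrightarrow> \<bar>f x\<bar> \<le> B"
  shows "integrable LS f"
  using assms by (intro LS.integrable_const_bound[where B=B] AE_I2) auto

lemma LI_integrable_bounded:
  fixes f :: "real \<Rightarrow> real"
  assumes "f \<in> borel_measurable LI" "\<And>x. x \<in> unit_interval \<Longrightarrow> \<bar>f x\<bar> \<le> B"
  shows "integrable LI f"
  using assms by (intro LI.integrable_const_bound[where B=B] AE_I2) auto

text \<open>The indicator \<open>d\<close> of the set where \<open>f\<close> and \<open>g\<close>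
  differ is nonnegative, and by Fubini its integral is zero as soon as almost all its sections are
  null.\<close>

lemma AE_LS_from_vertical_sections:
  fixes f g :: "real \<times> real \<Rightarrow> real"
  assumes "f \<in> borel_measurable LS" "g \<in> borel_measurable LS"
    and "AE x in LI. AE y in LI. f (x, y) = g (x, y)"
  shows "AE z in LS. f z = g z"
proof -
  define d where "d z = (if f z = g z then 0 else 1 :: real)" for z
  have [measurable]: "f \<in> borel_measurable LS" "g \<in> borel_measurable LS" by fact+
  have dm: "d \<in> borel_measurable LS" unfolding d_def by measurable
  have d1: "\<bar>d z\<bar> \<le> 1" for z by (simp add: d_def)
  have "integral\<^sup>L LS d = (LINT x|LI. LINT y|LI. d (x, y))"
    by (rule fubini_unit_square(3)[OF dm d1])
  also have "\<dots> = (LINT x|LI. 0)"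
  proof (rule integral_cong_AE)
    show "AE x in LI. (LINT y|LI. d (x, y)) = 0"
      using assms(3)
    proof eventually_elim
      case (elim x)
      then have "AE y in LI. d (x, y) = 0" by eventually_elim (simp add: d_def)
      then show ?case by (rule integral_eq_zero_AE)
    qed
  qed (use fubini_unit_square(1)[OF dm d1] in auto)
  finally have "integral\<^sup>L LS d = 0" by simp
  moreover have "integrable LS d" by (rule LS_integrable_bounded[OF dm d1])
  ultimately have "AE z in LS. d z = 0"
    by (subst (asm) integral_nonneg_eq_0_iff_AE) (auto simp: d_def)
  then show ?thesis by eventually_elim (simp add: d_def split: if_splits)
qed

lemma AE_LS_from_horizontal_sections:
  fixes f g :: "real \<times> real \<Rightarrow> real"
  assumes "f \<in> borel_measurable LS" "g \<in> borel_measurable LS"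
    and "AE y in LI. AE x in LI. f (x, y) = g (x, y)"
  shows "AE z in LS. f z = g z"
proof -
  define d where "d z = (if f z = g z then 0 else 1 :: real)" for z
  have [measurable]: "f \<in> borel_measurable LS" "g \<in> borel_measurable LS" by fact+
  have dm: "d \<in> borel_measurable LS" unfolding d_def by measurable
  have d1: "\<bar>d z\<bar> \<le> 1" for z by (simp add: d_def)
  have "integral\<^sup>L LS d = (LINT y|LI. LINT x|LI. d (x, y))"
    by (rule fubini_unit_square(4)[OF dm d1])
  also have "\<dots> = (LINT y|LI. 0)"
  proof (rule integral_cong_AE)
    show "AE y in LI. (LINT x|LI. d (x, y)) = 0"
      using assms(3)
    proof eventually_elim
      case (elim y)
      then have "AE x in LI. d (x, y) = 0" by eventually_elim (simp add: d_def)
      then show ?case by (rule integral_eq_zero_AE)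
    qed
  qed (use fubini_unit_square(2)[OF dm d1] in auto)
  finally have "integral\<^sup>L LS d = 0" by simp
  moreover have "integrable LS d" by (rule LS_integrable_bounded[OF dm d1])
  ultimately have "AE z in LS. d z = 0"
    by (subst (asm) integral_nonneg_eq_0_iff_AE) (auto simp: d_def)
  then show ?thesis by eventually_elim (simp add: d_def split: if_splits)
qed

section \<open>Lebesgue measurability of up-sets and monotone functions\<close>

lemma mono_on_measurable_LI:
  fixes g :: "real \<Rightarrow> real"
  assumes "mono_on unit_interval g"
  shows "g \<in> borel_measurable LI"
proof (rule borel_measurable_subalgebra)
  show "sets (restrict_space borel unit_interval) \<subseteq> sets LI"
    unfolding sets_restrict_space by (intro image_mono) auto
  show "g \<in> borel_measurable (restrict_space borel unit_interval)"
    using assms by (rule borel_measurable_mono_on_fnc)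
qed (simp add: space_restrict_space)

text \<open>The lower boundary \<open>a\<close> of the sections is nonincreasing, hence Borel, so
  the region strictly above its graph is Borel. An up-set agrees with that region off the graph, and
  the graph is a null set; completeness does the rest.\<close>

lemma up_set_sets:
  assumes "up_set A"
  shows "A \<in> sets lebesgue"
proof -
  \<comment> \<open>\<open>insert 1\<close> gives the infimum the value 1 for an empty section; the
    clamp \<open>c\<close> extends the boundary to a monotone function on the whole line.\<close>
  define a where "a x = Inf (insert 1 {y \<in> unit_interval. (x, y) \<in> A})" for x
  define c where "c x = max 0 (min 1 x)" for x :: real
  have bdd: "bdd_below (insert 1 {y \<in> unit_interval. (x, y) \<in> A})" for x
    by (rule bdd_belowI[of _ 0]) auto
  have "mono (\<lambda>x. - a (c x))"
  proof
    fix x x' :: real assume le: "x \<le> x'"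
    have "a (c x') \<le> a (c x)"
      unfolding a_def
    proof (rule cInf_superset_mono)
      show "insert 1 {y \<in> unit_interval. (c x, y) \<in> A} \<subseteq> insert 1 {y \<in> unit_interval. (c x', y) \<in> A}"
      proof -
        have "(c x', y) \<in> A" if "(c x, y) \<in> A" "y \<in> unit_interval" for y
        proof -
          have "(c x', y) \<in> unit_square" "(c x, y) \<le> (c x', y)"
            using le that(2) by (auto simp: c_def)
          with that(1) assms show ?thesis unfolding up_set_def by blast
        qed
        then show ?thesis by auto
      qed
    qed (use bdd in auto)
    then show "- a (c x) \<le> - a (c x')" by simp
  qed
  then have "(\<lambda>x. - a (c x)) \<in> borel_measurable borel" by (rule borel_measurable_mono)
  then have "(\<lambda>x. a (c x)) \<in> borel_measurable borel" by simp
  moreover define b where "b x = a (c x)" for x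
  ultimately have [measurable]: "b \<in> borel_measurable borel" by (simp add: b_def[abs_def])
  define U where "U = {z::real\<times>real. z \<in> unit_square \<and> b (fst z) < snd z}"
  define G where "G = {z::real\<times>real. b (fst z) = snd z}"
  have m1: "(\<lambda>z::real\<times>real. b (fst z)) \<in> borel_measurable borel"
    by (rule measurable_compose[of fst borel borel])
       (auto intro!: borel_measurable_continuous_onI continuous_intros)
  have m2: "(snd :: real\<times>real \<Rightarrow> real) \<in> borel_measurable borel"
    by (auto intro!: borel_measurable_continuous_onI continuous_intros)
  have G: "G \<in> sets borel" unfolding G_def using borel_measurable_eq[OF m1 m2] by simp
  have U: "U \<in> sets borel"
  proof -
    have "U = unit_square \<inter> {z. b (fst z) < snd z}" by (auto simp: U_def)
    moreover have "{z::real\<times>real. b (fst z) < snd z} \<in> sets borel"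
      using borel_measurable_less[OF m1 m2] by simp
    ultimately show ?thesis by auto
  qed
  have "AE z in lborel \<Otimes>\<^sub>M lborel. z \<notin> G"
  proof (rule lborel_pair.AE_pair_measure)
    have "{z \<in> space lborel. z \<notin> G} = - G" by auto
    then show "{z \<in> space (lborel \<Otimes>\<^sub>M lborel). z \<notin> G} \<in> sets (lborel \<Otimes>\<^sub>M lborel)"
      unfolding lborel_prod using G by auto
    show "AE x in lborel. AE y in lborel. (x, y) \<notin> G"
    proof (rule AE_I2)
      fix x :: real
      have "AE y in lborel. y \<noteq> a (c x)" by (rule AE_lborel_singleton)
      then show "AE y in lborel. (x, y) \<notin> G" by eventually_elim (auto simp: G_def b_def)
    qed
  qed
  then have "AE z in lborel. z \<notin> G" unfolding lborel_prod .
  then have aeG: "AE z in lebesgue. z \<notin> G" by (simp add: AE_completion_iff)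
  show ?thesis
  proof (rule completion.in_sets_AE)
    show "U \<in> sets lebesgue" using U by auto
    show "AE z in lebesgue. (z \<in> U) = (z \<in> A)"
      using aeG
    proof eventually_elim
      case (elim z)
      obtain x y where z: "z = (x, y)" by force
      have ne: "a (c x) \<noteq> y" using elim z by (auto simp: G_def b_def)
      show ?case
      proof
        assume "z \<in> U"
        then have xy: "x \<in> unit_interval" "y \<in> unit_interval" "a (c x) < y" by (auto simp: U_def b_def z)
        then have cx: "c x = x" by (auto simp: c_def)
        obtain y' where "y' \<in> insert 1 {y \<in> unit_interval. (x, y) \<in> A}" "y' < y"
          using xy(3) unfolding cx a_def by (meson cInf_lessD insert_not_empty)
        then have "(x, y') \<in> A" "y' \<le> y" using xy by auto
        then show "z \<in> A" using assms xy unfolding up_set_def z by fastforce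
      next
        assume "z \<in> A"
        then have xy: "x \<in> unit_interval" "y \<in> unit_interval" using assms unfolding up_set_def z by auto
        then have cx: "c x = x" by (auto simp: c_def)
        have "a x \<le> y" unfolding a_def
          by (rule cInf_lower[OF _ bdd]) (use \<open>z \<in> A\<close> xy in \<open>auto simp: z\<close>)
        with ne cx xy show "z \<in> U" by (auto simp: U_def b_def z)
      qed
    qed
  qed auto
qed

lemma mono_on_measurable_LS:
  fixes f :: "real \<times> real \<Rightarrow> real"
  assumes "mono_on unit_square f"
  shows "f \<in> borel_measurable LS"
proof (subst borel_measurable_iff_ge, intro allI)
  fix s :: real
  have "up_set {z \<in> unit_square. s \<le> f z}"
    unfolding up_set_def
    using monotone_onD[OF assms] by (auto intro: order_trans)
  from up_set_sets[OF this] show "{w \<in> space LS. s \<le> f w} \<in> sets LS"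
    by (subst sets_restrict_space_iff) auto
qed

section \<open>Monotone matrices with prescribed margins, and Riemann sums\<close>

text \<open>Row \<open>i\<close> exceeds row \<open>i'\<close> in column \<open>j\<close> although
  its total is not larger, so it is smaller in another column \<open>j'\<close>. Moving mass
  \<open>e\<close> around these four entries keeps all margins and makes the entries more equal
  within each column, which lowers the sum of squares.\<close>

lemma exchange_matrix:
  fixes N :: "nat \<Rightarrow> nat \<Rightarrow> real"
  assumes b: "\<And>a b. 0 \<le> N a b \<and> N a b \<le> 1"
    and i: "i < n" "i' < n" and j: "j < n" and gt: "N i' j < N i j"
    and le: "(\<Sum>b<n. N i b) \<le> (\<Sum>b<n. N i' b)"
  shows "\<exists>N'. (\<forall>a b. 0 \<le> N' a b \<and> N' a b \<le> 1) \<and>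
    (\<forall>a. (\<Sum>b<n. N' a b) = (\<Sum>b<n. N a b)) \<and> (\<forall>b. (\<Sum>a<n. N' a b) = (\<Sum>a<n. N a b)) \<and>
    (\<Sum>a<n. \<Sum>b<n. (N' a b)\<^sup>2) < (\<Sum>a<n. \<Sum>b<n. (N a b)\<^sup>2)"
proof -
  have "\<exists>j'<n. N i j' < N i' j'"
  proof (rule ccontr)
    assume "\<not> ?thesis"
    then have "N i' j' \<le> N i j'" if "j' < n" for j' using that by force
    then have "(\<Sum>b<n. N i' b) < (\<Sum>b<n. N i b)"
      using j gt by (intro sum_strict_mono_ex1) auto
    with le show False by simp
  qed
  then obtain j' where j': "j' < n" "N i j' < N i' j'" by blast
  have ne: "i \<noteq> i'" "j \<noteq> j'" using gt j' by auto
  \<comment> \<open>Half of the smaller gap: neither pair moves past equality, so the entries stay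
    in the unit interval, and the linear gain of at least \<open>8 * e\<^sup>2\<close> in the sum of
    squares beats the quadratic cost \<open>4 * e\<^sup>2\<close>.\<close>
  define e where "e = min (N i j - N i' j) (N i' j' - N i j') / 2"
  have e: "0 < e" "2 * e \<le> N i j - N i' j" "2 * e \<le> N i' j' - N i j'"
    using gt j' by (auto simp: e_def)
  \<comment> \<open>The exchange is a rank-one matrix built from signed indicators of two rows and
    two columns, so its row and column sums vanish.\<close>
  define u where "u a = (if a = i' then 1 else if a = i then - 1 else 0 :: real)" for a
  define v where "v b = (if b = j then 1 else if b = j' then - 1 else 0 :: real)" for b
  define N' where "N' a b = N a b + e * (u a * v b)" for a b
  have su: "(\<Sum>a<n. u a * f a) = f i' - f i" for f
  proof -
    have "(\<Sum>a<n. u a * f a) = (\<Sum>a\<in>{i, i'}. u a * f a)"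
      using i by (intro sum.mono_neutral_right) (auto simp: u_def)
    then show ?thesis using ne by (simp add: u_def)
  qed
  have sv: "(\<Sum>b<n. v b * f b) = f j - f j'" for f
  proof -
    have "(\<Sum>b<n. v b * f b) = (\<Sum>b\<in>{j, j'}. v b * f b)"
      using j j' by (intro sum.mono_neutral_right) (auto simp: v_def)
    then show ?thesis using ne by (simp add: v_def)
  qed
  have su0: "(\<Sum>a<n. u a) = 0" using su[of "\<lambda>_. 1"] by simp
  have sv0: "(\<Sum>b<n. v b) = 0" using sv[of "\<lambda>_. 1"] by simp
  show ?thesis
  proof (intro exI[of _ N'] conjI allI)
    fix a b
    have "N i j \<le> 1" "0 \<le> N i' j" "N i' j' \<le> 1" "0 \<le> N i j'"
      "0 \<le> N a b" "N a b \<le> 1" using assms(1) by blast+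
    then show "0 \<le> N' a b" "N' a b \<le> 1"
      using e ne by (auto simp: N'_def u_def v_def)
  next
    fix a
    show "(\<Sum>b<n. N' a b) = (\<Sum>b<n. N a b)"
      unfolding N'_def sum.distrib sum_distrib_left[symmetric] by (simp add: sv0)
  next
    fix b
    show "(\<Sum>a<n. N' a b) = (\<Sum>a<n. N a b)"
      unfolding N'_def sum.distrib sum_distrib_left[symmetric] sum_distrib_right[symmetric] by (simp add: su0)
  next
    have "(\<Sum>a<n. \<Sum>b<n. (N' a b)\<^sup>2) =
        (\<Sum>a<n. \<Sum>b<n. (N a b)\<^sup>2) + 2 * e * (\<Sum>a<n. u a * (\<Sum>b<n. v b * N a b))
        + e\<^sup>2 * (\<Sum>a<n. u a * (u a * (\<Sum>b<n. v b * v b)))"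
      unfolding N'_def sum_distrib_left sum.distrib[symmetric]
      by (intro sum.cong refl) (simp add: power2_eq_square algebra_simps)
    also have "(\<Sum>a<n. u a * (\<Sum>b<n. v b * N a b)) = - (N i j - N i' j) - (N i' j' - N i j')"
      unfolding sv su by simp
    also have "(\<Sum>a<n. u a * (u a * (\<Sum>b<n. v b * v b))) = 4"
      unfolding sv su using ne by (simp add: u_def v_def)
    finally have E: "(\<Sum>a<n. \<Sum>b<n. (N' a b)\<^sup>2) = (\<Sum>a<n. \<Sum>b<n. (N a b)\<^sup>2)
      + 2 * e * (- (N i j - N i' j) - (N i' j' - N i j')) + e\<^sup>2 * 4" .
    have "2 * e * (- (N i j - N i' j) - (N i' j' - N i j')) + e\<^sup>2 * 4 < 0"
    proof -
      have "2 * e * (- (N i j - N i' j) - (N i' j' - N i j')) \<le> 2 * e * (- (4 * e))"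
        using e by (intro mult_left_mono) auto
      moreover have "2 * e * (- (4 * e)) + e\<^sup>2 * 4 < 0" using e(1) by (simp add: power2_eq_square)
      ultimately show ?thesis by linarith
    qed
    with E show "(\<Sum>a<n. \<Sum>b<n. (N' a b)\<^sup>2) < (\<Sum>a<n. \<Sum>b<n. (N a b)\<^sup>2)" by linarith
  qed
qed

lemma compact_Pi_unit: "compact {F :: 'a \<Rightarrow> real. \<forall>z. F z \<in> {0..1}}"
proof -
  have "compactin (product_topology (\<lambda>_. euclidean) UNIV) (PiE UNIV (\<lambda>_::'a. {0..1::real}))"
    unfolding compactin_PiE by simp
  moreover have "PiE UNIV (\<lambda>_::'a. {0..1::real}) = {F. \<forall>z. F z \<in> {0..1}}" by auto
  ultimately show ?thesis by (simp add: euclidean_product_topology)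
qed

text \<open>The prescribed margins are themselves nondecreasing, which lets
  \<open>exchange_matrix\<close> apply to any two entries in the wrong order and contradict
  minimality; for entries of one row it is applied to the transpose.\<close>

lemma monotone_matrix_exists:
  fixes M :: "nat \<Rightarrow> nat \<Rightarrow> real"
  assumes b: "\<And>a b. 0 \<le> M a b \<and> M a b \<le> 1"
    and row: "\<And>i i'. i \<le> i' \<Longrightarrow> i' < n \<Longrightarrow> (\<Sum>b<n. M i b) \<le> (\<Sum>b<n. M i' b)"
    and col: "\<And>j j'. j \<le> j' \<Longrightarrow> j' < n \<Longrightarrow> (\<Sum>a<n. M a j) \<le> (\<Sum>a<n. M a j')"
  obtains N :: "nat \<Rightarrow> nat \<Rightarrow> real" where "\<And>a b. 0 \<le> N a b \<and> N a b \<le> 1"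
    "\<And>a. (\<Sum>b<n. N a b) = (\<Sum>b<n. M a b)" "\<And>b. (\<Sum>a<n. N a b) = (\<Sum>a<n. M a b)"
    "\<And>i i' j. i \<le> i' \<Longrightarrow> i' < n \<Longrightarrow> j < n \<Longrightarrow> N i j \<le> N i' j"
    "\<And>i j j'. j \<le> j' \<Longrightarrow> j' < n \<Longrightarrow> i < n \<Longrightarrow> N i j \<le> N i j'"
proof -
  define S :: "(nat \<times> nat \<Rightarrow> real) set" where "S = {F. \<forall>z. F z \<in> {0..1}} \<inter>
    {F. \<forall>a. (\<Sum>b<n. F (a, b)) = (\<Sum>b<n. M a b)} \<inter> {F. \<forall>b. (\<Sum>a<n. F (a, b)) = (\<Sum>a<n. M a b)}"
  have cS: "compact S"
    unfolding S_def
    by (intro compact_Int_closed compact_Pi_unit closed_Collect_all closed_Collect_eq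
        continuous_on_sum continuous_on_product_coordinates continuous_on_const)
  have "(\<lambda>(a, b). M a b) \<in> S" using b by (auto simp: S_def)
  then have "S \<noteq> {}" by blast
  moreover have "continuous_on S (\<lambda>F. \<Sum>a<n. \<Sum>b<n. (F (a, b))\<^sup>2)"
    by (intro continuous_on_sum continuous_on_power)
       (rule continuous_on_subset[OF continuous_on_product_coordinates], simp)
  ultimately obtain F where F: "F \<in> S"
    and min: "\<And>G. G \<in> S \<Longrightarrow> (\<Sum>a<n. \<Sum>b<n. (F (a, b))\<^sup>2) \<le> (\<Sum>a<n. \<Sum>b<n. (G (a, b))\<^sup>2)"
    using continuous_attains_inf[OF cS] by blast
  define N where "N a b = F (a, b)" for a b
  have Nb: "0 \<le> N a b \<and> N a b \<le> 1" for a b using F by (auto simp: S_def N_def)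
  have Nr: "(\<Sum>b<n. N a b) = (\<Sum>b<n. M a b)" for a using F by (auto simp: S_def N_def)
  have Nc: "(\<Sum>a<n. N a b) = (\<Sum>a<n. M a b)" for b using F by (auto simp: S_def N_def)
  have noex: False
    if "\<And>a b. 0 \<le> N' a b \<and> N' a b \<le> 1" "\<And>a. (\<Sum>b<n. N' a b) = (\<Sum>b<n. N a b)"
      "\<And>b. (\<Sum>a<n. N' a b) = (\<Sum>a<n. N a b)"
      "(\<Sum>a<n. \<Sum>b<n. (N' a b)\<^sup>2) < (\<Sum>a<n. \<Sum>b<n. (N a b)\<^sup>2)" for N'
  proof -
    have "(\<lambda>(a, b). N' a b) \<in> S" using that(1-3) Nr Nc by (auto simp: S_def)
    from min[OF this] that(4) show False by (simp add: N_def)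
  qed
  show ?thesis
  proof
    fix i i' j assume i: "i \<le> i'" "i' < n" "j < n"
    show "N i j \<le> N i' j"
    proof (rule ccontr)
      assume "\<not> N i j \<le> N i' j"
      moreover have "(\<Sum>b<n. N i b) \<le> (\<Sum>b<n. N i' b)" unfolding Nr using i by (intro row)
      ultimately show False
        using exchange_matrix[of N i n i' j] Nb i noex by force
    qed
  next
    fix i j j' assume j: "j \<le> j'" "j' < n" "i < n"
    show "N i j \<le> N i j'"
    proof (rule ccontr)
      assume "\<not> N i j \<le> N i j'"
      moreover have "(\<Sum>a<n. N a j) \<le> (\<Sum>a<n. N a j')" unfolding Nc using j by (intro col)
      ultimately obtain N' where N': "\<forall>a b. 0 \<le> N' a b \<and> N' a b \<le> 1"
        "\<forall>a. (\<Sum>b<n. N' a b) = (\<Sum>b<n. N b a)" "\<forall>b. (\<Sum>a<n. N' a b) = (\<Sum>a<n. N b a)"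
        "(\<Sum>a<n. \<Sum>b<n. (N' a b)\<^sup>2) < (\<Sum>a<n. \<Sum>b<n. (N b a)\<^sup>2)"
        using exchange_matrix[of "\<lambda>a b. N b a" j n j' i] Nb j by force
      show False
      proof (rule noex[of "\<lambda>a b. N' b a"])
        have "(\<Sum>a<n. \<Sum>b<n. (N' b a)\<^sup>2) = (\<Sum>a<n. \<Sum>b<n. (N' a b)\<^sup>2)" by (rule sum.swap)
        moreover have "(\<Sum>a<n. \<Sum>b<n. (N b a)\<^sup>2) = (\<Sum>a<n. \<Sum>b<n. (N a b)\<^sup>2)" by (rule sum.swap)
        ultimately show "(\<Sum>a<n. \<Sum>b<n. (N' b a)\<^sup>2) < (\<Sum>a<n. \<Sum>b<n. (N a b)\<^sup>2)" using N'(4) by simp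
      qed (use N' in auto)
    qed
  qed (use Nb Nr Nc in auto)
qed

section \<open>Grid cells and Riemann sums\<close>

definition cell_index :: "nat \<Rightarrow> real \<Rightarrow> nat" where
  "cell_index n x = nat \<lfloor>real n * x\<rfloor>"

definition in_cell :: "nat \<Rightarrow> nat \<Rightarrow> real \<Rightarrow> real" where
  "in_cell n i x = of_bool (cell_index n x = i)"

lemma in_cell_measurable [measurable]: "in_cell n i \<in> borel_measurable borel"
  unfolding in_cell_def cell_index_def by measurable

text \<open>Cells are half-open, so the point 1 has index \<open>n\<close> and lies in none of the
  \<open>n\<close> cells; later it is either discarded as a null set or sent to the last
  cell.\<close>

lemma cell_index_less: "0 \<le> x \<Longrightarrow> x < 1 \<Longrightarrow> 0 < n \<Longrightarrow> cell_index n x < n"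
proof -
  assume "0 \<le> x" "x < 1" "0 < n"
  then have "real n * x < real n" by simp
  then show ?thesis unfolding cell_index_def using \<open>0 \<le> x\<close> \<open>0 < n\<close> by (simp add: nat_less_iff floor_less_iff)
qed

lemma cell_index_mono: "x \<le> y \<Longrightarrow> cell_index n x \<le> cell_index n y"
  unfolding cell_index_def by (intro nat_mono floor_mono mult_left_mono) auto

lemma cell_index_bounds:
  assumes "0 \<le> x" "0 < n"
  shows "real (cell_index n x) / real n \<le> x" "x < (real (cell_index n x) + 1) / real n"
proof -
  have "real (cell_index n x) = of_int \<lfloor>real n * x\<rfloor>"
    unfolding cell_index_def using assms by simp
  moreover have "of_int \<lfloor>real n * x\<rfloor> \<le> real n * x" "real n * x < of_int \<lfloor>real n * x\<rfloor> + 1" by linarith+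
  ultimately show "real (cell_index n x) / real n \<le> x" "x < (real (cell_index n x) + 1) / real n"
    using assms by (auto simp: field_simps)
qed

lemma cell_index_eq_iff:
  assumes "0 \<le> x" "0 < n"
  shows "cell_index n x = i \<longleftrightarrow> x \<in> {real i / real n..<(real i + 1) / real n}"
proof
  assume "cell_index n x = i" then show "x \<in> {real i / real n..<(real i + 1) / real n}"
    using cell_index_bounds[OF assms] by auto
next
  assume "x \<in> {real i / real n..<(real i + 1) / real n}"
  then have "real i \<le> real n * x" "real n * x < real i + 1" using assms by (auto simp: field_simps)
  then have "\<lfloor>real n * x\<rfloor> = int i" by linarith
  then show "cell_index n x = i" by (simp add: cell_index_def)
qed

lemma sum_in_cell: "0 \<le> x \<Longrightarrow> x < 1 \<Longrightarrow> 0 < n \<Longrightarrow> (\<Sum>i<n. in_cell n i x) = 1"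
  using cell_index_less[of x n] by (simp add: in_cell_def)

lemma in_cell_nonneg [simp]: "0 \<le> in_cell n i x" and in_cell_le_one [simp]: "in_cell n i x \<le> 1"
  by (auto simp: in_cell_def)

lemma in_cell_measurable_LI [measurable]: "in_cell n i \<in> borel_measurable LI"
  by (intro measurable_restrict_space1 measurable_completion) simp

lemma integral_in_cell:
  assumes "i < n"
  shows "(LINT x|LI. in_cell n i x) = 1 / n"
proof -
  have n: "0 < n" using assms by simp
  have sub: "{real i / real n..<(real i + 1) / real n} \<subseteq> unit_interval"
  proof -
    have "0 \<le> real i / real n" "(real i + 1) / real n \<le> 1" using assms by (auto simp: field_simps)
    then show ?thesis by (smt (verit) atLeastAtMost_iff atLeastLessThan_iff subsetI)
  qed
  have "(LINT x|LI. in_cell n i x) = (LINT x|lebesgue. indicator unit_interval x *\<^sub>R in_cell n i x)"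
    by (subst integral_restrict_space) auto
  also have "\<dots> = (LINT x|lebesgue. indicator {real i / real n..<(real i + 1) / real n} x)"
    using sub cell_index_eq_iff[OF _ n, of _ i]
    by (intro Bochner_Integration.integral_cong refl) (auto simp: indicator_def in_cell_def)
  also have "\<dots> = 1 / n"
    using n by (simp add: divide_right_mono diff_divide_distrib[symmetric])
  finally show ?thesis .
qed

lemma integrable_in_cell_mult:
  assumes g: "g \<in> borel_measurable LI" "\<And>x. x \<in> unit_interval \<Longrightarrow> \<bar>g x\<bar> \<le> B"
  shows "integrable LI (\<lambda>x. in_cell n i x * g x)"
proof (rule LI_integrable_bounded)
  show "(\<lambda>x. in_cell n i x * g x) \<in> borel_measurable LI" using g(1) by measurable
  show "\<bar>in_cell n i x * g x\<bar> \<le> B" if "x \<in> unit_interval" for x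
    using g(2)[OF that] by (auto simp: in_cell_def)
qed

lemma integral_cells:
  assumes g: "g \<in> borel_measurable LI" "\<And>x. x \<in> unit_interval \<Longrightarrow> \<bar>g x\<bar> \<le> B" and n: "0 < n"
  shows "integral\<^sup>L LI g = (\<Sum>i<n. LINT x|LI. in_cell n i x * g x)"
proof -
  have "(\<Sum>i<n. LINT x|LI. in_cell n i x * g x) = (LINT x|LI. (\<Sum>i<n. in_cell n i x * g x))"
    by (rule Bochner_Integration.integral_sum[symmetric]) (rule integrable_in_cell_mult[OF g])
  also have "\<dots> = integral\<^sup>L LI g"
  proof (rule integral_cong_AE)
    have "AE x in LI. x \<in> unit_interval \<and> x \<noteq> 1"
      using AE_LI_neq[of 1] AE_space[of LI] by eventually_elim simp
    then show "AE x in LI. (\<Sum>i<n. in_cell n i x * g x) = g x"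
    proof eventually_elim
      case (elim x)
      then show ?case using sum_in_cell[of x n] n by (simp add: sum_distrib_right[symmetric])
    qed
  qed (use g(1) in measurable)
  finally show ?thesis by simp
qed

lemma integral_cell_bounds:
  assumes g: "g \<in> borel_measurable LI" "\<And>x. x \<in> unit_interval \<Longrightarrow> \<bar>g x\<bar> \<le> B" and i: "i < n"
    and lo: "\<And>x. x \<in> unit_interval \<Longrightarrow> cell_index n x = i \<Longrightarrow> lo \<le> g x \<and> g x \<le> hi"
  shows "lo / n \<le> (LINT x|LI. in_cell n i x * g x)" "(LINT x|LI. in_cell n i x * g x) \<le> hi / n"
proof -
  note int = integrable_in_cell_mult[OF g]
  have const: "integrable LI (\<lambda>x. in_cell n i x * c)" for c :: real
    by (rule integrable_in_cell_mult[where B="\<bar>c\<bar>"]) auto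
  have "lo / n = (LINT x|LI. in_cell n i x * lo)" using integral_in_cell[OF i] by simp
  also have "\<dots> \<le> (LINT x|LI. in_cell n i x * g x)"
    using lo by (intro integral_mono int const) (auto simp: in_cell_def)
  finally show "lo / n \<le> (LINT x|LI. in_cell n i x * g x)" .
  have "(LINT x|LI. in_cell n i x * g x) \<le> (LINT x|LI. in_cell n i x * hi)"
    using lo by (intro integral_mono int const) (auto simp: in_cell_def)
  also have "\<dots> = hi / n" using integral_in_cell[OF i] by simp
  finally show "(LINT x|LI. in_cell n i x * g x) \<le> hi / n" .
qed

lemma mono_cell_bounds:
  assumes g: "mono_on unit_interval g" "g ` unit_interval \<subseteq> {0..1 :: real}" and i: "i < n"
  shows "g (i / n) / n \<le> (LINT x|LI. in_cell n i x * g x)"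
    "(LINT x|LI. in_cell n i x * g x) \<le> g ((real i + 1) / n) / n"
proof -
  have *: "g (i / n) \<le> g x \<and> g x \<le> g ((real i + 1) / n)" if x: "x \<in> unit_interval" "cell_index n x = i" for x
  proof -
    have "real i / n \<in> unit_interval" "(real i + 1) / n \<in> unit_interval" using i by (auto simp: field_simps)
    then show ?thesis
      using cell_index_bounds[of x n] x i by (auto intro!: monotone_onD[OF g(1)])
  qed
  have gb: "\<bar>g x\<bar> \<le> 1" if "x \<in> unit_interval" for x using that g(2) by (auto simp: image_subset_iff)
  show "g (i / n) / n \<le> (LINT x|LI. in_cell n i x * g x)"
    "(LINT x|LI. in_cell n i x * g x) \<le> g ((real i + 1) / n) / n"
    using integral_cell_bounds[OF mono_on_measurable_LI[OF g(1)] gb i, of "g (i / n)" "g ((real i + 1) / n)"] *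
    by auto
qed

lemma riemann_sum_bounds:
  assumes g: "mono_on unit_interval g" "g ` unit_interval \<subseteq> {0..1 :: real}" and k: "0 < k"
  shows "(\<Sum>i<k. g (real i / k)) / k \<le> integral\<^sup>L LI g"
    "integral\<^sup>L LI g \<le> (\<Sum>i<k. g ((real i + 1) / k)) / k"
proof -
  have gb: "\<bar>g x\<bar> \<le> 1" if "x \<in> unit_interval" for x using that g(2) by (auto simp: image_subset_iff)
  have eq: "integral\<^sup>L LI g = (\<Sum>i<k. LINT x|LI. in_cell k i x * g x)"
    using mono_on_measurable_LI[OF g(1)] gb k by (rule integral_cells)
  show "(\<Sum>i<k. g (real i / k)) / k \<le> integral\<^sup>L LI g"
    unfolding eq sum_divide_distrib by (intro sum_mono mono_cell_bounds[OF g]) auto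
  show "integral\<^sup>L LI g \<le> (\<Sum>i<k. g ((real i + 1) / k)) / k"
    unfolding eq sum_divide_distrib by (intro sum_mono mono_cell_bounds[OF g]) auto
qed

section \<open>Existence of monotone rationalizations\<close>

lemma borel_fst_snd_LS:
  assumes "u \<in> borel_measurable borel"
  shows "(\<lambda>z. u (fst z)) \<in> borel_measurable LS" "(\<lambda>z. u (snd z)) \<in> borel_measurable LS"
proof -
  have "(\<lambda>z::real\<times>real. u (fst z)) \<in> borel_measurable borel"
    by (rule measurable_compose[of fst borel borel, OF _ assms])
       (auto intro!: borel_measurable_continuous_onI continuous_intros)
  then show "(\<lambda>z. u (fst z)) \<in> borel_measurable LS"
    by (intro measurable_restrict_space1 measurable_completion) simp
  have "(\<lambda>z::real\<times>real. u (snd z)) \<in> borel_measurable borel"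
    by (rule measurable_compose[of snd borel borel, OF _ assms])
       (auto intro!: borel_measurable_continuous_onI continuous_intros)
  then show "(\<lambda>z. u (snd z)) \<in> borel_measurable LS"
    by (intro measurable_restrict_space1 measurable_completion) simp
qed

lemma borel_LI: "u \<in> borel_measurable borel \<Longrightarrow> u \<in> borel_measurable LI"
  by (intro measurable_restrict_space1 measurable_completion) simp

lemma integral_fst_snd_weight:
  fixes f :: "real \<times> real \<Rightarrow> real"
  assumes f: "f \<in> borel_measurable LS" "\<And>z. z \<in> unit_square \<Longrightarrow> \<bar>f z\<bar> \<le> B"
    and u: "u \<in> borel_measurable borel" "\<And>x. x \<in> unit_interval \<Longrightarrow> \<bar>u x\<bar> \<le> C"
  shows "(LINT z|LS. f z * u (fst z)) = (LINT x|LI. (LINT y|LI. f (x, y)) * u x)"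
    "(LINT z|LS. f z * u (snd z)) = (LINT y|LI. (LINT x|LI. f (x, y)) * u y)"
proof -
  have b: "\<bar>f (x, y) * u x\<bar> \<le> B * C" "\<bar>f (x, y) * u y\<bar> \<le> B * C" if "(x, y) \<in> unit_square" for x y
    unfolding abs_mult using f(2)[OF that] u(2)[of x] u(2)[of y] that
    by (auto intro!: mult_mono intro: order_trans[OF abs_ge_zero])
  note m = borel_fst_snd_LS[OF u(1)]
  have "(LINT z|LS. f z * u (fst z)) = (LINT x|LI. LINT y|LI. f (x, y) * u (fst (x, y)))"
    by (rule fubini_unit_square(3)[where B="B * C"]) (use f m(1) b in auto)
  then show "(LINT z|LS. f z * u (fst z)) = (LINT x|LI. (LINT y|LI. f (x, y)) * u x)" by simp
  have "(LINT z|LS. f z * u (snd z)) = (LINT y|LI. LINT x|LI. f (x, y) * u (snd (x, y)))"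
    by (rule fubini_unit_square(4)[where B="B * C"]) (use f m(2) b in auto)
  then show "(LINT z|LS. f z * u (snd z)) = (LINT y|LI. (LINT x|LI. f (x, y)) * u y)" by simp
qed

text \<open>The almost everywhere identities for the margins, tested against a weight of one
  coordinate. With a cell indicator as weight they give the row and column sums of the cell
  averages.\<close>

lemma rationalizes_integral:
  assumes f: "rationalizes f q"
    and u: "u \<in> borel_measurable borel" "\<And>x. x \<in> unit_interval \<Longrightarrow> \<bar>u x\<bar> \<le> C"
  shows "mono_on unit_interval (fst q) \<Longrightarrow> (LINT z|LS. f z * u (fst z)) = (LINT x|LI. fst q x * u x)"
    "mono_on unit_interval (snd q) \<Longrightarrow> (LINT z|LS. f z * u (snd z)) = (LINT y|LI. snd q y * u y)"
proof -
  have fb: "\<bar>f z\<bar> \<le> 1" if "z \<in> unit_square" for z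
    using f that unfolding rationalizes_def image_subset_iff by (smt (verit) atLeastAtMost_iff)
  have fm: "f \<in> borel_measurable LS" using f by (simp add: rationalizes_def)
  note um = borel_LI[OF u(1)]
  have m: "(\<lambda>x. LINT y|LI. f (x, y)) \<in> borel_measurable LI" "(\<lambda>y. LINT x|LI. f (x, y)) \<in> borel_measurable LI"
    using fubini_unit_square(1,2)[of f 1] fm fb by auto
  show "(LINT z|LS. f z * u (fst z)) = (LINT x|LI. fst q x * u x)" if q: "mono_on unit_interval (fst q)"
  proof -
    have "(LINT z|LS. f z * u (fst z)) = (LINT x|LI. (LINT y|LI. f (x, y)) * u x)"
      using fm fb u by (rule integral_fst_snd_weight(1))
    also have "\<dots> = (LINT x|LI. fst q x * u x)"
    proof (rule integral_cong_AE)
      have "AE x in LI. fst q x = (LINT y|LI. f (x, y))" using f by (simp add: rationalizes_def)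
      then show "AE x in LI. (LINT y|LI. f (x, y)) * u x = fst q x * u x"
        by eventually_elim simp
    qed (use mono_on_measurable_LI[OF q] m um in measurable)
    finally show ?thesis .
  qed
  show "(LINT z|LS. f z * u (snd z)) = (LINT y|LI. snd q y * u y)" if q: "mono_on unit_interval (snd q)"
  proof -
    have "(LINT z|LS. f z * u (snd z)) = (LINT y|LI. (LINT x|LI. f (x, y)) * u y)"
      using fm fb u by (rule integral_fst_snd_weight(2))
    also have "\<dots> = (LINT y|LI. snd q y * u y)"
    proof (rule integral_cong_AE)
      have "AE y in LI. snd q y = (LINT x|LI. f (x, y))" using f by (simp add: rationalizes_def)
      then show "AE y in LI. (LINT x|LI. f (x, y)) * u y = snd q y * u y"
        by eventually_elim simp
    qed (use mono_on_measurable_LI[OF q] m um in measurable)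
    finally show ?thesis .
  qed
qed

lemma mono_on_sections:
  fixes F :: "real \<times> real \<Rightarrow> real"
  assumes "mono_on unit_square F"
  shows "x \<in> unit_interval \<Longrightarrow> mono_on unit_interval (\<lambda>y. F (x, y))"
    "y \<in> unit_interval \<Longrightarrow> mono_on unit_interval (\<lambda>x. F (x, y))"
  by (auto intro!: mono_onI intro: monotone_onD[OF assms])

lemma AE_LS_neq_one: "AE z in LS. fst z \<noteq> 1 \<and> snd z \<noteq> 1"
proof -
  have 1: "(\<lambda>z. of_bool (fst z = 1) :: real) \<in> borel_measurable LS" "(\<lambda>z. of_bool (snd z = 1) :: real) \<in> borel_measurable LS"
    by (rule borel_fst_snd_LS; measurable)+
  have "AE z in LS. (of_bool (fst z = 1) :: real) = 0"
    by (rule AE_LS_from_vertical_sections[OF 1(1)]) (use AE_LI_neq[of 1] in \<open>auto elim!: eventually_mono\<close>)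
  moreover have "AE z in LS. (of_bool (snd z = 1) :: real) = 0"
    by (rule AE_LS_from_horizontal_sections[OF 1(2)]) (use AE_LI_neq[of 1] in \<open>auto elim!: eventually_mono\<close>)
  ultimately show ?thesis by eventually_elim simp
qed

text \<open>The factor \<open>(real n)\<^sup>2\<close> is the inverse of the area of a cell. The
  value 0 off the grid keeps all entries in the unit interval, as
  \<open>monotone_matrix_exists\<close> asks for every index.\<close>

definition cell_average :: "nat \<Rightarrow> (real \<times> real \<Rightarrow> real) \<Rightarrow> nat \<Rightarrow> nat \<Rightarrow> real" where
  "cell_average n f i j = (if i < n \<and> j < n
     then (real n)\<^sup>2 * (LINT z|LS. f z * (in_cell n i (fst z) * in_cell n j (snd z))) else 0)"

lemma cell_average:
  fixes f :: "real \<times> real \<Rightarrow> real"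
  assumes f: "f \<in> borel_measurable LS" "\<And>z. z \<in> unit_square \<Longrightarrow> 0 \<le> f z \<and> f z \<le> 1" and n: "0 < n"
  shows "0 \<le> cell_average n f i j \<and> cell_average n f i j \<le> 1"
    "i < n \<Longrightarrow> (\<Sum>j<n. cell_average n f i j) = (real n)\<^sup>2 * (LINT z|LS. f z * in_cell n i (fst z))"
    "j < n \<Longrightarrow> (\<Sum>i<n. cell_average n f i j) = (real n)\<^sup>2 * (LINT z|LS. f z * in_cell n j (snd z))"
proof -
  note cm[measurable] = borel_fst_snd_LS[OF in_cell_measurable]
  have [measurable]: "f \<in> borel_measurable LS" by fact
  have int: "integrable LS (\<lambda>z. f z * (in_cell n i (fst z) * in_cell n j (snd z)))" for i j
  proof (rule LS_integrable_bounded[where B=1])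
    show "\<bar>f z * (in_cell n i (fst z) * in_cell n j (snd z))\<bar> \<le> 1" if "z \<in> unit_square" for z
      using f(2)[OF that] by (auto simp: in_cell_def)
  qed measurable
  have int1: "integrable LS (\<lambda>z. in_cell n i (fst z) * in_cell n j (snd z))" for i j
  proof (rule LS_integrable_bounded[where B=1])
    show "\<bar>in_cell n i (fst z) * in_cell n j (snd z)\<bar> \<le> 1" for z by (auto simp: in_cell_def)
  qed measurable
  show "0 \<le> cell_average n f i j \<and> cell_average n f i j \<le> 1"
  proof (cases "i < n \<and> j < n")
    case True
    have "(LINT z|LS. f z * (in_cell n i (fst z) * in_cell n j (snd z)))
        \<le> (LINT z|LS. in_cell n i (fst z) * in_cell n j (snd z))"
      using f(2) by (intro integral_mono int int1) (auto simp: in_cell_def)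
    also have "\<dots> = (LINT x|LI. (LINT y|LI. in_cell n j (snd (x, y))) * in_cell n i x)"
      unfolding mult.commute[of "in_cell n i _"]
      by (rule integral_fst_snd_weight(1)[where B=1 and C=1]) (auto simp: in_cell_def[abs_def] simp del: measurable_of_bool intro: cm(2)[unfolded in_cell_def[abs_def]] in_cell_measurable[unfolded in_cell_def[abs_def]])
    also have "\<dots> = 1 / n * (1 / n)"
      using True by (simp add: integral_in_cell)
    finally have "(real n)\<^sup>2 * (LINT z|LS. f z * (in_cell n i (fst z) * in_cell n j (snd z))) \<le> (real n)\<^sup>2 * (1 / n * (1 / n))"
      by (intro mult_left_mono) auto
    also have "\<dots> = 1" using n by (simp add: power2_eq_square)
    finally have "cell_average n f i j \<le> 1" using True by (simp add: cell_average_def)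
    moreover have "0 \<le> (LINT z|LS. f z * (in_cell n i (fst z) * in_cell n j (snd z)))"
      using f(2) by (intro integral_nonneg_AE AE_I2) auto
    ultimately show ?thesis by (simp add: cell_average_def)
  qed (auto simp: cell_average_def)
  show "(\<Sum>j<n. cell_average n f i j) = (real n)\<^sup>2 * (LINT z|LS. f z * in_cell n i (fst z))" if i: "i < n"
  proof -
    have "(\<Sum>j<n. cell_average n f i j) = (real n)\<^sup>2 * (\<Sum>j<n. LINT z|LS. f z * (in_cell n i (fst z) * in_cell n j (snd z)))"
      using i by (simp add: cell_average_def sum_distrib_left)
    also have "(\<Sum>j<n. LINT z|LS. f z * (in_cell n i (fst z) * in_cell n j (snd z)))
        = (LINT z|LS. (\<Sum>j<n. f z * (in_cell n i (fst z) * in_cell n j (snd z))))"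
      by (rule Bochner_Integration.integral_sum[symmetric]) (rule int)
    also have "\<dots> = (LINT z|LS. f z * in_cell n i (fst z))"
    proof (rule integral_cong_AE)
      show "AE z in LS. (\<Sum>j<n. f z * (in_cell n i (fst z) * in_cell n j (snd z))) = f z * in_cell n i (fst z)"
        using AE_LS_neq_one AE_space
      proof eventually_elim
        case (elim z)
        then have "(\<Sum>j<n. in_cell n j (snd z)) = 1" using n by (intro sum_in_cell) auto
        then show ?case by (simp add: sum_distrib_left[symmetric])
      qed
    qed measurable
    finally show ?thesis .
  qed
  show "(\<Sum>i<n. cell_average n f i j) = (real n)\<^sup>2 * (LINT z|LS. f z * in_cell n j (snd z))" if j: "j < n"
  proof -
    have "(\<Sum>i<n. cell_average n f i j) = (real n)\<^sup>2 * (\<Sum>i<n. LINT z|LS. f z * (in_cell n i (fst z) * in_cell n j (snd z)))"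
      using j by (simp add: cell_average_def sum_distrib_left)
    also have "(\<Sum>i<n. LINT z|LS. f z * (in_cell n i (fst z) * in_cell n j (snd z)))
        = (LINT z|LS. (\<Sum>i<n. f z * (in_cell n i (fst z) * in_cell n j (snd z))))"
      by (rule Bochner_Integration.integral_sum[symmetric]) (rule int)
    also have "\<dots> = (LINT z|LS. f z * in_cell n j (snd z))"
    proof (rule integral_cong_AE)
      show "AE z in LS. (\<Sum>i<n. f z * (in_cell n i (fst z) * in_cell n j (snd z))) = f z * in_cell n j (snd z)"
        using AE_LS_neq_one AE_space
      proof eventually_elim
        case (elim z)
        then have "(\<Sum>i<n. in_cell n i (fst z)) = 1" using n by (intro sum_in_cell) auto
        then show ?case by (simp add: sum_distrib_left[symmetric] sum_distrib_right[symmetric])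
      qed
    qed measurable
    finally show ?thesis .
  qed
qed

lemma mono_on_step_function:
  fixes N :: "nat \<Rightarrow> nat \<Rightarrow> real"
  assumes "\<And>i i' j. i \<le> i' \<Longrightarrow> i' < n \<Longrightarrow> j < n \<Longrightarrow> N i j \<le> N i' j"
    "\<And>i j j'. j \<le> j' \<Longrightarrow> j' < n \<Longrightarrow> i < n \<Longrightarrow> N i j \<le> N i j'"
    and ix: "\<And>x. ix x < n" "\<And>x y. x \<le> y \<Longrightarrow> ix x \<le> ix (y :: real)"
  shows "mono_on S (\<lambda>z. N (ix (fst z)) (ix (snd z)))"
proof (rule mono_onI)
  fix z w :: "real \<times> real" assume "z \<le> w"
  then have "fst z \<le> fst w" "snd z \<le> snd w" by (auto simp: less_eq_prod_def)
  then have "N (ix (fst z)) (ix (snd z)) \<le> N (ix (fst w)) (ix (snd z))"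
    "N (ix (fst w)) (ix (snd z)) \<le> N (ix (fst w)) (ix (snd w))"
    by (simp_all add: assms(1,2) ix)
  then show "N (ix (fst z)) (ix (snd z)) \<le> N (ix (fst w)) (ix (snd w))" by simp
qed

lemma step_integral:
  fixes h :: "nat \<Rightarrow> real"
  assumes m: "(\<lambda>x. h (min (n - 1) (cell_index n x))) \<in> borel_measurable LI" and b: "\<And>i. 0 \<le> h i \<and> h i \<le> 1" and n: "0 < n"
  shows "(LINT x|LI. h (min (n - 1) (cell_index n x))) = (\<Sum>j<n. h j) / n"
proof -
  have hb: "\<bar>h (min (n - 1) (cell_index n x))\<bar> \<le> 1" if "x \<in> unit_interval" for x
    using b[of "min (n - 1) (cell_index n x)"] by simp
  have "(LINT x|LI. h (min (n - 1) (cell_index n x))) =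
      (\<Sum>j<n. LINT x|LI. in_cell n j x * h (min (n - 1) (cell_index n x)))"
    using m hb n by (rule integral_cells)
  also have "\<dots> = (\<Sum>j<n. h j / n)"
  proof (rule sum.cong[OF refl])
    fix j assume j: "j \<in> {..<n}"
    have "h j / n \<le> (LINT x|LI. in_cell n j x * h (min (n - 1) (cell_index n x)))"
      "(LINT x|LI. in_cell n j x * h (min (n - 1) (cell_index n x))) \<le> h j / n"
      by (rule integral_cell_bounds[OF m, where B=1 and lo="h j" and hi="h j"]; use j hb in \<open>simp add: min_absorb2\<close>)+
    then show "(LINT x|LI. in_cell n j x * h (min (n - 1) (cell_index n x))) = h j / n" by simp
  qed
  finally show ?thesis by (simp add: sum_divide_distrib)
qed

text \<open>The margin of the step function at \<open>x\<close> is the average of the component of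
  \<open>q\<close> over the cell of \<open>x\<close>. This cell lies within \<open>1 / n\<close> of
  \<open>x\<close>, so by monotonicity the average is caught between the two shifted values;
  \<open>max\<close> and \<open>min\<close> keep the arguments in the interval.\<close>

lemma approximate_monotone_rationalizer:
  fixes n :: nat
  assumes f: "rationalizes f q" and n: "0 < n"
    and q1: "mono_on unit_interval (fst q)" "fst q ` unit_interval \<subseteq> {0..1}"
    and q2: "mono_on unit_interval (snd q)" "snd q ` unit_interval \<subseteq> {0..1}"
  obtains F :: "real \<times> real \<Rightarrow> real" where "\<And>z. F z \<in> {0..1}" "mono_on unit_square F"
    "\<And>x. x \<in> unit_interval \<Longrightarrow> fst q (max 0 (x - 1 / n)) \<le> (LINT y|LI. F (x, y)) \<and>
        (LINT y|LI. F (x, y)) \<le> fst q (min 1 (x + 1 / n))"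
    "\<And>y. y \<in> unit_interval \<Longrightarrow> snd q (max 0 (y - 1 / n)) \<le> (LINT x|LI. F (x, y)) \<and>
        (LINT x|LI. F (x, y)) \<le> snd q (min 1 (y + 1 / n))"
proof -
  define M where "M = cell_average n f"
  have fm: "f \<in> borel_measurable LS" using f by (simp add: rationalizes_def)
  have fb: "0 \<le> f z \<and> f z \<le> 1" if "z \<in> unit_square" for z
    using f that by (auto simp: rationalizes_def image_subset_iff)
  have Mb: "0 \<le> M i j \<and> M i j \<le> 1" for i j
    unfolding M_def using fm fb n by (rule cell_average(1))
  have row: "(\<Sum>j<n. M i j) / n = n * (LINT x|LI. in_cell n i x * fst q x)" if "i < n" for i
  proof -
    have "(\<Sum>j<n. M i j) = (real n)\<^sup>2 * (LINT z|LS. f z * in_cell n i (fst z))"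
      unfolding M_def using fm fb n that by (rule cell_average(2))
    also have "(LINT z|LS. f z * in_cell n i (fst z)) = (LINT x|LI. fst q x * in_cell n i x)"
      by (rule rationalizes_integral(1)[OF f _ _ q1(1), where C=1]) auto
    finally show ?thesis using n by (simp add: power2_eq_square mult.commute)
  qed
  have col: "(\<Sum>i<n. M i j) / n = n * (LINT x|LI. in_cell n j x * snd q x)" if "j < n" for j
  proof -
    have "(\<Sum>i<n. M i j) = (real n)\<^sup>2 * (LINT z|LS. f z * in_cell n j (snd z))"
      unfolding M_def using fm fb n that by (rule cell_average(3))
    also have "(LINT z|LS. f z * in_cell n j (snd z)) = (LINT x|LI. snd q x * in_cell n j x)"
      by (rule rationalizes_integral(2)[OF f _ _ q2(1), where C=1]) auto
    finally show ?thesis using n by (simp add: power2_eq_square mult.commute)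
  qed
  have avg: "g (i / n) \<le> n * (LINT x|LI. in_cell n i x * g x) \<and> n * (LINT x|LI. in_cell n i x * g x) \<le> g ((real i + 1) / n)"
    if "mono_on unit_interval g" "g ` unit_interval \<subseteq> {0..1}" "i < n" for g i
    using mono_cell_bounds[OF that] n by (simp add: field_simps)
  have avg_mono: "n * (LINT x|LI. in_cell n i x * g x) \<le> n * (LINT x|LI. in_cell n i' x * g x)"
    if g: "mono_on unit_interval g" "g ` unit_interval \<subseteq> {0..1}" and i: "i \<le> i'" "i' < n" for g i i'
  proof (cases "i = i'")
    case False
    \<comment> \<open>The right end of cell \<open>i\<close> is at most the left end of the later
      cell \<open>i'\<close>, so this inequality separates the two averages.\<close>
    then have "g ((real i + 1) / n) \<le> g (i' / n)"
      using i by (intro monotone_onD[OF g(1)]) (auto simp: divide_right_mono)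
    then show ?thesis using avg[OF g, of i] avg[OF g, of i'] i by linarith
  qed simp
  obtain N where Nb: "\<And>a b. 0 \<le> N a b \<and> N a b \<le> 1"
    and Nr: "\<And>a. (\<Sum>b<n. N a b) = (\<Sum>b<n. M a b)" and Nc: "\<And>b. (\<Sum>a<n. N a b) = (\<Sum>a<n. M a b)"
    and Nm1: "\<And>i i' j. i \<le> i' \<Longrightarrow> i' < n \<Longrightarrow> j < n \<Longrightarrow> N i j \<le> N i' j"
    and Nm2: "\<And>i j j'. j \<le> j' \<Longrightarrow> j' < n \<Longrightarrow> i < n \<Longrightarrow> N i j \<le> N i j'"
  proof (rule monotone_matrix_exists)
    show "0 \<le> M a b \<and> M a b \<le> 1" for a b by (rule Mb)
    show "(\<Sum>b<n. M i b) \<le> (\<Sum>b<n. M i' b)" if "i \<le> i'" "i' < n" for i i'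
    proof -
      have "(\<Sum>b<n. M i b) / n \<le> (\<Sum>b<n. M i' b) / n" using row[of i] row[of i'] avg_mono[OF q1 that] that by simp
      then show ?thesis using n by (simp add: divide_le_cancel)
    qed
    show "(\<Sum>a<n. M a j) \<le> (\<Sum>a<n. M a j')" if "j \<le> j'" "j' < n" for j j'
    proof -
      have "(\<Sum>a<n. M a j) / n \<le> (\<Sum>a<n. M a j') / n" using col[of j] col[of j'] avg_mono[OF q2 that] that by simp
      then show ?thesis using n by (simp add: divide_le_cancel)
    qed
  qed blast
  \<comment> \<open>The minimum puts the point 1 into the last cell, which makes the step function
    monotone on the closed square.\<close>
  define ix where "ix x = min (n - 1) (cell_index n x)" for x
  have ixn: "ix x < n" for x using n by (auto simp: ix_def)
  have ixm: "ix x \<le> ix y" if "x \<le> y" for x y using cell_index_mono[OF that, of n] by (auto simp: ix_def)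
  have ixb: "real (ix x) / n \<in> unit_interval \<and> (real (ix x) + 1) / n \<in> unit_interval \<and>
     max 0 (x - 1 / n) \<le> real (ix x) / n \<and> (real (ix x) + 1) / n \<le> min 1 (x + 1 / n)" if x: "x \<in> unit_interval" for x
  proof -
    have "real (ix x) / n \<le> x \<and> x \<le> (real (ix x) + 1) / n"
    proof (cases "x = 1")
      case True
      then have "ix x = n - 1" by (simp add: ix_def cell_index_def)
      then show ?thesis using True n by (simp add: of_nat_diff)
    next
      case False
      then have "cell_index n x < n" using x n by (intro cell_index_less) auto
      then have "ix x = cell_index n x" by (auto simp: ix_def)
      then show ?thesis using cell_index_bounds[of x n] x n by auto
    qed
    moreover have "(real (ix x) + 1) / n = real (ix x) / n + 1 / n" by (simp add: add_divide_distrib)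
    moreover have "0 \<le> real (ix x) / n" by simp
    moreover have "(real (ix x) + 1) / n \<le> 1" using ixn[of x] n by simp
    moreover have "0 \<le> 1 / real n" by simp
    ultimately show ?thesis unfolding atLeastAtMost_iff by linarith
  qed
  define F where "F z = N (ix (fst z)) (ix (snd z))" for z
  have Fm: "mono_on unit_square F"
    unfolding F_def by (rule mono_on_step_function[OF Nm1 Nm2 ixn ixm])
  show ?thesis
  proof
    show "F z \<in> {0..1}" for z using Nb by (simp add: F_def)
    show "mono_on unit_square F" by (rule Fm)
  next
    fix x assume x: "x \<in> unit_interval"
    have "(LINT y|LI. F (x, y)) = (\<Sum>j<n. N (ix x) j) / n"
      unfolding F_def fst_conv snd_conv
      using step_integral[of "N (ix x)" n] Nb n mono_on_measurable_LI[OF mono_on_sections(1)[OF Fm x]]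
      by (simp add: F_def ix_def)
    also have "\<dots> = n * (LINT x'|LI. in_cell n (ix x) x' * fst q x')" unfolding Nr by (rule row[OF ixn])
    finally have "fst q (ix x / n) \<le> (LINT y|LI. F (x, y)) \<and> (LINT y|LI. F (x, y)) \<le> fst q ((real (ix x) + 1) / n)"
      using avg[OF q1 ixn] by simp
    moreover have "fst q (max 0 (x - 1 / n)) \<le> fst q (ix x / n)" "fst q ((real (ix x) + 1) / n) \<le> fst q (min 1 (x + 1 / n))"
      using ixb[OF x] x by (auto intro!: monotone_onD[OF q1(1)])
    ultimately show "fst q (max 0 (x - 1 / n)) \<le> (LINT y|LI. F (x, y)) \<and>
        (LINT y|LI. F (x, y)) \<le> fst q (min 1 (x + 1 / n))" by linarith
  next
    fix y assume y: "y \<in> unit_interval"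
    have "(LINT x|LI. F (x, y)) = (\<Sum>i<n. N i (ix y)) / n"
      unfolding F_def fst_conv snd_conv
      using step_integral[of "\<lambda>i. N i (ix y)" n] Nb n mono_on_measurable_LI[OF mono_on_sections(2)[OF Fm y]]
      by (simp add: F_def ix_def)
    also have "\<dots> = n * (LINT x'|LI. in_cell n (ix y) x' * snd q x')" unfolding Nc by (rule col[OF ixn])
    finally have "snd q (ix y / n) \<le> (LINT x|LI. F (x, y)) \<and> (LINT x|LI. F (x, y)) \<le> snd q ((real (ix y) + 1) / n)"
      using avg[OF q2 ixn] by simp
    moreover have "snd q (max 0 (y - 1 / n)) \<le> snd q (ix y / n)" "snd q ((real (ix y) + 1) / n) \<le> snd q (min 1 (y + 1 / n))"
      using ixb[OF y] y by (auto intro!: monotone_onD[OF q2(1)])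
    ultimately show "snd q (max 0 (y - 1 / n)) \<le> (LINT x|LI. F (x, y)) \<and>
        (LINT x|LI. F (x, y)) \<le> snd q (min 1 (y + 1 / n))" by linarith
  qed
qed

text \<open>For nondecreasing \<open>g\<close> with values in the unit interval this says that the
  integral of \<open>g\<close> lies between \<open>p (max 0 (x - d))\<close> and
  \<open>p (min 1 (x + d))\<close>. Each inequality involves finitely many values of
  \<open>g\<close> and so survives pointwise limits, unlike a condition on the integral.\<close>

definition section_bounds :: "(real \<Rightarrow> real) \<Rightarrow> real \<Rightarrow> real \<Rightarrow> (real \<Rightarrow> real) \<Rightarrow> bool" where
  "section_bounds p d x g \<longleftrightarrow> (\<forall>k>0. (\<Sum>i<k. g (real i / real k)) / real k \<le> p (min 1 (x + d)) \<and>
     p (max 0 (x - d)) \<le> (\<Sum>i<k. g ((real i + 1) / real k)) / real k)"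

lemma section_bounds_antimono:
  assumes p: "mono_on unit_interval p" and x: "x \<in> unit_interval" and d: "0 \<le> d" "d \<le> d'"
    and "section_bounds p d x g"
  shows "section_bounds p d' x g"
proof -
  have "p (min 1 (x + d)) \<le> p (min 1 (x + d'))" "p (max 0 (x - d')) \<le> p (max 0 (x - d))"
    using x d by (auto intro!: monotone_onD[OF p])
  then show ?thesis using assms(5) unfolding section_bounds_def by (meson order_trans)
qed

lemma section_bounds_integral:
  assumes g: "mono_on unit_interval g" "g ` unit_interval \<subseteq> {0..1}"
    and "p (max 0 (x - d)) \<le> integral\<^sup>L LI g \<and> integral\<^sup>L LI g \<le> p (min 1 (x + d))"
  shows "section_bounds p d x g"
  unfolding section_bounds_def using riemann_sum_bounds[OF g] assms(3) by (meson order_trans)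

text \<open>Upper and lower Riemann sums of a nondecreasing \<open>g\<close> differ by the
  telescoped amount \<open>(g 1 - g 0) / k\<close>, at most \<open>1 / k\<close>, so large
  \<open>k\<close> recovers the bounds for the integral.\<close>

lemma integral_section_bounds:
  assumes g: "mono_on unit_interval g" "g ` unit_interval \<subseteq> {0..1 :: real}" and sb: "section_bounds p d x g"
  shows "p (max 0 (x - d)) \<le> integral\<^sup>L LI g" "integral\<^sup>L LI g \<le> p (min 1 (x + d))"
proof -
  define L where "L k = (\<Sum>i<k. g (real i / real k)) / real k" for k
  define U where "U k = (\<Sum>i<k. g ((real i + 1) / real k)) / real k" for k
  have UL: "U k \<le> L k + 1 / k" if k: "0 < k" for k
  proof -
    have "(\<Sum>i<k. g ((real i + 1) / real k)) - (\<Sum>i<k. g (real i / real k)) = g 1 - g 0"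
      using sum_lessThan_telescope[of "\<lambda>i. g (real i / real k)" k] k
      by (simp add: sum_subtractf add.commute)
    moreover have "g 1 \<le> 1" "0 \<le> g 0" using g(2) by (auto simp: image_subset_iff)
    ultimately have "(\<Sum>i<k. g ((real i + 1) / real k)) \<le> (\<Sum>i<k. g (real i / real k)) + 1" by linarith
    then show ?thesis unfolding U_def L_def using k by (simp add: field_simps)
  qed
  have LU: "L k \<le> integral\<^sup>L LI g" "integral\<^sup>L LI g \<le> U k" "L k \<le> p (min 1 (x + d))" "p (max 0 (x - d)) \<le> U k"
    if k: "0 < k" for k
    using riemann_sum_bounds[OF g k] sb k unfolding L_def U_def section_bounds_def by auto
  have *: "a \<le> b" if "\<And>k::nat. (0::nat) < k \<Longrightarrow> a \<le> b + 1 / k" for a b :: real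
  proof (rule field_le_epsilon)
    fix e :: real assume "0 < e"
    then obtain k :: nat where "inverse (Suc k) < e" using reals_Archimedean by blast
    then show "a \<le> b + e" using that[of "Suc k"] by (simp add: inverse_eq_divide)
  qed
  have "p (max 0 (x - d)) \<le> integral\<^sup>L LI g + 1 / real k" if "0 < k" for k
    using LU[OF that] UL[OF that] by linarith
  then show "p (max 0 (x - d)) \<le> integral\<^sup>L LI g" by (rule *)
  have "integral\<^sup>L LI g \<le> p (min 1 (x + d)) + 1 / real k" if "0 < k" for k
    using LU[OF that] UL[OF that] by linarith
  then show "integral\<^sup>L LI g \<le> p (min 1 (x + d))" by (rule *)
qed

lemma closed_section_bounds:
  assumes "\<And>t. continuous_on UNIV (\<lambda>F. G F t)"
  shows "closed {F. section_bounds p d x (G F)}"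
  unfolding section_bounds_def divide_inverse
  by (intro closed_Collect_all closed_Collect_imp closed_Collect_conj closed_Collect_le
      continuous_on_mult continuous_on_sum continuous_on_const assms open_Collect_const)

lemma eq_from_section_bounds:
  fixes p :: "real \<Rightarrow> real"
  assumes p: "continuous (at x within unit_interval) p" and x: "x \<in> unit_interval"
    and b: "\<And>n. p (max 0 (x - 1 / Suc n)) \<le> c" "\<And>n. c \<le> p (min 1 (x + 1 / Suc n))"
  shows "p x = c"
proof -
  have t: "(\<lambda>n. 1 / real (Suc n)) \<longlonglongrightarrow> 0" using LIMSEQ_inverse_real_of_nat by (simp add: inverse_eq_divide)
  have "(\<lambda>n. max 0 (x - 1 / Suc n)) \<longlonglongrightarrow> max 0 (x - 0)" "(\<lambda>n. min 1 (x + 1 / Suc n)) \<longlonglongrightarrow> min 1 (x + 0)"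
    by (intro tendsto_intros t)+
  then have "(\<lambda>n. max 0 (x - 1 / Suc n)) \<longlonglongrightarrow> x" "(\<lambda>n. min 1 (x + 1 / Suc n)) \<longlonglongrightarrow> x"
    using x by auto
  moreover have I: "max 0 (x - 1 / Suc n) \<in> unit_interval" "min 1 (x + 1 / Suc n) \<in> unit_interval" for n
  proof -
    have "0 \<le> 1 / real (Suc n)" by simp
    with x show "max 0 (x - 1 / Suc n) \<in> unit_interval" "min 1 (x + 1 / Suc n) \<in> unit_interval"
      unfolding atLeastAtMost_iff by linarith+
  qed
  ultimately have "(\<lambda>n. p (max 0 (x - 1 / Suc n))) \<longlonglongrightarrow> p x" "(\<lambda>n. p (min 1 (x + 1 / Suc n))) \<longlonglongrightarrow> p x"
    using I by (auto intro!: continuous_within_tendsto_compose[OF p] always_eventually simp del: of_nat_Suc)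
  from LIMSEQ_le_const2[OF this(1)] LIMSEQ_le_const[OF this(2)] b
  show ?thesis by (meson order_antisym)
qed

text \<open>The closed sets \<open>K n\<close> of approximate solutions decrease and each meets the
  compact cube, so they have a common element \<open>F\<close> in it. Its margins are squeezed to
  \<open>q\<close> at every point of continuity of the component, and a monotone function has only
  countably many other points.\<close>

lemma monotone_rationalizer_exists:
  assumes f: "rationalizes f q"
    and q1: "mono_on unit_interval (fst q)" "fst q ` unit_interval \<subseteq> {0..1}"
    and q2: "mono_on unit_interval (snd q)" "snd q ` unit_interval \<subseteq> {0..1}"
  obtains F where "mono_on unit_square F" "rationalizes F q"
proof -
  define K :: "nat \<Rightarrow> (real \<times> real \<Rightarrow> real) set" where "K n = {F. mono_on unit_square F \<and>
     (\<forall>x. x \<in> unit_interval \<longrightarrow> section_bounds (fst q) (1 / Suc n) x (\<lambda>y. F (x, y))) \<and>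
     (\<forall>y. y \<in> unit_interval \<longrightarrow> section_bounds (snd q) (1 / Suc n) y (\<lambda>x. F (x, y)))}" for n
  have cl: "closed (K n)" for n
    unfolding K_def monotone_on_def Ball_def
    by (intro closed_Collect_all closed_Collect_imp closed_Collect_conj closed_Collect_le open_Collect_const
        closed_section_bounds continuous_on_product_coordinates)
  have anti: "K n \<subseteq> K m" if "m \<le> n" for m n
  proof -
    have "1 / real (Suc n) \<le> 1 / real (Suc m)" using that by (simp add: frac_le)
    then have "section_bounds p (1 / Suc m) x g"
      if "mono_on unit_interval p" "x \<in> unit_interval" "section_bounds p (1 / Suc n) x g" for p x g
      using section_bounds_antimono[OF that(1,2) _ _ that(3)] by simp
    then show ?thesis unfolding K_def using q1(1) q2(1) by blast
  qed
  have ne: "{F. \<forall>z. F z \<in> {0..1}} \<inter> K n \<noteq> {}" for n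
  proof -
    obtain F where F: "\<And>z. F z \<in> {0..1}" "mono_on unit_square F"
      "\<And>x. x \<in> unit_interval \<Longrightarrow> fst q (max 0 (x - 1 / Suc n)) \<le> (LINT y|LI. F (x, y)) \<and>
          (LINT y|LI. F (x, y)) \<le> fst q (min 1 (x + 1 / Suc n))"
      "\<And>y. y \<in> unit_interval \<Longrightarrow> snd q (max 0 (y - 1 / Suc n)) \<le> (LINT x|LI. F (x, y)) \<and>
          (LINT x|LI. F (x, y)) \<le> snd q (min 1 (y + 1 / Suc n))"
      by (rule approximate_monotone_rationalizer[OF f _ q1 q2, of "Suc n"]) auto
    have "F \<in> K n" unfolding K_def
      using F mono_on_sections[OF F(2)] by (auto intro!: section_bounds_integral)
    with F(1) show ?thesis by blast
  qed
  have "{F. \<forall>z. F z \<in> {0..1}} \<inter> (\<Inter>n\<in>UNIV. K n) \<noteq> {}"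
  proof (rule compact_imp_fip_image[OF compact_Pi_unit])
    show "closed (K n)" for n by (rule cl)
    fix I' :: "nat set" assume "finite I'"
    then have "K (Max (insert 0 I')) \<subseteq> (\<Inter>n\<in>I'. K n)" by (auto intro!: INF_greatest anti)
    with ne[of "Max (insert 0 I')"] show "{F. \<forall>z. F z \<in> {0..1}} \<inter> (\<Inter>n\<in>I'. K n) \<noteq> {}" by blast
  qed
  then obtain F where F: "\<And>z. F z \<in> {0..1}" "\<And>n. F \<in> K n" by auto
  have Fm: "mono_on unit_square F" using F(2)[of 0] by (simp add: K_def)
  have "AE x in LI. fst q x = (LINT y|LI. F (x, y))"
    using AE_LI_countable[OF mono_on_ctble_discont[OF q1(1)]] AE_space
  proof eventually_elim
    case (elim x)
    then have x: "x \<in> unit_interval" "continuous (at x within unit_interval) (fst q)" by auto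
    have sb: "section_bounds (fst q) (1 / Suc n) x (\<lambda>y. F (x, y))" for n
      using F(2)[of n] x unfolding K_def by blast
    have g: "mono_on unit_interval (\<lambda>y. F (x, y))" "(\<lambda>y. F (x, y)) ` unit_interval \<subseteq> {0..1}"
      using mono_on_sections(1)[OF Fm x(1)] F(1) by auto
    show ?case
      by (rule eq_from_section_bounds[OF x(2,1)]) (rule integral_section_bounds[OF g sb])+
  qed
  moreover have "AE y in LI. snd q y = (LINT x|LI. F (x, y))"
    using AE_LI_countable[OF mono_on_ctble_discont[OF q2(1)]] AE_space
  proof eventually_elim
    case (elim y)
    then have y: "y \<in> unit_interval" "continuous (at y within unit_interval) (snd q)" by auto
    have sb: "section_bounds (snd q) (1 / Suc n) y (\<lambda>x. F (x, y))" for n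
      using F(2)[of n] y unfolding K_def by blast
    have g: "mono_on unit_interval (\<lambda>x. F (x, y))" "(\<lambda>x. F (x, y)) ` unit_interval \<subseteq> {0..1}"
      using mono_on_sections(2)[OF Fm y(1)] F(1) by auto
    show ?case
      by (rule eq_from_section_bounds[OF y(2,1)]) (rule integral_section_bounds[OF g sb])+
  qed
  ultimately have "rationalizes F q"
    unfolding rationalizes_def using F(1) mono_on_measurable_LS[OF Fm] by auto
  with Fm show ?thesis by (rule that)
qed

section \<open>Perturbations of extreme points\<close>

definition marg1 :: "(real \<times> real \<Rightarrow> real) \<Rightarrow> real \<Rightarrow> real" where
  "marg1 g x = (LINT y|LI. g (x, y))"

definition marg2 :: "(real \<times> real \<Rightarrow> real) \<Rightarrow> real \<Rightarrow> real" where
  "marg2 g y = (LINT x|LI. g (x, y))"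

text \<open>Measurability on the square controls only almost every section. Asking it of every
  section makes margins additive and monotone at every point, so that their increments can be
  compared for all \<open>x \<le> y\<close>.\<close>

definition regular :: "(real \<times> real \<Rightarrow> real) \<Rightarrow> bool" where
  "regular g \<longleftrightarrow> g \<in> borel_measurable LS \<and>
     (\<forall>x\<in>unit_interval. (\<lambda>y. g (x, y)) \<in> borel_measurable LI) \<and>
     (\<forall>y\<in>unit_interval. (\<lambda>x. g (x, y)) \<in> borel_measurable LI) \<and>
     (\<exists>B. \<forall>z\<in>unit_square. \<bar>g z\<bar> \<le> B)"

lemma regular_const: "regular (\<lambda>_. c)"
  by (auto simp: regular_def)

lemma regular_add:
  assumes "regular g" "regular h"
  shows "regular (\<lambda>z. g z + h z)"
proof -
  obtain B C where "\<forall>z\<in>unit_square. \<bar>g z\<bar> \<le> B" "\<forall>z\<in>unit_square. \<bar>h z\<bar> \<le> C"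
    using assms unfolding regular_def by blast
  then have "\<forall>z\<in>unit_square. \<bar>g z + h z\<bar> \<le> B + C"
    by (intro ballI order_trans[OF abs_triangle_ineq] add_mono) auto
  then show ?thesis using assms unfolding regular_def by (auto intro!: borel_measurable_add)
qed

lemma regular_mult:
  assumes "regular g" "regular h"
  shows "regular (\<lambda>z. g z * h z)"
proof -
  obtain B C where "\<forall>z\<in>unit_square. \<bar>g z\<bar> \<le> B" "\<forall>z\<in>unit_square. \<bar>h z\<bar> \<le> C"
    using assms unfolding regular_def by blast
  then have "\<forall>z\<in>unit_square. \<bar>g z * h z\<bar> \<le> B * C"
    unfolding abs_mult by (intro ballI mult_mono) (auto intro: order_trans[OF abs_ge_zero])
  then show ?thesis using assms unfolding regular_def by (auto intro!: borel_measurable_times)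
qed

lemma regular_cmult: "regular g \<Longrightarrow> regular (\<lambda>z. c * g z)"
  by (rule regular_mult[OF regular_const])

lemma mono_on_unit_square_bounds:
  fixes F :: "real \<times> real \<Rightarrow> real"
  assumes "mono_on unit_square F" "z \<in> unit_square"
  shows "F (0, 0) \<le> F z" "F z \<le> F (1, 1)"
  using assms(2) by (auto intro!: monotone_onD[OF assms(1)])

lemma regular_mono:
  assumes "mono_on unit_square F"
  shows "regular F"
proof -
  have "\<forall>z\<in>unit_square. \<bar>F z\<bar> \<le> \<bar>F (0, 0)\<bar> + \<bar>F (1, 1)\<bar>"
    using mono_on_unit_square_bounds[OF assms] by (smt (verit))
  then show ?thesis
    unfolding regular_def
    using mono_on_measurable_LS[OF assms] mono_on_sections[OF assms] mono_on_measurable_LI by blast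
qed

lemma regular_compose:
  fixes F :: "real \<times> real \<Rightarrow> real"
  assumes "mono_on unit_square F" "h \<in> borel_measurable borel" "\<And>t. \<bar>h t\<bar> \<le> C"
  shows "regular (\<lambda>z. h (F z))"
  using regular_mono[OF assms(1)] assms(2,3) unfolding regular_def
  by (auto intro!: measurable_compose[OF _ assms(2)])

lemma regularD:
  assumes "regular g"
  shows "g \<in> borel_measurable LS" "integrable LS g"
    "x \<in> unit_interval \<Longrightarrow> integrable LI (\<lambda>y. g (x, y))"
    "x \<in> unit_interval \<Longrightarrow> integrable LI (\<lambda>y. g (y, x))"
    "marg1 g \<in> borel_measurable LI" "marg2 g \<in> borel_measurable LI"
    "\<exists>C. \<forall>x\<in>unit_interval. \<bar>marg1 g x\<bar> \<le> C \<and> \<bar>marg2 g x\<bar> \<le> C"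
proof -
  obtain B where B: "\<And>z. z \<in> unit_square \<Longrightarrow> \<bar>g z\<bar> \<le> B"
    using assms unfolding regular_def by blast
  show g: "g \<in> borel_measurable LS" using assms by (simp add: regular_def)
  show "integrable LS g" using g B by (rule LS_integrable_bounded)
  have i1: "integrable LI (\<lambda>y. g (x, y))" if "x \<in> unit_interval" for x
    using assms B that by (intro LI_integrable_bounded[where B=B]) (auto simp: regular_def)
  have i2: "integrable LI (\<lambda>y. g (y, x))" if "x \<in> unit_interval" for x
    using assms B that by (intro LI_integrable_bounded[where B=B]) (auto simp: regular_def)
  show "x \<in> unit_interval \<Longrightarrow> integrable LI (\<lambda>y. g (x, y))"
    "x \<in> unit_interval \<Longrightarrow> integrable LI (\<lambda>y. g (y, x))" by (fact i1, fact i2)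
  show "marg1 g \<in> borel_measurable LI" "marg2 g \<in> borel_measurable LI"
    unfolding marg1_def[abs_def] marg2_def[abs_def] using fubini_unit_square(1,2)[of g B] g B by auto
  have bnd: "\<bar>LINT y|LI. h y\<bar> \<le> B" if h: "integrable LI h" "\<And>y. y \<in> unit_interval \<Longrightarrow> \<bar>h y\<bar> \<le> B" for h :: "real \<Rightarrow> real"
  proof -
    have "\<bar>LINT y|LI. h y\<bar> \<le> (LINT y|LI. \<bar>h y\<bar>)" by (rule integral_abs_bound)
    also have "\<dots> \<le> (LINT y|LI. B)" using h by (intro integral_mono) auto
    also have "\<dots> = B" by (simp add: measure_restrict_space)
    finally show ?thesis .
  qed
  have "\<bar>marg1 g x\<bar> \<le> B \<and> \<bar>marg2 g x\<bar> \<le> B" if x: "x \<in> unit_interval" for x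
    unfolding marg1_def marg2_def using i1[OF x] i2[OF x] B x by (auto intro!: bnd)
  then show "\<exists>C. \<forall>x\<in>unit_interval. \<bar>marg1 g x\<bar> \<le> C \<and> \<bar>marg2 g x\<bar> \<le> C" by blast
qed

lemma marg_linear:
  assumes "regular g" "regular h" "x \<in> unit_interval"
  shows "marg1 (\<lambda>z. a * g z + b * h z) x = a * marg1 g x + b * marg1 h x"
    "marg2 (\<lambda>z. a * g z + b * h z) x = a * marg2 g x + b * marg2 h x"
  using regularD(3,4)[OF assms(1,3)] regularD(3,4)[OF assms(2,3)]
  by (simp_all add: marg1_def marg2_def)

lemma marg_mono:
  assumes "regular g" "regular h" "x \<in> unit_interval" "\<And>z. z \<in> unit_square \<Longrightarrow> g z \<le> h z"
  shows "marg1 g x \<le> marg1 h x" "marg2 g x \<le> marg2 h x"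
  unfolding marg1_def marg2_def
  using regularD(3,4)[OF assms(1,3)] regularD(3,4)[OF assms(2,3)] assms(3,4)
  by (auto intro!: integral_mono)

lemma marg_const: "marg1 (\<lambda>_. c) x = c" "marg2 (\<lambda>_. c) x = c"
  by (simp_all add: marg1_def marg2_def measure_restrict_space)

lemma rationalizes_iff_marg:
  "rationalizes f q \<longleftrightarrow> f \<in> borel_measurable LS \<and> f ` unit_square \<subseteq> {0..1} \<and>
     (AE x in LI. fst q x = marg1 f x) \<and> (AE x in LI. snd q x = marg2 f x)"
  by (simp add: rationalizes_def marg1_def marg2_def)

text \<open>The left limit of a nondecreasing \<open>g\<close>: \<open>Q\<close> asks for
  left-continuous components, whereas the margins of a perturbed function are only known to be
  nondecreasing. The value at 0, where there is no left limit, is kept.\<close>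

definition left_reg :: "(real \<Rightarrow> real) \<Rightarrow> real \<Rightarrow> real" where
  "left_reg g x = (if 0 < x \<and> x \<le> 1 then Sup (g ` {0..<x}) else g x)"

text \<open>\<open>left_reg g x\<close> lies above \<open>g y\<close> for \<open>y < x\<close> and
  below \<open>g x\<close>, which gives monotonicity and left-continuity. At a point of continuity
  of \<open>g\<close> the two bounds meet, and there are only countably many other points.\<close>

lemma left_reg:
  assumes g: "mono_on unit_interval g" "g ` unit_interval \<subseteq> {0..1}"
  shows "nondecreasing_left_cont (left_reg g)" "AE x in LI. left_reg g x = g x"
proof -
  have gb: "0 \<le> g x \<and> g x \<le> 1" if "x \<in> unit_interval" for x using g(2) that by (auto simp: image_subset_iff)
  have bdd: "bdd_above (g ` {0..<x})" if "x \<le> 1" for x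
    using gb that by (intro bdd_aboveI[of _ 1]) auto
  have up: "g y \<le> left_reg g x" if "0 \<le> y" "y < x" "x \<le> 1" for x y
    using that bdd by (auto simp: left_reg_def intro!: cSup_upper)
  have lo: "left_reg g x \<le> g y" if "0 \<le> x" "x \<le> y" "y \<le> 1" for x y
  proof (cases "0 < x")
    case True
    then show ?thesis using that
      by (auto simp: left_reg_def intro!: cSup_least monotone_onD[OF g(1)])
  next
    case False
    then show ?thesis using that by (auto simp: left_reg_def intro!: monotone_onD[OF g(1)])
  qed
  have mono: "mono_on unit_interval (left_reg g)"
  proof (rule mono_onI)
    fix x y :: real assume *: "x \<in> unit_interval" "y \<in> unit_interval" "x \<le> y"
    show "left_reg g x \<le> left_reg g y"
    proof (cases "x = y")
      case False
      then show ?thesis using lo[of x x] up[of x y] * by (auto intro: order_trans)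
    qed simp
  qed
  have range: "left_reg g ` unit_interval \<subseteq> {0..1}"
  proof
    fix c assume "c \<in> left_reg g ` unit_interval"
    then obtain x where x: "x \<in> unit_interval" "c = left_reg g x" by blast
    have "left_reg g x \<le> 1" using lo[of x 1] x gb[of 1] by auto
    moreover have "left_reg g 0 \<le> left_reg g x" using monotone_onD[OF mono, of 0 x] x by auto
    moreover have "0 \<le> left_reg g 0" using gb[of 0] by (simp add: left_reg_def)
    ultimately show "c \<in> {0..1}" using x by auto
  qed
  have "continuous (at_left x) (left_reg g)" if x: "x \<in> {0<..1}" for x
    unfolding continuous_within
  proof (rule order_tendstoI)
    fix a assume "a < left_reg g x"
    then have "a < Sup (g ` {0..<x})" using x by (simp add: left_reg_def)
    then obtain y where y: "0 \<le> y" "y < x" "a < g y"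
      using x bdd[of x] by (subst (asm) less_cSup_iff) auto
    have "eventually (\<lambda>z. z \<in> {y<..<x}) (at_left x)"
      by (rule eventually_at_left_real[OF y(2)])
    then show "eventually (\<lambda>z. a < left_reg g z) (at_left x)"
    proof eventually_elim
      case (elim z)
      then show ?case using up[of y z] y x by auto
    qed
  next
    fix a assume a: "left_reg g x < a"
    have "eventually (\<lambda>z. z \<in> {0<..<x}) (at_left x)"
      by (rule eventually_at_left_real) (use x in simp)
    then show "eventually (\<lambda>z. left_reg g z < a) (at_left x)"
    proof eventually_elim
      case (elim z)
      then show ?case using monotone_onD[OF mono, of z x] x a by auto
    qed
  qed
  then show "nondecreasing_left_cont (left_reg g)"
    unfolding nondecreasing_left_cont_def using mono range by blast
  show "AE x in LI. left_reg g x = g x"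
    using AE_LI_countable[OF mono_on_ctble_discont[OF g(1)]] AE_space
  proof eventually_elim
    case (elim x)
    then have x: "x \<in> unit_interval" and c: "continuous (at x within unit_interval) g" by auto
    show ?case
    proof (cases "x = 0")
      case False
      have "g x \<le> left_reg g x"
      proof (rule LIMSEQ_le_const2)
        have "(\<lambda>n. max 0 (x - 1 / Suc n)) \<longlonglongrightarrow> max 0 (x - 0)"
          using LIMSEQ_inverse_real_of_nat by (intro tendsto_intros) (simp add: inverse_eq_divide)
        then have "(\<lambda>n. max 0 (x - 1 / Suc n)) \<longlonglongrightarrow> x" using x by auto
        moreover have "max 0 (x - 1 / Suc n) \<in> unit_interval" for n
        proof -
          have "0 \<le> 1 / real (Suc n)" by simp
          with x show ?thesis unfolding atLeastAtMost_iff by linarith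
        qed
        ultimately show "(\<lambda>n. g (max 0 (x - 1 / Suc n))) \<longlonglongrightarrow> g x"
          by (intro continuous_within_tendsto_compose[OF c] always_eventually) auto
        have "g (max 0 (x - 1 / Suc n)) \<le> left_reg g x" for n
          using x False by (intro up) auto
        then show "\<exists>N. \<forall>n\<ge>N. g (max 0 (x - 1 / Suc n)) \<le> left_reg g x" by blast
      qed
      then show ?thesis using lo[of x x] x by auto
    qed (simp add: left_reg_def)
  qed
qed

text \<open>These inequalities say that both \<open>F + G\<close> and \<open>F - G\<close> have
  values in the unit interval and nondecreasing margins, without asking either to be monotone. All
  of them bound an absolute value, so they pass to combinations with
  \<open>\<bar>a\<bar> + \<bar>b\<bar> \<le> 1\<close>.\<close>

definition admissible :: "(real \<times> real \<Rightarrow> real) \<Rightarrow> (real \<times> real \<Rightarrow> real) \<Rightarrow> bool" where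
  "admissible F G \<longleftrightarrow> regular G \<and> (\<forall>z\<in>unit_square. \<bar>G z\<bar> \<le> F z \<and> \<bar>G z\<bar> \<le> 1 - F z) \<and>
     (\<forall>x\<in>unit_interval. \<forall>y\<in>unit_interval. x \<le> y \<longrightarrow>
        \<bar>marg1 G y - marg1 G x\<bar> \<le> marg1 F y - marg1 F x \<and> \<bar>marg2 G y - marg2 G x\<bar> \<le> marg2 F y - marg2 F x)"

lemma admissible_combination:
  assumes "admissible F G" "admissible F H" and ab: "\<bar>a\<bar> + \<bar>b\<bar> \<le> 1"
  shows "admissible F (\<lambda>z. a * G z + b * H z)"
proof -
  have *: "\<bar>a * s + b * t\<bar> \<le> c" if "\<bar>s\<bar> \<le> c" "\<bar>t\<bar> \<le> c" for s t c :: real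
  proof -
    have "\<bar>a * s + b * t\<bar> \<le> \<bar>a\<bar> * \<bar>s\<bar> + \<bar>b\<bar> * \<bar>t\<bar>"
      using abs_triangle_ineq[of "a * s" "b * t"] by (simp add: abs_mult)
    also have "\<dots> \<le> \<bar>a\<bar> * c + \<bar>b\<bar> * c" using that by (intro add_mono mult_left_mono) auto
    also have "\<dots> = (\<bar>a\<bar> + \<bar>b\<bar>) * c" by (simp add: distrib_right)
    also have "\<dots> \<le> 1 * c" using ab that by (intro mult_right_mono) auto
    finally show ?thesis by simp
  qed
  have G: "regular G" and H: "regular H" using assms by (auto simp: admissible_def)
  have e: "a * g + b * h - (a * g' + b * h') = a * (g - g') + b * (h - h')" for g g' h h' :: real
    by (simp add: algebra_simps)
  show ?thesis
    unfolding admissible_def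
  proof (intro conjI ballI impI)
    show "regular (\<lambda>z. a * G z + b * H z)" by (intro regular_add regular_cmult G H)
  next
    fix z assume "z \<in> unit_square"
    then show "\<bar>a * G z + b * H z\<bar> \<le> F z" "\<bar>a * G z + b * H z\<bar> \<le> 1 - F z"
      using assms(1,2) by (auto simp: admissible_def intro!: *)
  next
    fix x y :: real assume xy: "x \<in> unit_interval" "y \<in> unit_interval" "x \<le> y"
    show "\<bar>marg1 (\<lambda>z. a * G z + b * H z) y - marg1 (\<lambda>z. a * G z + b * H z) x\<bar> \<le> marg1 F y - marg1 F x"
      "\<bar>marg2 (\<lambda>z. a * G z + b * H z) y - marg2 (\<lambda>z. a * G z + b * H z) x\<bar> \<le> marg2 F y - marg2 F x"
      unfolding marg_linear[OF G H xy(1)] marg_linear[OF G H xy(2)] e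
      using assms(1,2) xy by (auto simp: admissible_def intro!: *)
  qed
qed

section \<open>The constrained functional and extremality\<close>

definition weight :: "(real \<Rightarrow> real) \<Rightarrow> (real \<Rightarrow> real) \<Rightarrow> (real \<times> real \<Rightarrow> real) \<Rightarrow> real" where
  "weight \<psi>1 \<psi>2 g = (LINT x|LI. marg1 g x * \<psi>1 x) + (LINT x|LI. marg2 g x * \<psi>2 x)"

lemma integrable_mult_essentially_bounded:
  assumes "essentially_bounded \<psi>" "p \<in> borel_measurable LI" "\<And>x. x \<in> unit_interval \<Longrightarrow> \<bar>p x\<bar> \<le> B"
  shows "integrable LI (\<lambda>x. p x * \<psi> x)"
proof -
  obtain C where C: "AE x in LI. \<bar>\<psi> x\<bar> \<le> C" and m: "\<psi> \<in> borel_measurable LI"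
    using assms(1) by (auto simp: essentially_bounded_def)
  show ?thesis
  proof (rule LI.integrable_const_bound[where B="B * C"])
    show "AE x in LI. norm (p x * \<psi> x) \<le> B * C"
      using C AE_space
    proof eventually_elim
      case (elim x)
      then have "\<bar>p x\<bar> * \<bar>\<psi> x\<bar> \<le> B * C"
        using assms(3)[of x] by (intro mult_mono) auto
      then show ?case by (simp add: abs_mult)
    qed
    show "(\<lambda>x. p x * \<psi> x) \<in> borel_measurable LI" using assms(2) m by measurable
  qed
qed

lemma weight_linear:
  assumes \<psi>: "essentially_bounded \<psi>1" "essentially_bounded \<psi>2" and g: "regular g" and h: "regular h"
  shows "weight \<psi>1 \<psi>2 (\<lambda>z. a * g z + b * h z) = a * weight \<psi>1 \<psi>2 g + b * weight \<psi>1 \<psi>2 h"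
proof -
  obtain Bg where Bg: "\<And>x. x \<in> unit_interval \<Longrightarrow> \<bar>marg1 g x\<bar> \<le> Bg" "\<And>x. x \<in> unit_interval \<Longrightarrow> \<bar>marg2 g x\<bar> \<le> Bg"
    using regularD(7)[OF g] by blast
  obtain Bh where Bh: "\<And>x. x \<in> unit_interval \<Longrightarrow> \<bar>marg1 h x\<bar> \<le> Bh" "\<And>x. x \<in> unit_interval \<Longrightarrow> \<bar>marg2 h x\<bar> \<le> Bh"
    using regularD(7)[OF h] by blast
  note int = integrable_mult_essentially_bounded[OF \<psi>(1) regularD(5)[OF g] Bg(1)]
    integrable_mult_essentially_bounded[OF \<psi>(1) regularD(5)[OF h] Bh(1)]
    integrable_mult_essentially_bounded[OF \<psi>(2) regularD(6)[OF g] Bg(2)]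
    integrable_mult_essentially_bounded[OF \<psi>(2) regularD(6)[OF h] Bh(2)]
  have "(LINT x|LI. marg1 (\<lambda>z. a * g z + b * h z) x * \<psi>1 x) = (LINT x|LI. a * (marg1 g x * \<psi>1 x) + b * (marg1 h x * \<psi>1 x))"
    by (intro Bochner_Integration.integral_cong refl) (simp add: marg_linear[OF g h] algebra_simps)
  also have "\<dots> = a * (LINT x|LI. marg1 g x * \<psi>1 x) + b * (LINT x|LI. marg1 h x * \<psi>1 x)"
    using int by simp
  finally have 1: "(LINT x|LI. marg1 (\<lambda>z. a * g z + b * h z) x * \<psi>1 x) = \<dots>" .
  have "(LINT x|LI. marg2 (\<lambda>z. a * g z + b * h z) x * \<psi>2 x) = (LINT x|LI. a * (marg2 g x * \<psi>2 x) + b * (marg2 h x * \<psi>2 x))"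
    by (intro Bochner_Integration.integral_cong refl) (simp add: marg_linear[OF g h] algebra_simps)
  also have "\<dots> = a * (LINT x|LI. marg2 g x * \<psi>2 x) + b * (LINT x|LI. marg2 h x * \<psi>2 x)"
    using int by simp
  finally have 2: "(LINT x|LI. marg2 (\<lambda>z. a * g z + b * h z) x * \<psi>2 x) = \<dots>" .
  show ?thesis unfolding weight_def 1 2 by (simp add: algebra_simps)
qed

lemma Qbar_perturbation:
  assumes \<psi>: "essentially_bounded \<psi>1" "essentially_bounded \<psi>2" and H: "regular H" "H ` unit_square \<subseteq> {0..1}"
    and mono: "mono_on unit_interval (marg1 H)" "mono_on unit_interval (marg2 H)"
    and w: "weight \<psi>1 \<psi>2 H \<le> \<eta>"
  shows "(left_reg (marg1 H), left_reg (marg2 H)) \<in> Qbar \<psi>1 \<psi>2 \<eta>"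
    "AE x in LI. left_reg (marg1 H) x = marg1 H x" "AE x in LI. left_reg (marg2 H) x = marg2 H x"
proof -
  have r: "marg1 H ` unit_interval \<subseteq> {0..1}" "marg2 H ` unit_interval \<subseteq> {0..1}"
    using marg_mono[OF regular_const H(1), of _ 0] marg_mono[OF H(1) regular_const, of _ 1] H(2)
    by (auto simp: marg_const image_subset_iff)
  note l1 = left_reg[OF mono(1) r(1)] and l2 = left_reg[OF mono(2) r(2)]
  show "AE x in LI. left_reg (marg1 H) x = marg1 H x" "AE x in LI. left_reg (marg2 H) x = marg2 H x" by fact+
  have "rationalizes H (left_reg (marg1 H), left_reg (marg2 H))"
    unfolding rationalizes_iff_marg using l1(2) l2(2) regularD(1)[OF H(1)] H(2) by simp
  then have "(left_reg (marg1 H), left_reg (marg2 H)) \<in> Q"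
    using l1(1) l2(1) by (auto simp: Q_def rationalizable_def)
  moreover have "(LINT x|LI. left_reg p x * \<psi> x) = (LINT x|LI. p x * \<psi> x)"
    if "essentially_bounded \<psi>" "p \<in> borel_measurable LI" "AE x in LI. left_reg p x = p x"
      "nondecreasing_left_cont (left_reg p)" for p \<psi>
  proof (rule integral_cong_AE)
    have "left_reg p \<in> borel_measurable LI" "\<psi> \<in> borel_measurable LI"
      using that by (auto simp: nondecreasing_left_cont_def essentially_bounded_def intro: mono_on_measurable_LI)
    then show "(\<lambda>x. left_reg p x * \<psi> x) \<in> borel_measurable LI" "(\<lambda>x. p x * \<psi> x) \<in> borel_measurable LI"
      using that(2) by measurable
    show "AE x in LI. left_reg p x * \<psi> x = p x * \<psi> x" using that(3) by eventually_elim simp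
  qed
  ultimately show "(left_reg (marg1 H), left_reg (marg2 H)) \<in> Qbar \<psi>1 \<psi>2 \<eta>"
    using w l1 l2 \<psi> regularD(5,6)[OF H(1)] by (simp add: Qbar_def weight_def)
qed

lemma weight_rationalizes:
  assumes \<psi>: "essentially_bounded \<psi>1" "essentially_bounded \<psi>2" and q: "q \<in> Qbar \<psi>1 \<psi>2 \<eta>"
    and F: "rationalizes F q" "regular F"
  shows "weight \<psi>1 \<psi>2 F \<le> \<eta>"
proof -
  have nd: "mono_on unit_interval (fst q)" "mono_on unit_interval (snd q)"
    using q by (auto simp: Qbar_def Q_def nondecreasing_left_cont_def)
  have eq: "(LINT x|LI. p x * \<psi> x) = (LINT x|LI. p' x * \<psi> x)"
    if "essentially_bounded \<psi>" "p \<in> borel_measurable LI" "mono_on unit_interval p'" "AE x in LI. p' x = p x" for p p' \<psi>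
  proof (rule integral_cong_AE)
    have "p' \<in> borel_measurable LI" "\<psi> \<in> borel_measurable LI"
      using that by (auto simp: essentially_bounded_def intro: mono_on_measurable_LI)
    then show "(\<lambda>x. p x * \<psi> x) \<in> borel_measurable LI" "(\<lambda>x. p' x * \<psi> x) \<in> borel_measurable LI"
      using that(2) by measurable
    show "AE x in LI. p x * \<psi> x = p' x * \<psi> x" using that(4) by eventually_elim simp
  qed
  show ?thesis
    using q F(1) eq[OF \<psi>(1) regularD(5)[OF F(2)] nd(1)] eq[OF \<psi>(2) regularD(6)[OF F(2)] nd(2)]
    by (simp add: weight_def Qbar_def rationalizes_iff_marg)
qed

text \<open>As \<open>G\<close> has weight 0, \<open>F + G\<close> and \<open>F - G\<close> both
  respect the constraint, and \<open>q\<close> is the midpoint of their margins. Extremality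
  identifies the two pairs, whose difference is twice the margins of \<open>G\<close>.\<close>

lemma extreme_point_perturbation:
  assumes \<psi>: "essentially_bounded \<psi>1" "essentially_bounded \<psi>2"
    and q: "extreme_point_ae q (Qbar \<psi>1 \<psi>2 \<eta>)" and F: "rationalizes F q" "regular F"
    and G: "admissible F G" "weight \<psi>1 \<psi>2 G = 0"
  shows "(AE x in LI. marg1 G x = 0) \<and> (AE x in LI. marg2 G x = 0)"
proof -
  have qQ: "q \<in> Qbar \<psi>1 \<psi>2 \<eta>" using q by (simp add: extreme_point_ae_def)
  have Gr: "regular G" using G by (simp add: admissible_def)
  define H where "H s z = 1 * F z + s * G z" for s :: real and z
  define p where "p s = (left_reg (marg1 (H s)), left_reg (marg2 (H s)))" for s
  have Hr: "regular (H s)" for s unfolding H_def by (intro regular_add regular_cmult F Gr)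
  have m: "marg1 (H s) x = marg1 F x + s * marg1 G x" "marg2 (H s) x = marg2 F x + s * marg2 G x"
    if "x \<in> unit_interval" for s x
    unfolding H_def marg_linear[OF F(2) Gr that] by simp_all
  have p: "p s \<in> Qbar \<psi>1 \<psi>2 \<eta>" "AE x in LI. fst (p s) x = marg1 F x + s * marg1 G x"
    "AE x in LI. snd (p s) x = marg2 F x + s * marg2 G x" if s: "s \<in> {1, -1}" for s
  proof -
    have 1: "H s ` unit_square \<subseteq> {0..1}"
    proof
      fix c assume "c \<in> H s ` unit_square"
      then obtain z where z: "z \<in> unit_square" "c = H s z" by blast
      then have "\<bar>G z\<bar> \<le> F z" "\<bar>G z\<bar> \<le> 1 - F z" using G by (auto simp: admissible_def)
      then show "c \<in> {0..1}" using s z by (auto simp: H_def)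
    qed
    have d: "\<bar>marg1 G y - marg1 G x\<bar> \<le> marg1 F y - marg1 F x \<and> \<bar>marg2 G y - marg2 G x\<bar> \<le> marg2 F y - marg2 F x"
      if "x \<in> unit_interval" "y \<in> unit_interval" "x \<le> y" for x y
      using G that by (auto simp: admissible_def)
    have 2: "mono_on unit_interval (marg1 (H s))" "mono_on unit_interval (marg2 (H s))"
      using s d by (auto intro!: mono_onI simp: m; force)+
    have "weight \<psi>1 \<psi>2 (H s) \<le> \<eta>"
      unfolding H_def weight_linear[OF \<psi> F(2) Gr] using weight_rationalizes[OF \<psi> qQ F] G(2) by simp
    note * = Qbar_perturbation[OF \<psi> Hr 1 2 this]
    show "p s \<in> Qbar \<psi>1 \<psi>2 \<eta>" unfolding p_def by (rule *)
    show "AE x in LI. fst (p s) x = marg1 F x + s * marg1 G x"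
      using *(2) AE_space by eventually_elim (simp add: m p_def)
    show "AE x in LI. snd (p s) x = marg2 F x + s * marg2 G x"
      using *(3) AE_space by eventually_elim (simp add: m p_def)
  qed
  note p1 = p(2,3)[of 1, simplified] and p2 = p(2,3)[of "-1", simplified]
  have "ae_eq q (convex_comb (1/2) (p 1) (p (-1)))"
    unfolding ae_eq_def
  proof
    have "AE x in LI. fst q x = marg1 F x" using F by (simp add: rationalizes_iff_marg)
    then show "AE x in LI. fst q x = fst (convex_comb (1/2) (p 1) (p (-1))) x"
      using p1(1) p2(1) by eventually_elim (simp add: convex_comb_def field_simps)
    have "AE x in LI. snd q x = marg2 F x" using F by (simp add: rationalizes_iff_marg)
    then show "AE x in LI. snd q x = snd (convex_comb (1/2) (p 1) (p (-1))) x"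
      using p1(2) p2(2) by eventually_elim (simp add: convex_comb_def field_simps)
  qed
  then have eq: "ae_eq (p 1) (p (-1))"
    using q p(1)[of 1] p(1)[of "-1"] unfolding extreme_point_ae_def
    by (metis insertI1 insertI2 half_gt_zero_iff less_numeral_extra(1) field_sum_of_halves less_add_same_cancel1)
  show ?thesis
  proof
    have "AE x in LI. fst (p 1) x = fst (p (-1)) x" using eq by (simp add: ae_eq_def)
    then show "AE x in LI. marg1 G x = 0"
      using p1(1) p2(1) by eventually_elim simp
    have "AE x in LI. snd (p 1) x = snd (p (-1)) x" using eq by (simp add: ae_eq_def)
    then show "AE x in LI. marg2 G x = 0"
      using p1(2) p2(2) by eventually_elim simp
  qed
qed

text \<open>A second perturbation absorbs the single linear constraint: \<open>(v, - u)\<close> is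
  orthogonal to the weights \<open>(u, v)\<close> of \<open>G\<close> and \<open>H\<close>.\<close>

lemma extreme_point_two_perturbations:
  assumes \<psi>: "essentially_bounded \<psi>1" "essentially_bounded \<psi>2"
    and q: "extreme_point_ae q (Qbar \<psi>1 \<psi>2 \<eta>)" and F: "rationalizes F q" "regular F"
    and G: "admissible F G" and H: "admissible F H"
  obtains a b where "a \<noteq> 0 \<or> b \<noteq> 0" "AE x in LI. a * marg1 G x + b * marg1 H x = 0"
    "AE x in LI. a * marg2 G x + b * marg2 H x = 0"
proof -
  have r: "regular G" "regular H" using G H by (auto simp: admissible_def)
  define u where "u = weight \<psi>1 \<psi>2 G"
  define v where "v = weight \<psi>1 \<psi>2 H"
  \<comment> \<open>Scaling by \<open>s\<close> gives
    \<open>\<bar>a\<bar> + \<bar>b\<bar> \<le> 1\<close>, as \<open>admissible_combination\<close>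
    requires. If both weights vanish, \<open>(v, - u)\<close> is trivial and \<open>G\<close> alone
    serves.\<close>
  define s where "s = 1 / (1 + \<bar>u\<bar> + \<bar>v\<bar>)"
  define a where "a = (if u = 0 \<and> v = 0 then 1 else s * v)"
  define b where "b = (if u = 0 \<and> v = 0 then 0 else - s * u)"
  have s: "0 < s" by (simp add: s_def add_pos_nonneg)
  have "\<bar>a\<bar> + \<bar>b\<bar> \<le> 1"
  proof -
    have "s * \<bar>v\<bar> + s * \<bar>u\<bar> = (\<bar>v\<bar> + \<bar>u\<bar>) / (1 + \<bar>u\<bar> + \<bar>v\<bar>)" by (simp add: s_def add_divide_distrib)
    also have "\<dots> \<le> 1" by (subst divide_le_eq_1_pos) auto
    finally show ?thesis using s by (simp add: a_def b_def abs_mult)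
  qed
  from admissible_combination[OF G H this] have adm: "admissible F (\<lambda>z. a * G z + b * H z)" .
  have "weight \<psi>1 \<psi>2 (\<lambda>z. a * G z + b * H z) = 0"
    unfolding weight_linear[OF \<psi> r] u_def[symmetric] v_def[symmetric] by (simp add: a_def b_def)
  from extreme_point_perturbation[OF \<psi> q F adm this]
  have ae: "AE x in LI. marg1 (\<lambda>z. a * G z + b * H z) x = 0" "AE x in LI. marg2 (\<lambda>z. a * G z + b * H z) x = 0"
    by auto
  show ?thesis
  proof
    show "a \<noteq> 0 \<or> b \<noteq> 0" using s by (auto simp: a_def b_def)
    show "AE x in LI. a * marg1 G x + b * marg1 H x = 0"
      using ae(1) AE_space by eventually_elim (simp add: marg_linear[OF r])
    show "AE x in LI. a * marg2 G x + b * marg2 H x = 0"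
      using ae(2) AE_space by eventually_elim (simp add: marg_linear[OF r])
  qed
qed

section \<open>Two levels and uniqueness\<close>

lemma rationalizes_range: "rationalizes f q \<Longrightarrow> z \<in> unit_square \<Longrightarrow> 0 \<le> f z \<and> f z \<le> 1"
  unfolding rationalizes_def image_subset_iff by (meson atLeastAtMost_iff)

lemma marg_increment_bound:
  fixes G F :: "real \<times> real \<Rightarrow> real"
  assumes G: "regular G" and F: "regular F" and xy: "x \<in> unit_interval" "x' \<in> unit_interval"
  shows "(\<And>t. t \<in> unit_interval \<Longrightarrow> \<bar>G (x', t) - G (x, t)\<bar> \<le> F (x', t) - F (x, t)) \<Longrightarrow>
      \<bar>marg1 G x' - marg1 G x\<bar> \<le> marg1 F x' - marg1 F x"
    "(\<And>t. t \<in> unit_interval \<Longrightarrow> \<bar>G (t, x') - G (t, x)\<bar> \<le> F (t, x') - F (t, x)) \<Longrightarrow>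
      \<bar>marg2 G x' - marg2 G x\<bar> \<le> marg2 F x' - marg2 F x"
proof -
  have *: "\<bar>integral\<^sup>L LI g' - integral\<^sup>L LI g\<bar> \<le> integral\<^sup>L LI f' - integral\<^sup>L LI f"
    if i: "integrable LI g" "integrable LI g'" "integrable LI f" "integrable LI f'"
      and le: "\<And>t. t \<in> unit_interval \<Longrightarrow> \<bar>g' t - g t\<bar> \<le> f' t - f t" for g g' f f' :: "real \<Rightarrow> real"
  proof -
    have "\<bar>integral\<^sup>L LI g' - integral\<^sup>L LI g\<bar> = \<bar>LINT t|LI. g' t - g t\<bar>" using i by simp
    also have "\<dots> \<le> (LINT t|LI. \<bar>g' t - g t\<bar>)" by (rule integral_abs_bound)
    also have "\<dots> \<le> (LINT t|LI. f' t - f t)" using i le by (intro integral_mono) auto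
    also have "\<dots> = integral\<^sup>L LI f' - integral\<^sup>L LI f" using i by simp
    finally show ?thesis .
  qed
  show "\<bar>marg1 G x' - marg1 G x\<bar> \<le> marg1 F x' - marg1 F x"
    if "\<And>t. t \<in> unit_interval \<Longrightarrow> \<bar>G (x', t) - G (x, t)\<bar> \<le> F (x', t) - F (x, t)"
    unfolding marg1_def by (intro * regularD(3) G F xy that)
  show "\<bar>marg2 G x' - marg2 G x\<bar> \<le> marg2 F x' - marg2 F x"
    if "\<And>t. t \<in> unit_interval \<Longrightarrow> \<bar>G (t, x') - G (t, x)\<bar> \<le> F (t, x') - F (t, x)"
    unfolding marg2_def by (intro * regularD(4) G F xy that)
qed

text \<open>A 1-Lipschitz \<open>h\<close> does not enlarge the increments of the nondecreasing
  \<open>f\<close>, pointwise and hence in the margins. Vanishing at 0 and 1, it is bounded by the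
  distances of \<open>f\<close> to these two values.\<close>

lemma admissible_lipschitz:
  fixes f :: "real \<times> real \<Rightarrow> real"
  assumes f: "mono_on unit_square f" and fb: "\<And>z. z \<in> unit_square \<Longrightarrow> 0 \<le> f z \<and> f z \<le> 1"
    and h: "h \<in> borel_measurable borel" "\<And>t. \<bar>h t\<bar> \<le> C" "\<And>s t. \<bar>h s - h t\<bar> \<le> \<bar>s - t\<bar>" "h 0 = 0" "h 1 = 0"
  shows "admissible f (\<lambda>z. h (f z))"
proof -
  note rf = regular_mono[OF f] and rh = regular_compose[OF f h(1,2)]
  show ?thesis
    unfolding admissible_def
  proof (intro conjI ballI impI)
    show "regular (\<lambda>z. h (f z))" by (rule rh)
  next
    fix z assume "z \<in> unit_square"
    then show "\<bar>h (f z)\<bar> \<le> f z" "\<bar>h (f z)\<bar> \<le> 1 - f z"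
      using fb[of z] h(3)[of "f z" 0] h(3)[of "f z" 1] h(4,5) by auto
  next
    fix x y :: real assume xy: "x \<in> unit_interval" "y \<in> unit_interval" "x \<le> y"
    have "\<bar>h (f w) - h (f z)\<bar> \<le> f w - f z" if "z \<in> unit_square" "w \<in> unit_square" "z \<le> w" for z w
      using h(3)[of "f w" "f z"] monotone_onD[OF f that] by auto
    then show "\<bar>marg1 (\<lambda>z. h (f z)) y - marg1 (\<lambda>z. h (f z)) x\<bar> \<le> marg1 f y - marg1 f x"
      "\<bar>marg2 (\<lambda>z. h (f z)) y - marg2 (\<lambda>z. h (f z)) x\<bar> \<le> marg2 f y - marg2 f x"
      using xy by (auto intro!: marg_increment_bound[OF rh rf])
  qed
qed

lemma AE_zero_of_sign:
  assumes K: "regular K" "integral\<^sup>L LS K = 0"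
    and sgn: "(\<forall>z\<in>unit_square. 0 \<le> K z) \<or> (\<forall>z\<in>unit_square. K z \<le> 0)"
  shows "AE z in LS. K z = 0"
  using sgn
proof
  assume "\<forall>z\<in>unit_square. 0 \<le> K z"
  then have "AE z in LS. 0 \<le> K z" by (intro AE_I2) auto
  then show ?thesis using K regularD(2)[OF K(1)] by (simp add: integral_nonneg_eq_0_iff_AE)
next
  assume "\<forall>z\<in>unit_square. K z \<le> 0"
  then have "AE z in LS. 0 \<le> - K z" by (intro AE_I2) auto
  moreover have "(LINT z|LS. - K z) = 0" using K by simp
  ultimately have "AE z in LS. - K z = 0"
    using regularD(2)[OF K(1)] by (subst (asm) integral_nonneg_eq_0_iff_AE) auto
  then show ?thesis by eventually_elim simp
qed

text \<open>The vertical sections of the set \<open>f < s\<close> are initial intervals ending at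
  \<open>c x\<close>, and \<open>c\<close> is nonincreasing, so the sign of \<open>y - c x\<close>
  tells the two sides apart. \<open>insert 0\<close> covers sections that lie entirely above the
  level, and the clamp \<open>k\<close> makes \<open>u\<close> monotone on the whole line.\<close>

lemma separating_function:
  fixes f :: "real \<times> real \<Rightarrow> real"
  assumes f: "mono_on unit_square f"
  obtains u where "mono u" "\<And>x. \<bar>u x\<bar> \<le> 1"
    "\<And>x y. (x, y) \<in> unit_square \<Longrightarrow> f (x, y) < s \<Longrightarrow> u x + y \<le> 0"
    "\<And>x y. (x, y) \<in> unit_square \<Longrightarrow> s \<le> f (x, y) \<Longrightarrow> 0 \<le> u x + y"
proof -
  define c where "c x = Sup (insert 0 {y \<in> unit_interval. f (x, y) < s})" for x
  define k where "k x = max 0 (min 1 x)" for x :: real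
  have kI: "k x \<in> unit_interval" for x by (auto simp: k_def)
  have kx: "k x = x" if "x \<in> unit_interval" for x using that by (auto simp: k_def)
  have bdd: "bdd_above (insert 0 {y \<in> unit_interval. f (x, y) < s})" for x
    by (rule bdd_aboveI[of _ 1]) auto
  have c01: "0 \<le> c x \<and> c x \<le> 1" for x
    unfolding c_def by (auto intro!: cSup_upper cSup_least bdd)
  show ?thesis
  proof
    show "mono (\<lambda>x. - c (k x))"
    proof
      fix x x' :: real assume le: "x \<le> x'"
      have "c (k x') \<le> c (k x)"
        unfolding c_def
      proof (rule cSup_subset_mono)
        have "f (k x, y) \<le> f (k x', y)" if "y \<in> unit_interval" for y
          using le that kI by (auto intro!: monotone_onD[OF f] simp: k_def)
        then show "insert 0 {y \<in> unit_interval. f (k x', y) < s} \<subseteq> insert 0 {y \<in> unit_interval. f (k x, y) < s}"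
          by force
      qed (use bdd in auto)
      then show "- c (k x) \<le> - c (k x')" by simp
    qed
    show "\<bar>- c (k x)\<bar> \<le> 1" for x using c01[of "k x"] by auto
    fix x y :: real assume xy: "(x, y) \<in> unit_square"
    show "- c (k x) + y \<le> 0" if "f (x, y) < s"
    proof -
      have "y \<le> c x" unfolding c_def by (rule cSup_upper[OF _ bdd]) (use xy that in auto)
      then show ?thesis using kx xy by auto
    qed
    show "0 \<le> - c (k x) + y" if "s \<le> f (x, y)"
    proof -
      have "c x \<le> y"
        unfolding c_def
      proof (rule cSup_least)
        fix y' assume "y' \<in> insert 0 {y \<in> unit_interval. f (x, y) < s}"
        then consider "y' = 0" | "y' \<in> unit_interval" "f (x, y') < s" by blast
        then show "y' \<le> y"
        proof cases
          case 2
          show ?thesis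
          proof (rule ccontr)
            assume "\<not> y' \<le> y"
            then have "f (x, y) \<le> f (x, y')" using 2 xy by (intro monotone_onD[OF f]) auto
            with 2 that show False by simp
          qed
        qed (use xy in auto)
      qed auto
      then show ?thesis using kx xy by auto
    qed
  qed
qed

text \<open>A function with zero margins is orthogonal to every bounded function of one coordinate,
  hence to sums of two of them. The test functions 1 and \<open>u x + y\<close> used below are of
  this kind.\<close>

lemma zero_margins_integral:
  assumes K: "regular K" "AE x in LI. marg1 K x = 0" "AE x in LI. marg2 K x = 0"
    and u: "u \<in> borel_measurable borel" "\<And>x. x \<in> unit_interval \<Longrightarrow> \<bar>u x\<bar> \<le> C"
  shows "(LINT z|LS. K z * u (fst z)) = 0" "(LINT z|LS. K z * u (snd z)) = 0"
proof -
  obtain B where B: "\<And>z. z \<in> unit_square \<Longrightarrow> \<bar>K z\<bar> \<le> B" using K(1) unfolding regular_def by blast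
  note eq = integral_fst_snd_weight[of K B u C, OF regularD(1)[OF K(1)] B u]
  have "(LINT z|LS. K z * u (fst z)) = (LINT x|LI. marg1 K x * u x)"
    unfolding marg1_def using eq(1) by simp
  also have "\<dots> = 0" by (rule integral_eq_zero_AE) (use K(2) in \<open>auto elim: eventually_mono\<close>)
  finally show "(LINT z|LS. K z * u (fst z)) = 0" .
  have "(LINT z|LS. K z * u (snd z)) = (LINT x|LI. marg2 K x * u x)"
    unfolding marg2_def using eq(2) by simp
  also have "\<dots> = 0" by (rule integral_eq_zero_AE) (use K(3) in \<open>auto elim: eventually_mono\<close>)
  finally show "(LINT z|LS. K z * u (snd z)) = 0" .
qed

text \<open>For \<open>a\<close> and \<open>b\<close> of equal sign the combination \<open>K\<close>
  has constant sign and is tested against 1. For opposite signs \<open>K\<close> changes sign across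
  the level \<open>s\<close>, as \<open>w\<close> does, so \<open>K * w\<close> has constant sign.
  In both cases the integral vanishes, hence so does the integrand almost everywhere.\<close>

lemma zero_margins_separated:
  fixes f G H :: "real \<times> real \<Rightarrow> real"
  assumes f: "mono_on unit_square f" and G: "regular G" and H: "regular H"
    and Gp: "\<And>z. z \<in> unit_square \<Longrightarrow> 0 \<le> G z" "\<And>z. z \<in> unit_square \<Longrightarrow> s \<le> f z \<Longrightarrow> G z = 0"
    and Hp: "\<And>z. z \<in> unit_square \<Longrightarrow> 0 \<le> H z" "\<And>z. z \<in> unit_square \<Longrightarrow> f z < s \<Longrightarrow> H z = 0"
    and m: "AE x in LI. a * marg1 G x + b * marg1 H x = 0" "AE x in LI. a * marg2 G x + b * marg2 H x = 0"
  shows "AE z in LS. a * G z + b * H z = 0"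
proof -
  define K where "K z = a * G z + b * H z" for z
  have K: "regular K" unfolding K_def by (intro regular_add regular_cmult G H)
  have m': "AE x in LI. marg1 K x = 0" "AE x in LI. marg2 K x = 0"
    unfolding K_def using m(1) AE_space m(2)
    by (auto elim!: eventually_elim2 simp: marg_linear[OF G H])
  obtain u where u: "mono u" "\<And>x. \<bar>u x\<bar> \<le> 1"
    "\<And>x y. (x, y) \<in> unit_square \<Longrightarrow> f (x, y) < s \<Longrightarrow> u x + y \<le> 0"
    "\<And>x y. (x, y) \<in> unit_square \<Longrightarrow> s \<le> f (x, y) \<Longrightarrow> 0 \<le> u x + y"
    by (rule separating_function[OF f]) blast
  have um: "u \<in> borel_measurable borel" using u(1) by (rule borel_measurable_mono)
  define w where "w z = u (fst z) + snd z" for z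
  have wr: "regular w"
  proof (rule regular_mono)
    show "mono_on unit_square w"
      unfolding w_def by (intro mono_onI add_mono monoD[OF u(1)]) (auto simp: less_eq_prod_def)
  qed
  \<comment> \<open>On a vertical section \<open>w\<close> vanishes only at the height
    \<open>- u x\<close>, so \<open>w\<close> may be cancelled almost everywhere.\<close>
  have w0: "AE z in LS. w z \<noteq> 0"
  proof -
    have [measurable]: "w \<in> borel_measurable LS" by (rule regularD(1)[OF wr])
    have "AE z in LS. (of_bool (w z = 0) :: real) = 0"
    proof (rule AE_LS_from_vertical_sections)
      show "AE x in LI. AE y in LI. (of_bool (w (x, y) = 0) :: real) = 0"
      proof (rule AE_I2)
        fix x show "AE y in LI. (of_bool (w (x, y) = 0) :: real) = 0"
          using AE_LI_neq[of "- u x"] by eventually_elim (simp add: w_def add_eq_0_iff)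
      qed
    qed measurable
    then show ?thesis by eventually_elim simp
  qed
  have i1: "(LINT z|LS. K z) = 0"
    using zero_margins_integral(1)[OF K m', of "\<lambda>_. 1" 1] by simp
  have i2: "(LINT z|LS. K z * w z) = 0"
  proof -
    have r: "regular (\<lambda>z. u (fst z))" "regular (\<lambda>z. snd z)"
      by (auto intro!: regular_mono mono_onI monoD[OF u(1)] simp: less_eq_prod_def)
    have "(LINT z|LS. K z * w z) = (LINT z|LS. K z * u (fst z) + K z * snd z)"
      by (simp add: w_def distrib_left)
    also have "\<dots> = (LINT z|LS. K z * u (fst z)) + (LINT z|LS. K z * snd z)"
      by (intro Bochner_Integration.integral_add regularD(2) regular_mult K r)
    also have "\<dots> = 0"
      using zero_margins_integral(1)[OF K m' um, of 1] zero_margins_integral(2)[OF K m', of "\<lambda>y. y" 1] u(2) by simp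
    finally show ?thesis .
  qed
  have ws: "f z < s \<Longrightarrow> w z \<le> 0" "s \<le> f z \<Longrightarrow> 0 \<le> w z" if "z \<in> unit_square" for z
    using u(3,4)[of "fst z" "snd z"] that by (auto simp: w_def)
  consider "0 \<le> a \<and> 0 \<le> b \<or> a \<le> 0 \<and> b \<le> 0" | "a \<le> 0 \<and> 0 \<le> b \<or> 0 \<le> a \<and> b \<le> 0" by linarith
  then have "AE z in LS. K z * w z = 0"
  proof cases
    case 1
    then have "(\<forall>z\<in>unit_square. 0 \<le> K z) \<or> (\<forall>z\<in>unit_square. K z \<le> 0)"
      unfolding K_def using Gp(1) Hp(1) by (auto intro!: add_nonneg_nonneg add_nonpos_nonpos mult_nonneg_nonneg mult_nonpos_nonneg)
    from AE_zero_of_sign[OF K i1 this] show ?thesis by eventually_elim simp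
  next
    case 2
    have e: "K z * w z = (if f z < s then a * (G z * w z) else b * (H z * w z))" if "z \<in> unit_square" for z
      using that Gp(2) Hp(2) by (auto simp: K_def)
    have gs: "f z < s \<Longrightarrow> G z * w z \<le> 0" "\<not> f z < s \<Longrightarrow> 0 \<le> H z * w z" if "z \<in> unit_square" for z
      using ws[OF that] Gp(1)[OF that] Hp(1)[OF that] by (auto intro: mult_nonneg_nonpos)
    have "(\<forall>z\<in>unit_square. 0 \<le> K z * w z) \<or> (\<forall>z\<in>unit_square. K z * w z \<le> 0)"
      using 2
    proof
      assume ab: "a \<le> 0 \<and> 0 \<le> b"
      have "0 \<le> K z * w z" if "z \<in> unit_square" for z
        using e[OF that] gs[OF that] ab by (auto intro: mult_nonpos_nonpos mult_nonneg_nonneg)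
      then show ?thesis by blast
    next
      assume ab: "0 \<le> a \<and> b \<le> 0"
      have "K z * w z \<le> 0" if "z \<in> unit_square" for z
        using e[OF that] gs[OF that] ab by (auto intro: mult_nonneg_nonpos mult_nonpos_nonneg)
      then show ?thesis by blast
    qed
    from AE_zero_of_sign[OF regular_mult[OF K wr] i2 this] show ?thesis .
  qed
  then have "AE z in LS. K z = 0" using w0 by eventually_elim simp
  then show ?thesis by (simp add: K_def)
qed

text \<open>The tents \<open>g\<close> and \<open>h\<close> are positive exactly between 0 and
  \<open>s\<close>, and between \<open>s\<close> and 1. In a vanishing combination of functions with
  disjoint supports each term vanishes, so a nonzero coefficient makes one of the two sets
  null.\<close>

lemma extreme_point_gap:
  assumes \<psi>: "essentially_bounded \<psi>1" "essentially_bounded \<psi>2"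
    and q: "extreme_point_ae q (Qbar \<psi>1 \<psi>2 \<eta>)" and f: "mono_on unit_square f" "rationalizes f q"
    and s: "0 < s" "s < 1"
  shows "(AE z in LS. \<not> (0 < f z \<and> f z < s)) \<or> (AE z in LS. \<not> (s < f z \<and> f z < 1))"
proof -
  define g where "g t = max 0 (min t (s - t))" for t :: real
  define h where "h t = max 0 (min (t - s) (1 - t))" for t :: real
  have fb: "0 \<le> f z \<and> f z \<le> 1" if "z \<in> unit_square" for z using f(2) that by (rule rationalizes_range)
  have G: "admissible f (\<lambda>z. g (f z))"
    by (rule admissible_lipschitz[OF f(1) fb, where C=1]) (use s in \<open>auto simp: g_def\<close>)
  have H: "admissible f (\<lambda>z. h (f z))"
    by (rule admissible_lipschitz[OF f(1) fb, where C=1]) (use s in \<open>auto simp: h_def\<close>)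
  obtain a b where ab: "a \<noteq> 0 \<or> b \<noteq> 0"
    "AE x in LI. a * marg1 (\<lambda>z. g (f z)) x + b * marg1 (\<lambda>z. h (f z)) x = 0"
    "AE x in LI. a * marg2 (\<lambda>z. g (f z)) x + b * marg2 (\<lambda>z. h (f z)) x = 0"
    by (rule extreme_point_two_perturbations[OF \<psi> q f(2) regular_mono[OF f(1)] G H])
  have "AE z in LS. a * g (f z) + b * h (f z) = 0"
  proof (rule zero_margins_separated[where s=s, OF f(1) _ _ _ _ _ _ ab(2,3)])
    show "regular (\<lambda>z. g (f z))" "regular (\<lambda>z. h (f z))" using G H by (auto simp: admissible_def)
  qed (auto simp: g_def h_def)
  then show ?thesis
  proof (cases "a = 0")
    case True
    with ab(1) have "b \<noteq> 0" by simp
    have "AE z in LS. \<not> (s < f z \<and> f z < 1)"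
      using \<open>AE z in LS. a * g (f z) + b * h (f z) = 0\<close>
      by eventually_elim (use True \<open>b \<noteq> 0\<close> in \<open>auto simp: h_def\<close>)
    then show ?thesis by blast
  next
    case False
    have "AE z in LS. \<not> (0 < f z \<and> f z < s)"
      using \<open>AE z in LS. a * g (f z) + b * h (f z) = 0\<close>
      by eventually_elim (use False in \<open>auto simp: g_def h_def\<close>)
    then show ?thesis by blast
  qed
qed

text \<open>By \<open>extreme_point_gap\<close> each level \<open>s\<close> has almost no values of
  \<open>f\<close> strictly between 0 and \<open>s\<close>, or almost none strictly between
  \<open>s\<close> and 1. The first alternative is inherited by smaller levels, and \<open>t\<close>
  is the place where the alternatives switch.\<close>

lemma extreme_point_two_levels:
  assumes \<psi>: "essentially_bounded \<psi>1" "essentially_bounded \<psi>2"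
    and q: "extreme_point_ae q (Qbar \<psi>1 \<psi>2 \<eta>)" and f: "mono_on unit_square f" "rationalizes f q"
  obtains t where "0 \<le> t" "t \<le> 1" "AE z in LS. f z = 0 \<or> f z = t \<or> f z = 1"
proof -
  define P where "P s \<longleftrightarrow> (AE z in LS. \<not> (0 < f z \<and> f z < s))" for s
  \<comment> \<open>With rational levels only countably many null sets are discarded. The 0 inserted
    below is the value of \<open>t\<close> if no level qualifies.\<close>
  define S where "S = {s \<in> \<rat>. 0 < s \<and> s < 1 \<and> P s}"
  define t where "t = Sup (insert 0 S)"
  have bdd: "bdd_above (insert 0 S)" by (rule bdd_aboveI[of _ 1]) (auto simp: S_def)
  have "0 \<le> t" unfolding t_def by (rule cSup_upper[OF _ bdd]) simp
  moreover have "t \<le> 1" unfolding t_def by (rule cSup_least) (auto simp: S_def)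
  ultimately have t: "0 \<le> t" "t \<le> 1" .
  have "AE z in LS. (P s \<longrightarrow> \<not> (0 < f z \<and> f z < s)) \<and> (\<not> P s \<longrightarrow> \<not> (s < f z \<and> f z < 1))"
    if "s \<in> {s \<in> \<rat>. 0 < s \<and> s < 1}" for s
    using extreme_point_gap[OF \<psi> q f, of s] that unfolding P_def[symmetric]
    by (cases "P s") (auto simp: P_def)
  then have "AE z in LS. \<forall>s\<in>{s \<in> \<rat>. 0 < s \<and> s < 1}. (P s \<longrightarrow> \<not> (0 < f z \<and> f z < s)) \<and> (\<not> P s \<longrightarrow> \<not> (s < f z \<and> f z < 1))"
    by (subst AE_ball_countable) (auto intro: countable_subset[OF _ countable_rat])
  then have "AE z in LS. f z = 0 \<or> f z = t \<or> f z = 1"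
    using AE_space
  proof eventually_elim
    case (elim z)
    have fz: "0 \<le> f z \<and> f z \<le> 1" using f(2) elim(2) by (intro rationalizes_range) auto
    show ?case
    proof (rule ccontr)
      assume "\<not> ?case"
      then have ne: "0 < f z" "f z < 1" "f z \<noteq> t" using fz by auto
      show False
      proof (cases "f z < t")
        case True
        then obtain s where s: "s \<in> insert 0 S" "f z < s"
          unfolding t_def using less_cSup_iff[OF _ bdd, of "f z"] by auto
        then have "s \<in> S" using ne by auto
        then show False using elim(1) s ne unfolding S_def by blast
      next
        case False
        then have "t < f z" using ne by simp
        then obtain s where s: "s \<in> \<rat>" "t < s" "s < f z" using Rats_dense_in_real by blast
        have "s \<notin> S"
        proof
          assume "s \<in> S"
          then have "s \<le> t" unfolding t_def by (intro cSup_upper bdd) auto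
          with s show False by simp
        qed
        then have "\<not> P s" using s t ne by (auto simp: S_def)
        then show False using elim(1) s t ne by auto
      qed
    qed
  qed
  with t show ?thesis by (rule that)
qed

text \<open>Taken separately, \<open>f\<close> and \<open>g\<close> could have different
  intermediate values and level sets. Their midpoint \<open>h\<close> rationalizes the same
  \<open>q\<close>, which puts both under one level structure.\<close>

lemma extreme_point_unique_monotone:
  assumes \<psi>: "essentially_bounded \<psi>1" "essentially_bounded \<psi>2"
    and q: "extreme_point_ae q (Qbar \<psi>1 \<psi>2 \<eta>)"
    and f: "mono_on unit_square f" "rationalizes f q" and g: "mono_on unit_square g" "rationalizes g q"
  shows "AE z in LS. f z = g z"
proof -
  note rf = regular_mono[OF f(1)] and rg = regular_mono[OF g(1)]
  define h where "h z = 1/2 * f z + 1/2 * g z" for z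
  have fb: "0 \<le> f z \<and> f z \<le> 1" if "z \<in> unit_square" for z using f(2) that by (rule rationalizes_range)
  have gb: "0 \<le> g z \<and> g z \<le> 1" if "z \<in> unit_square" for z using g(2) that by (rule rationalizes_range)
  have hm: "mono_on unit_square h"
    unfolding h_def by (intro mono_onI add_mono mult_left_mono monotone_onD[OF f(1)] monotone_onD[OF g(1)]) auto
  have hq: "rationalizes h q"
    unfolding rationalizes_iff_marg
  proof (intro conjI)
    show "h \<in> borel_measurable LS" by (rule mono_on_measurable_LS[OF hm])
    show "h ` unit_square \<subseteq> {0..1}"
    proof
      fix c assume "c \<in> h ` unit_square"
      then obtain z where "z \<in> unit_square" "c = h z" by blast
      then show "c \<in> {0..1}" using fb[of z] gb[of z] by (auto simp: h_def)
    qed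
    have "AE x in LI. fst q x = marg1 f x" "AE x in LI. fst q x = marg1 g x"
      using f g by (auto simp: rationalizes_iff_marg)
    then show "AE x in LI. fst q x = marg1 h x"
      unfolding h_def using AE_space
      by eventually_elim (simp add: marg_linear[OF rf rg, of _ "1/2" "1/2", simplified])
    have "AE x in LI. snd q x = marg2 f x" "AE x in LI. snd q x = marg2 g x"
      using f g by (auto simp: rationalizes_iff_marg)
    then show "AE x in LI. snd q x = marg2 h x"
      unfolding h_def using AE_space
      by eventually_elim (simp add: marg_linear[OF rf rg, of _ "1/2" "1/2", simplified])
  qed
  obtain t where t: "0 \<le> t" "t \<le> 1" "AE z in LS. h z = 0 \<or> h z = t \<or> h z = 1"
    by (rule extreme_point_two_levels[OF \<psi> q hm hq])
  have "AE x in LI. fst q x = marg1 f x" "AE x in LI. fst q x = marg1 g x"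
    using f g by (auto simp: rationalizes_iff_marg)
  then have "AE x in LI. AE y in LI. f (x, y) = g (x, y)"
    using AE_LS_sections(1)[OF t(3)] AE_space
  proof eventually_elim
    case (elim x)
    then have x: "x \<in> unit_interval" by simp
    define d where "d y = f (x, y) - g (x, y)" for y
    have di: "integrable LI d" "integral\<^sup>L LI d = 0"
      unfolding d_def using regularD(3)[OF rf x] regularD(3)[OF rg x] elim(1,2) by (auto simp: marg1_def)
    \<comment> \<open>Both values lie in the unit interval, so a mean of 0 or 1 forces them to
      agree.\<close>
    have d0: "d y = 0" if "y \<in> unit_interval" "h (x, y) = 0 \<or> h (x, y) = 1" for y
      using that x fb[of "(x, y)"] gb[of "(x, y)"] by (auto simp: h_def d_def)
    \<comment> \<open>Two nondecreasing functions with constant sum are both constant, hence so is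
      their difference.\<close>
    have dc: "d y = d y'" if "y \<in> unit_interval" "y' \<in> unit_interval" "h (x, y) = t" "h (x, y') = t" for y y'
    proof -
      have *: "d y = d y'" if "y \<in> unit_interval" "y' \<in> unit_interval" "h (x, y) = t" "h (x, y') = t" "y \<le> y'" for y y'
      proof -
        have "f (x, y) \<le> f (x, y')" "g (x, y) \<le> g (x, y')"
          using that x by (auto intro!: monotone_onD[OF f(1)] monotone_onD[OF g(1)])
        then show ?thesis using that by (auto simp: h_def d_def)
      qed
      show ?thesis using *[of y y'] *[of y' y] that by linarith
    qed
    obtain c where c: "\<And>y. y \<in> unit_interval \<Longrightarrow> h (x, y) = t \<Longrightarrow> d y = c"
      using dc by (metis (no_types, lifting))
    \<comment> \<open>Taking only the values 0 and \<open>c\<close>, \<open>d\<close> has constant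
      sign; its integral is zero because \<open>f\<close> and \<open>g\<close> have the same first
      margin at \<open>x\<close>.\<close>
    have val: "AE y in LI. d y = 0 \<or> d y = c"
      using elim(3) AE_space by eventually_elim (use d0 c in auto)
    have "AE y in LI. d y = 0"
    proof (cases "0 \<le> c")
      case True
      have "AE y in LI. 0 \<le> d y" using val by eventually_elim (use True in auto)
      then show ?thesis using di by (simp add: integral_nonneg_eq_0_iff_AE)
    next
      case False
      have "AE y in LI. 0 \<le> - d y" using val by eventually_elim (use False in auto)
      moreover have "(LINT y|LI. - d y) = 0" using di by simp
      ultimately have "AE y in LI. - d y = 0" using di(1) by (subst (asm) integral_nonneg_eq_0_iff_AE) auto
      then show ?thesis by eventually_elim simp
    qed
    then show ?case by eventually_elim (simp add: d_def)
  qed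
  then show ?thesis
    by (rule AE_LS_from_vertical_sections[OF regularD(1)[OF rf] regularD(1)[OF rg]])
qed

section \<open>The rectangle\<close>

lemma up_set_mono: "up_set A \<Longrightarrow> mono_on unit_square (indicat_real A)"
  by (auto intro!: mono_onI simp: up_set_def indicator_def)

lemma up_set_level:
  fixes f :: "real \<times> real \<Rightarrow> real"
  shows "mono_on unit_square f \<Longrightarrow> up_set {z \<in> unit_square. s \<le> f z}"
  unfolding up_set_def using monotone_onD[of unit_square "(\<le>)" "(\<le>)" f] by (auto intro: order_trans)

lemma rationalizes_cong:
  assumes "rationalizes f q" "regular f" "regular g" "AE z in LS. f z = g z" "g ` unit_square \<subseteq> {0..1}"
  shows "rationalizes g q"
proof -
  have "AE x in LI. marg1 f x = marg1 g x"
    using AE_LS_sections(1)[OF assms(4)] AE_space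
  proof eventually_elim
    case (elim x)
    then show ?case
      unfolding marg1_def using regularD(3)[OF assms(2), of x] regularD(3)[OF assms(3), of x]
      by (intro integral_cong_AE borel_measurable_integrable) auto
  qed
  moreover have "AE y in LI. marg2 f y = marg2 g y"
    using AE_LS_sections(2)[OF assms(4)] AE_space
  proof eventually_elim
    case (elim y)
    then show ?case
      unfolding marg2_def using regularD(4)[OF assms(2), of y] regularD(4)[OF assms(3), of y]
      by (intro integral_cong_AE borel_measurable_integrable) auto
  qed
  moreover have "AE x in LI. fst q x = marg1 f x" "AE x in LI. snd q x = marg2 f x"
    using assms(1) by (auto simp: rationalizes_iff_marg)
  ultimately show ?thesis
    unfolding rationalizes_iff_marg using regularD(1)[OF assms(3)] assms(5)
    by (auto elim!: eventually_elim2)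
qed

lemma LI_indicator_tail:
  assumes "x \<in> unit_interval"
  shows "(LINT y|LI. indicat_real {x..1} y) = 1 - x" "integrable LI (indicat_real {x..1})"
proof -
  have "(LINT y|LI. indicat_real {x..1} y) = (LINT y|lebesgue. indicator unit_interval y *\<^sub>R indicat_real {x..1} y)"
    by (subst integral_restrict_space) auto
  also have "\<dots> = (LINT y|lebesgue. indicat_real {x..1} y)"
    using assms by (intro Bochner_Integration.integral_cong refl) (auto simp: indicator_def)
  also have "\<dots> = 1 - x" using assms by simp
  finally show "(LINT y|LI. indicat_real {x..1} y) = 1 - x" .
  show "integrable LI (indicat_real {x..1})"
    by (rule LI_integrable_bounded[where B=1]) (auto intro!: borel_LI)
qed

text \<open>A horizontal section of an up-set is a final segment of the unit interval, so its length
  determines it except for membership of the end point; hence the weak inequalities.\<close>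

lemma up_set_section:
  assumes A: "up_set A" and xy: "x \<in> unit_interval" "y \<in> unit_interval"
  shows "(x, y) \<in> A \<Longrightarrow> 1 - marg2 (indicat_real A) y \<le> x"
    "(x, y) \<notin> A \<Longrightarrow> x \<le> 1 - marg2 (indicat_real A) y"
proof -
  note i = regularD(4)[OF regular_mono[OF up_set_mono[OF A]] xy(2)]
  show "1 - marg2 (indicat_real A) y \<le> x" if "(x, y) \<in> A"
  proof -
    have "(x', y) \<in> A" if "x' \<in> {x..1}" for x'
      using A \<open>(x, y) \<in> A\<close> that xy unfolding up_set_def by fastforce
    then have "(LINT x'|LI. indicat_real {x..1} x') \<le> (LINT x'|LI. indicat_real A (x', y))"
      by (intro integral_mono i LI_indicator_tail xy) (auto simp: indicator_def)
    then show ?thesis using LI_indicator_tail(1)[OF xy(1)] by (simp add: marg2_def)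
  qed
  show "x \<le> 1 - marg2 (indicat_real A) y" if "(x, y) \<notin> A"
  proof -
    have "x \<le> x'" if "(x', y) \<in> A" for x'
    proof (rule ccontr)
      assume "\<not> x \<le> x'"
      then have "(x, y) \<in> A" using A that xy unfolding up_set_def by fastforce
      with \<open>(x, y) \<notin> A\<close> show False by simp
    qed
    then have "(LINT x'|LI. indicat_real A (x', y)) \<le> (LINT x'|LI. indicat_real {x..1} x')"
      by (intro integral_mono i LI_indicator_tail xy) (auto simp: indicator_def)
    then show ?thesis using LI_indicator_tail(1)[OF xy(1)] by (simp add: marg2_def)
  qed
qed

text \<open>The increments of an up-set indicator in the first coordinate are nonnegative, and a
  factor in the unit interval that depends on the second coordinate alone only shrinks them.\<close>

lemma weighted_up_set_increment:
  assumes A: "up_set A" and w: "mono_on unit_interval w" "\<And>y. y \<in> unit_interval \<Longrightarrow> 0 \<le> w y \<and> w y \<le> 1"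
    and x: "x \<in> unit_interval" "x' \<in> unit_interval" "x \<le> x'"
  shows "\<bar>marg1 (\<lambda>z. indicat_real A z * w (snd z)) x' - marg1 (\<lambda>z. indicat_real A z * w (snd z)) x\<bar>
    \<le> marg1 (indicat_real A) x' - marg1 (indicat_real A) x"
proof (rule marg_increment_bound(1)[OF _ _ x(1,2)])
  show rA: "regular (indicat_real A)" by (rule regular_mono[OF up_set_mono[OF A]])
  have "mono_on unit_square (\<lambda>z. w (snd z))"
    by (auto intro!: mono_onI monotone_onD[OF w(1)])
  then show "regular (\<lambda>z. indicat_real A z * w (snd z))"
    by (intro regular_mult rA regular_mono)
  fix t :: real assume t: "t \<in> unit_interval"
  have "indicat_real A (x, t) \<le> indicat_real A (x', t)"
    using t x by (auto intro!: monotone_onD[OF up_set_mono[OF A]])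
  then have "0 \<le> indicat_real A (x', t) - indicat_real A (x, t)" by simp
  then have "\<bar>(indicat_real A (x', t) - indicat_real A (x, t)) * w t\<bar> \<le> indicat_real A (x', t) - indicat_real A (x, t)"
    using w(2)[OF t] by (auto simp: abs_mult intro: mult_left_le)
  then show "\<bar>indicat_real A (x', t) * w (snd (x', t)) - indicat_real A (x, t) * w (snd (x, t))\<bar>
      \<le> indicat_real A (x', t) - indicat_real A (x, t)"
    by (simp add: left_diff_distrib)
qed

text \<open>
  The second margin of \<open>(1\<^sub>A - 1\<^sub>A') w\<close> is \<open>(\<beta> - \<beta>') w\<close>; its increments are controlled by those of
  \<open>t \<beta> + (1 - t) \<beta>'\<close> as soon as \<open>w\<close> varies no faster than \<open>\<beta> + \<beta>'\<close>.
\<close>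

lemma admissible_difference:
  fixes t :: real
  assumes A: "up_set A" "up_set A'" "A' \<subseteq> A" and t: "0 < t" "t < 1"
    and w: "mono_on unit_interval w" "\<And>y. y \<in> unit_interval \<Longrightarrow> 0 \<le> w y \<and> w y \<le> 1"
    and wi: "\<And>y y'. y \<in> unit_interval \<Longrightarrow> y' \<in> unit_interval \<Longrightarrow> y \<le> y' \<Longrightarrow>
      w y' - w y \<le> marg2 (indicat_real A) y' - marg2 (indicat_real A) y
        + (marg2 (indicat_real A') y' - marg2 (indicat_real A') y)"
  shows "admissible (\<lambda>z. t * indicat_real A z + (1 - t) * indicat_real A' z)
      (\<lambda>z. min t (1 - t) / 3 * ((indicat_real A z - indicat_real A' z) * w (snd z)))"
proof -
  \<comment> \<open>The minimum fits the perturbation under both coefficients \<open>t\<close> and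
    \<open>1 - t\<close> of \<open>F\<close>; the 3 absorbs the constant in the increment bound for
    the second margin.\<close>
  define k where "k = min t (1 - t) / 3"
  have k: "0 < k" "3 * k \<le> t" "3 * k \<le> 1 - t" using t by (auto simp: k_def)
  define F where "F z = t * indicat_real A z + (1 - t) * indicat_real A' z" for z
  define G where "G z = k * ((indicat_real A z - indicat_real A' z) * w (snd z))" for z
  define P where "P z = indicat_real A z * w (snd z)" for z
  define P' where "P' z = indicat_real A' z * w (snd z)" for z
  define \<beta> where "\<beta> = marg2 (indicat_real A)"
  define \<beta>' where "\<beta>' = marg2 (indicat_real A')"
  have r: "regular (indicat_real A)" "regular (indicat_real A')"
    by (intro regular_mono up_set_mono A)+
  have rw: "regular (\<lambda>z. w (snd z))"
    by (rule regular_mono) (auto intro!: mono_onI monotone_onD[OF w(1)])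
  have rP: "regular P" "regular P'" unfolding P_def P'_def by (intro regular_mult r rw)+
  have GP: "G = (\<lambda>z. k * P z + (- k) * P' z)" by (auto simp: G_def P_def P'_def fun_eq_iff algebra_simps)
  have mF: "marg1 F x = t * marg1 (indicat_real A) x + (1 - t) * marg1 (indicat_real A') x"
    "marg2 F x = t * \<beta> x + (1 - t) * \<beta>' x" if "x \<in> unit_interval" for x
    unfolding F_def \<beta>_def \<beta>'_def by (rule marg_linear[OF r that])+
  have mG1: "marg1 G x = k * marg1 P x - k * marg1 P' x" if "x \<in> unit_interval" for x
    unfolding GP using marg_linear(1)[OF rP that, of k "- k"] by simp
  have mG2: "marg2 G y = k * ((\<beta> y - \<beta>' y) * w y)" if "y \<in> unit_interval" for y
  proof -
    have "marg2 P y = \<beta> y * w y" "marg2 P' y = \<beta>' y * w y"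
      by (simp_all add: marg2_def P_def P'_def \<beta>_def \<beta>'_def)
    then show ?thesis
      unfolding GP using marg_linear(2)[OF rP that, of k "- k"] by (simp add: algebra_simps)
  qed
  have ind_le: "indicat_real A' z \<le> indicat_real A z" for z using A(3) by (auto simp: indicator_def)
  have b: "0 \<le> \<beta>' y" "\<beta>' y \<le> \<beta> y" "\<beta> y \<le> 1" if "y \<in> unit_interval" for y
    using marg_mono(2)[OF regular_const r(2) that, of 0] marg_mono(2)[OF r(2,1) that]
      marg_mono(2)[OF r(1) regular_const that, of 1] ind_le
    by (auto simp: marg_const \<beta>_def \<beta>'_def)
  have "admissible F G"
    unfolding admissible_def
  proof (intro conjI ballI impI)
    show "regular G" unfolding GP by (intro regular_add regular_cmult rP)
  next
    fix z assume z: "z \<in> unit_square"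
    have "0 \<le> w (snd z) \<and> w (snd z) \<le> 1" using z by (intro w(2)) auto
    then have "0 \<le> k * w (snd z)" "k * w (snd z) \<le> k * 1"
      using k by (auto intro!: mult_left_mono simp del: mult_1_right)
    then have "0 \<le> k * w (snd z)" "k * w (snd z) \<le> t" "k * w (snd z) \<le> 1 - t"
      using k by linarith+
    then show "\<bar>G z\<bar> \<le> F z" "\<bar>G z\<bar> \<le> 1 - F z"
      using A(3) t by (auto simp: G_def F_def indicator_def)
  next
    fix x x' :: real assume x: "x \<in> unit_interval" "x' \<in> unit_interval" "x \<le> x'"
    have m: "\<bar>marg1 P x' - marg1 P x\<bar> \<le> marg1 (indicat_real A) x' - marg1 (indicat_real A) x"
      "\<bar>marg1 P' x' - marg1 P' x\<bar> \<le> marg1 (indicat_real A') x' - marg1 (indicat_real A') x"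
      unfolding P_def P'_def by (intro weighted_up_set_increment A w x; assumption)+
    have "\<bar>marg1 G x' - marg1 G x\<bar> = \<bar>k * (marg1 P x' - marg1 P x) - k * (marg1 P' x' - marg1 P' x)\<bar>"
      unfolding mG1[OF x(1)] mG1[OF x(2)] by (simp add: algebra_simps)
    also have "\<dots> \<le> k * \<bar>marg1 P x' - marg1 P x\<bar> + k * \<bar>marg1 P' x' - marg1 P' x\<bar>"
      using abs_triangle_ineq4[of "k * (marg1 P x' - marg1 P x)" "k * (marg1 P' x' - marg1 P' x)"] k
      by (simp add: abs_mult)
    also have "\<dots> \<le> t * (marg1 (indicat_real A) x' - marg1 (indicat_real A) x)
        + (1 - t) * (marg1 (indicat_real A') x' - marg1 (indicat_real A') x)"
      using m k by (intro add_mono mult_mono) auto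
    also have "\<dots> = marg1 F x' - marg1 F x"
      unfolding mF[OF x(1)] mF[OF x(2)] by (simp add: algebra_simps)
    finally show "\<bar>marg1 G x' - marg1 G x\<bar> \<le> marg1 F x' - marg1 F x" .
    have bm: "\<beta> x \<le> \<beta> x'" "\<beta>' x \<le> \<beta>' x'"
      unfolding \<beta>_def \<beta>'_def marg2_def using x
      by (auto intro!: integral_mono regularD(4) r monotone_onD[OF up_set_mono] A)
    have ww: "0 \<le> w x' - w x" "w x' - w x \<le> \<beta> x' - \<beta> x + (\<beta>' x' - \<beta>' x)"
      using wi[OF x] monotone_onD[OF w(1) x] by (auto simp: \<beta>_def \<beta>'_def)
    have wb: "0 \<le> w x'" "w x' \<le> 1" using w(2)[OF x(2)] by auto
    have aux: "\<bar>e\<bar> \<le> 3 * (d + d')"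
      if "e = p - p' + r" "0 \<le> p" "p \<le> d" "0 \<le> p'" "p' \<le> d'" "0 \<le> r" "r \<le> v" "v \<le> d + d'"
      for e p p' r d d' v :: real
      using that by (smt (verit))
    \<comment> \<open>Discrete product rule: the increment splits into those of
      \<open>\<beta>\<close>, \<open>\<beta>'\<close> and \<open>w\<close> with coefficients of
      absolute value at most 1, and the increment of \<open>w\<close> is in turn bounded by the
      other two.\<close>
    have "\<bar>(\<beta> x' - \<beta>' x') * w x' - (\<beta> x - \<beta>' x) * w x\<bar> \<le> 3 * ((\<beta> x' - \<beta> x) + (\<beta>' x' - \<beta>' x))"
    proof (rule aux)
      show "(\<beta> x' - \<beta>' x') * w x' - (\<beta> x - \<beta>' x) * w x
        = w x' * (\<beta> x' - \<beta> x) - w x' * (\<beta>' x' - \<beta>' x) + (\<beta> x - \<beta>' x) * (w x' - w x)"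
        by (simp add: algebra_simps)
      show "w x' - w x \<le> \<beta> x' - \<beta> x + (\<beta>' x' - \<beta>' x)" by (rule ww(2))
    qed (use wb bm b[OF x(1)] ww in \<open>auto intro!: mult_nonneg_nonneg mult_left_le_one_le\<close>)
    then have "k * \<bar>(\<beta> x' - \<beta>' x') * w x' - (\<beta> x - \<beta>' x) * w x\<bar> \<le> k * (3 * ((\<beta> x' - \<beta> x) + (\<beta>' x' - \<beta>' x)))"
      using k by (intro mult_left_mono) auto
    also have "\<dots> = (3 * k) * (\<beta> x' - \<beta> x) + (3 * k) * (\<beta>' x' - \<beta>' x)" by (simp add: algebra_simps)
    also have "\<dots> \<le> t * (\<beta> x' - \<beta> x) + (1 - t) * (\<beta>' x' - \<beta>' x)"
      using bm k by (intro add_mono mult_right_mono) auto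
    also have "\<dots> = marg2 F x' - marg2 F x"
      unfolding mF[OF x(1)] mF[OF x(2)] by (simp add: algebra_simps)
    also have "k * \<bar>(\<beta> x' - \<beta>' x') * w x' - (\<beta> x - \<beta>' x) * w x\<bar> = \<bar>marg2 G x' - marg2 G x\<bar>"
      unfolding mG2[OF x(1)] mG2[OF x(2)] right_diff_distrib[symmetric] abs_mult using k by simp
    finally show "\<bar>marg2 G x' - marg2 G x\<bar> \<le> marg2 F x' - marg2 F x" .
  qed
  then show ?thesis by (simp add: F_def[abs_def] G_def[abs_def] k_def)
qed

text \<open>The second margins of \<open>G (\<lambda>_. 1)\<close> and \<open>G w\<close> are the
  same multiple of the difference of section lengths, times 1 and \<open>w\<close>. A vanishing
  combination gives \<open>a + b * w y = 0\<close> wherever the lengths differ, which pins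
  \<open>w\<close> down.\<close>

lemma extreme_point_constant_weight:
  fixes t :: real
  assumes \<psi>: "essentially_bounded \<psi>1" "essentially_bounded \<psi>2"
    and q: "extreme_point_ae q (Qbar \<psi>1 \<psi>2 \<eta>)"
    and A: "up_set A" "up_set A'" "A' \<subseteq> A" and t: "0 < t" "t < 1"
    and F: "rationalizes (\<lambda>z. t * indicat_real A z + (1 - t) * indicat_real A' z) q"
    and w: "mono_on unit_interval w" "\<And>y. y \<in> unit_interval \<Longrightarrow> 0 \<le> w y \<and> w y \<le> 1"
    and wi: "\<And>y y'. y \<in> unit_interval \<Longrightarrow> y' \<in> unit_interval \<Longrightarrow> y \<le> y' \<Longrightarrow>
      w y' - w y \<le> marg2 (indicat_real A) y' - marg2 (indicat_real A) y
        + (marg2 (indicat_real A') y' - marg2 (indicat_real A') y)"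
  obtains c where "AE y in LI. marg2 (indicat_real A) y = marg2 (indicat_real A') y \<or> w y = c"
proof -
  define k where "k = min t (1 - t) / 3"
  have k: "0 < k" using t by (simp add: k_def)
  define G where "G v z = k * ((indicat_real A z - indicat_real A' z) * v (snd z))" for v :: "real \<Rightarrow> real" and z
  have r: "regular (indicat_real A)" "regular (indicat_real A')"
    by (intro regular_mono up_set_mono A)+
  have bm: "marg2 (indicat_real B) x \<le> marg2 (indicat_real B) x'"
    if "up_set B" "x \<in> unit_interval" "x' \<in> unit_interval" "x \<le> x'" for B x x'
    unfolding marg2_def using that
    by (auto intro!: integral_mono regularD(4) regular_mono monotone_onD[OF up_set_mono] up_set_mono)
  have 1: "admissible (\<lambda>z. t * indicat_real A z + (1 - t) * indicat_real A' z) (G (\<lambda>_. 1))"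
    unfolding G_def k_def
    by (rule admissible_difference[OF A t]) (auto intro!: mono_onI add_nonneg_nonneg simp: bm A)
  have 2: "admissible (\<lambda>z. t * indicat_real A z + (1 - t) * indicat_real A' z) (G w)"
    unfolding G_def k_def by (rule admissible_difference[OF A t w wi])
  have rF: "regular (\<lambda>z. t * indicat_real A z + (1 - t) * indicat_real A' z)"
    by (intro regular_add regular_cmult r)
  obtain a b where ab: "a \<noteq> 0 \<or> b \<noteq> 0"
    "AE y in LI. a * marg2 (G (\<lambda>_. 1)) y + b * marg2 (G w) y = 0"
    using extreme_point_two_perturbations[OF \<psi> q F rF 1 2] by metis
  have mG: "marg2 (G v) y = k * ((marg2 (indicat_real A) y - marg2 (indicat_real A') y) * v y)"
    if "y \<in> unit_interval" for v y
  proof -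
    have "integrable LI (\<lambda>x. indicat_real A (x, y))" "integrable LI (\<lambda>x. indicat_real A' (x, y))"
      using regularD(4)[OF r(1) that] regularD(4)[OF r(2) that] .
    then show ?thesis by (simp add: marg2_def G_def)
  qed
  have ae: "AE y in LI. marg2 (indicat_real A) y = marg2 (indicat_real A') y \<or> a + b * w y = 0"
    using ab(2) AE_space
  proof eventually_elim
    case (elim y)
    then have "k * ((marg2 (indicat_real A) y - marg2 (indicat_real A') y) * (a + b * w y)) = 0"
      by (simp add: mG algebra_simps)
    then show ?case using k by auto
  qed
  show ?thesis
  proof (rule that)
    \<comment> \<open>If \<open>b = 0\<close>, then \<open>a\<close> is nonzero and the lengths
      agree almost everywhere, so the first alternative holds whatever the quotient by 0 is.\<close>
    show "AE y in LI. marg2 (indicat_real A) y = marg2 (indicat_real A') y \<or> w y = - a / b"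
      using ae
    proof eventually_elim
      case (elim y)
      then show ?case
      proof (cases "b = 0")
        case False
        with elim show ?thesis by (auto simp: field_simps add_eq_0_iff)
      qed (use ab(1) in auto)
    qed
  qed
qed

text \<open>By monotonicity the heights with lengths \<open>b\<close> and \<open>b'\<close> form an
  interval, so \<open>A\<close> and \<open>A'\<close> differ by a rectangle up to a null set. As an
  exact rectangle between exact up-sets is wanted, both are rebuilt from \<open>A'\<close> by adding
  a quadrant, with the open rectangle left out in the smaller one.\<close>

lemma rectangle_modification:
  assumes A: "up_set A" "up_set A'" "A' \<subseteq> A"
    and ae: "AE y in LI. marg2 (indicat_real A) y = marg2 (indicat_real A') y \<or>
      (marg2 (indicat_real A) y = b \<and> marg2 (indicat_real A') y = b')"
  obtains C C' where "up_set C" "up_set C'" "C' \<subseteq> C" "differ_by_at_most_rectangle C' C"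
    "AE z in LS. indicat_real C z = indicat_real A z" "AE z in LS. indicat_real C' z = indicat_real A' z"
proof -
  define \<beta> where "\<beta> = marg2 (indicat_real A)"
  define \<beta>' where "\<beta>' = marg2 (indicat_real A')"
  note m = up_set_mono[OF A(1)] up_set_mono[OF A(2)]
  note r = regular_mono[OF m(1)] regular_mono[OF m(2)]
  have bm: "\<beta> y \<le> \<beta> y'" "\<beta>' y \<le> \<beta>' y'" if "y \<in> unit_interval" "y' \<in> unit_interval" "y \<le> y'" for y y'
    unfolding \<beta>_def \<beta>'_def marg2_def using that
    by (auto intro!: integral_mono regularD(4) r monotone_onD[OF m(1)] monotone_onD[OF m(2)])
  have ind_le: "indicat_real A' z \<le> indicat_real A z" for z using A(3) by (auto simp: indicator_def)
  have bb: "0 \<le> \<beta>' y" "\<beta>' y \<le> \<beta> y" "\<beta> y \<le> 1" if "y \<in> unit_interval" for y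
    using marg_mono(2)[OF regular_const r(2) that, of 0] marg_mono(2)[OF r(2,1) that]
      marg_mono(2)[OF r(1) regular_const that, of 1] ind_le
    by (auto simp: marg_const \<beta>_def \<beta>'_def)
  have inA: "(x, y) \<in> A \<longleftrightarrow> 1 - \<beta> y < x" if "x \<in> unit_interval" "y \<in> unit_interval" "x \<noteq> 1 - \<beta> y" for x y
    using up_set_section[OF A(1) that(1,2)] that(3) by (cases "(x, y) \<in> A") (auto simp: \<beta>_def)
  have inA': "(x, y) \<in> A' \<longleftrightarrow> 1 - \<beta>' y < x" if "x \<in> unit_interval" "y \<in> unit_interval" "x \<noteq> 1 - \<beta>' y" for x y
    using up_set_section[OF A(2) that(1,2)] that(3) by (cases "(x, y) \<in> A'") (auto simp: \<beta>'_def)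
  show ?thesis
  proof (cases "AE y in LI. \<beta> y = \<beta>' y")
    case True
    have "AE z in LS. indicat_real A' z = indicat_real A z"
    proof (rule AE_LS_from_horizontal_sections[OF regularD(1)[OF r(2)] regularD(1)[OF r(1)]])
      show "AE y in LI. AE x in LI. indicat_real A' (x, y) = indicat_real A (x, y)"
        using True AE_space
      proof eventually_elim
        case (elim y)
        show ?case
          using AE_LI_neq[of "1 - \<beta> y"] AE_space
          by eventually_elim (use elim in \<open>simp add: indicator_def inA inA'\<close>)
      qed
    qed
    then show ?thesis using A by (intro that[of A' A']) (auto simp: differ_by_at_most_rectangle_def)
  next
    case False
    define E where "E = {y \<in> unit_interval. \<beta> y = b \<and> \<beta>' y = b'}"
    have aeE: "AE y in LI. \<beta> y = \<beta>' y \<or> y \<in> E"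
      using ae AE_space by eventually_elim (auto simp: E_def \<beta>_def \<beta>'_def)
    \<comment> \<open>With at most one point in \<open>E\<close> the lengths would agree almost
      everywhere, the case already settled. Two points make the interval of heights nondegenerate,
      so that the open rectangle has the expected closure.\<close>
    have "\<exists>u\<in>E. \<exists>v\<in>E. u < v"
    proof (rule ccontr)
      assume c: "\<not> ?thesis"
      have "\<exists>e. E \<subseteq> {e}"
      proof (cases "E = {}")
        case False
        then obtain e where e: "e \<in> E" by blast
        have "E \<subseteq> {e}"
        proof
          fix y assume "y \<in> E"
          with c e have "\<not> y < e" "\<not> e < y" by blast+
          then show "y \<in> {e}" by simp
        qed
        then show ?thesis ..
      qed simp
      then obtain e where "E \<subseteq> {e}" ..
      have "AE y in LI. \<beta> y = \<beta>' y"
        using aeE AE_LI_neq[of e] by eventually_elim (use \<open>E \<subseteq> {e}\<close> in auto)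
      with False show False ..
    qed
    then obtain u v where uv: "u \<in> E" "v \<in> E" "u < v" by blast
    have E: "y \<in> unit_interval" "\<beta> y = b" "\<beta>' y = b'" if "y \<in> E" for y using that by (auto simp: E_def)
    have "b' \<noteq> b"
    proof
      assume "b' = b"
      have "AE y in LI. \<beta> y = \<beta>' y"
        using aeE by eventually_elim (use E \<open>b' = b\<close> in auto)
      with False show False ..
    qed
    then have b: "0 \<le> b'" "b' < b" "b \<le> 1" using bb[of u] E[OF uv(1)] by auto
    define e1 where "e1 = Inf E"
    define e2 where "e2 = Sup E"
    have bdd: "bdd_below E" "bdd_above E"
      by (auto intro!: bdd_belowI[of _ 0] bdd_aboveI[of _ 1] simp: E_def)
    have e1: "e1 \<le> y" and e2: "y \<le> e2" if "y \<in> E" for y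
      unfolding e1_def e2_def using that bdd by (auto intro: cInf_lower cSup_upper)
    have e01: "0 \<le> e1" "e2 \<le> 1"
      unfolding e1_def e2_def using uv by (auto intro!: cInf_greatest cSup_least simp: E_def)
    have e12: "e1 < e2" using e1[OF uv(1)] e2[OF uv(2)] uv(3) by simp
    have inE: "y \<in> E" if lt: "e1 < y" "y < e2" for y
    proof -
      have ne: "E \<noteq> {}" using uv by blast
      obtain l where l: "l \<in> E" "l < y"
        using lt(1) unfolding e1_def cInf_less_iff[OF ne bdd(1)] by blast
      obtain h where h: "h \<in> E" "y < h"
        using lt(2) unfolding e2_def less_cSup_iff[OF ne bdd(2)] by blast
      have y: "y \<in> unit_interval" using l h E(1) by force
      then have "\<beta> l \<le> \<beta> y" "\<beta> y \<le> \<beta> h" "\<beta>' l \<le> \<beta>' y" "\<beta>' y \<le> \<beta>' h"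
        using l h E(1) by (auto intro!: bm)
      then show ?thesis using y E[OF l(1)] E[OF h(1)] by (simp add: E_def)
    qed
    \<comment> \<open>At heights in \<open>E\<close> the section of \<open>A\<close> starts at
      \<open>1 - b\<close> and that of \<open>A'\<close> at \<open>1 - b'\<close>.\<close>
    define B where "B = {1 - b<..<1 - b'} \<times> {e1<..<e2}"
    define C where "C = A' \<union> {z \<in> unit_square. 1 - b < fst z \<and> e1 < snd z}"
    define C' where "C' = A' \<union> {z \<in> unit_square. 1 - b < fst z \<and> e1 < snd z \<and> (1 - b' \<le> fst z \<or> e2 \<le> snd z)}"
    have A's: "A' \<subseteq> unit_square" "\<And>z w. z \<in> A' \<Longrightarrow> w \<in> unit_square \<Longrightarrow> z \<le> w \<Longrightarrow> w \<in> A'"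
      using A(2) unfolding up_set_def by blast+
    have uC: "up_set C" "up_set C'"
      unfolding up_set_def C_def C'_def using A's by (auto simp: less_eq_prod_def intro: order_trans less_le_trans)
    have sub: "C' \<subseteq> C" by (auto simp: C_def C'_def)
    \<comment> \<open>This holds exactly, not just almost everywhere: inside \<open>B\<close> the
      strict inequality \<open>x < 1 - b'\<close> decides membership in \<open>A'\<close>.\<close>
    have disj: "A' \<inter> B = {}"
    proof -
      have False if "(x, y) \<in> A'" "1 - b < x" "x < 1 - b'" "e1 < y" "y < e2" for x y
      proof -
        have "y \<in> E" using that by (intro inE)
        with inA'[of x y] that A's(1) E[of y] show False by auto
      qed
      then show ?thesis by (auto simp: B_def)
    qed
    have Bs: "B \<subseteq> unit_square" using b e01 by (auto simp: B_def)
    have "C - C' = B"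
      using disj Bs by (auto simp: C_def C'_def B_def)
    moreover have "closure B = {1 - b..1 - b'} \<times> {e1..e2}"
      using b e12 by (simp add: B_def closure_Times)
    ultimately have dif: "differ_by_at_most_rectangle C' C"
      unfolding differ_by_at_most_rectangle_def rectangle_def using Bs b e12
      by (metis diff_left_mono less_imp_le)
    note mC = regularD(1)[OF regular_mono[OF up_set_mono[OF uC(1)]]] regularD(1)[OF regular_mono[OF up_set_mono[OF uC(2)]]]
    have sec: "AE y in LI. AE x in LI. ((x, y) \<in> C \<longleftrightarrow> (x, y) \<in> A) \<and> ((x, y) \<in> C' \<longleftrightarrow> (x, y) \<in> A')"
      using aeE AE_LI_neq[of e1] AE_LI_neq[of e2] AE_space
    proof eventually_elim
      case (elim y)
      then have y: "y \<in> unit_interval" by simp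
      \<comment> \<open>Above \<open>e2\<close> the lengths agree and are at least \<open>b\<close>,
        so there the added quadrant already belongs to \<open>A'\<close> up to a null set; below
        \<open>e1\<close> nothing is added.\<close>
      have ycase: "y < e1 \<and> \<beta> y = \<beta>' y \<or> e1 < y \<and> y < e2 \<and> \<beta> y = b \<and> \<beta>' y = b' \<or> e2 < y \<and> \<beta> y = \<beta>' y \<and> b \<le> \<beta> y"
      proof -
        consider "y < e1" | "e1 < y" "y < e2" | "e2 < y" using elim(2,3) by linarith
        then show ?thesis
        proof cases
          case 1
          then have "y \<notin> E" using e1 by force
          with 1 elim(1) show ?thesis by simp
        next
          case 2
          with E[OF inE[OF 2]] show ?thesis by simp
        next
          case 3
          then have "y \<notin> E" using e2 by force
          moreover have "\<beta> v \<le> \<beta> y" using 3 e2[OF uv(2)] E(1)[OF uv(2)] y by (intro bm) auto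
          ultimately show ?thesis using 3 elim(1) E[OF uv(2)] by auto
        qed
      qed
      show ?case
        using AE_LI_neq[of "1 - \<beta> y"] AE_LI_neq[of "1 - \<beta>' y"] AE_LI_neq[of "1 - b"] AE_LI_neq[of "1 - b'"] AE_space
      proof eventually_elim
        case (elim x)
        then have x: "x \<in> unit_interval" by simp
        have c: "(x, y) \<in> C \<longleftrightarrow> 1 - \<beta>' y < x \<or> (1 - b < x \<and> e1 < y)"
          using x y elim by (simp add: C_def inA')
        have c': "(x, y) \<in> C' \<longleftrightarrow> 1 - \<beta>' y < x \<or> (1 - b < x \<and> e1 < y \<and> (1 - b' \<le> x \<or> e2 \<le> y))"
          using x y elim by (simp add: C'_def inA')
        show ?case
          unfolding c c' inA[OF x y elim(1)] inA'[OF x y elim(2)]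
          using ycase elim(3,4) b e12 by auto
      qed
    qed
    have "AE z in LS. indicat_real C z = indicat_real A z"
      by (rule AE_LS_from_horizontal_sections[OF mC(1) regularD(1)[OF r(1)]])
         (use sec in \<open>elim eventually_mono, simp add: indicator_def\<close>)
    moreover have "AE z in LS. indicat_real C' z = indicat_real A' z"
      by (rule AE_LS_from_horizontal_sections[OF mC(2) regularD(1)[OF r(2)]])
         (use sec in \<open>elim eventually_mono, simp add: indicator_def\<close>)
    ultimately show ?thesis using uC sub dif by (intro that)
  qed
qed

text \<open>The section lengths of \<open>A\<close> and \<open>A'\<close> are themselves valid
  weights: each grows no faster than their sum, because the other is nondecreasing. Pairing each
  with the constant weight makes both constant where they differ.\<close>

lemma extreme_point_rectangle_mixture:
  fixes t :: real
  assumes \<psi>: "essentially_bounded \<psi>1" "essentially_bounded \<psi>2"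
    and q: "extreme_point_ae q (Qbar \<psi>1 \<psi>2 \<eta>)"
    and A: "up_set A" "up_set A'" "A' \<subseteq> A" and t: "0 < t" "t < 1"
    and F: "rationalizes (\<lambda>z. t * indicat_real A z + (1 - t) * indicat_real A' z) q"
  shows "\<exists>C C'. up_set C \<and> up_set C' \<and> C' \<subseteq> C \<and> differ_by_at_most_rectangle C' C \<and>
    rationalizes (\<lambda>z. t * indicat_real C z + (1 - t) * indicat_real C' z) q"
proof -
  define \<beta> where "\<beta> B = marg2 (indicat_real B)" for B
  have r: "regular (indicat_real B)" if "up_set B" for B
    by (intro regular_mono up_set_mono that)
  have bm: "\<beta> B x \<le> \<beta> B x'" if "up_set B" "x \<in> unit_interval" "x' \<in> unit_interval" "x \<le> x'" for B x x'
    unfolding \<beta>_def marg2_def using that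
    by (auto intro!: integral_mono regularD(4) regular_mono monotone_onD[OF up_set_mono] up_set_mono)
  have b01: "0 \<le> \<beta> B y \<and> \<beta> B y \<le> 1" if "up_set B" "y \<in> unit_interval" for B y
    using marg_mono(2)[OF regular_const r[OF that(1)] that(2), of 0]
      marg_mono(2)[OF r[OF that(1)] regular_const that(2), of 1]
    by (auto simp: marg_const \<beta>_def)
  have bmono: "mono_on unit_interval (\<beta> B)" if "up_set B" for B
    using bm[OF that] by (intro mono_onI)
  obtain b where b: "AE y in LI. \<beta> A y = \<beta> A' y \<or> \<beta> A y = b"
    unfolding \<beta>_def
    by (rule extreme_point_constant_weight[OF \<psi> q A t F bmono[OF A(1), unfolded \<beta>_def] b01[OF A(1), unfolded \<beta>_def]])
       (use bm[OF A(2)] in \<open>auto simp: \<beta>_def\<close>)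
  obtain b' where b': "AE y in LI. \<beta> A y = \<beta> A' y \<or> \<beta> A' y = b'"
    unfolding \<beta>_def
    by (rule extreme_point_constant_weight[OF \<psi> q A t F bmono[OF A(2), unfolded \<beta>_def] b01[OF A(2), unfolded \<beta>_def]])
       (use bm[OF A(1)] in \<open>auto simp: \<beta>_def\<close>)
  have "AE y in LI. marg2 (indicat_real A) y = marg2 (indicat_real A') y \<or>
      (marg2 (indicat_real A) y = b \<and> marg2 (indicat_real A') y = b')"
    using b b' unfolding \<beta>_def by eventually_elim auto
  from A this obtain C C' where C: "up_set C" "up_set C'" "C' \<subseteq> C" "differ_by_at_most_rectangle C' C"
    "AE z in LS. indicat_real C z = indicat_real A z" "AE z in LS. indicat_real C' z = indicat_real A' z"
    by (rule rectangle_modification)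
  have "rationalizes (\<lambda>z. t * indicat_real C z + (1 - t) * indicat_real C' z) q"
  proof (rule rationalizes_cong[OF F])
    show "AE z in LS. t * indicat_real A z + (1 - t) * indicat_real A' z = t * indicat_real C z + (1 - t) * indicat_real C' z"
      using C(5,6) by eventually_elim simp
    show "(\<lambda>z. t * indicat_real C z + (1 - t) * indicat_real C' z) ` unit_square \<subseteq> {0..1}"
      using t by (auto simp: indicator_def)
  qed (intro regular_add regular_cmult r A C)+
  with C show ?thesis by blast
qed

theorem theorem4:
  fixes \<psi>1 \<psi>2 :: "real \<Rightarrow> real" and \<eta> :: real and q :: fun_pair
  assumes "essentially_bounded \<psi>1" and "essentially_bounded \<psi>2"
    and "extreme_point_ae q (Qbar \<psi>1 \<psi>2 \<eta>)"
  shows "(\<exists>A A' t. up_set A \<and> up_set A' \<and> A' \<subseteq> A \<and> differ_by_at_most_rectangle A' A \<and>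
            0 \<le> t \<and> t \<le> 1 \<and>
            rationalizes (\<lambda>x. t * indicat_real A x + (1 - t) * indicat_real A' x) q) \<and>
         (\<forall>f g. mono_on unit_square f \<and> rationalizes f q \<and> mono_on unit_square g \<and> rationalizes g q \<longrightarrow>
            (AE x in lebesgue_on unit_square. f x = g x))"
proof
  have "q \<in> Q" using assms(3) by (simp add: extreme_point_ae_def Qbar_def)
  then have nd: "nondecreasing_left_cont (fst q)" "nondecreasing_left_cont (snd q)" and "rationalizable q"
    by (auto simp: Q_def)
  then obtain f0 where "rationalizes f0 q" by (auto simp: rationalizable_def)
  then obtain f where f: "mono_on unit_square f" "rationalizes f q"
    using nd by (auto simp: nondecreasing_left_cont_def elim: monotone_rationalizer_exists)
  have fb: "0 \<le> f z \<and> f z \<le> 1" if "z \<in> unit_square" for z using f(2) that by (rule rationalizes_range)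
  obtain t where t: "0 \<le> t" "t \<le> 1" "AE z in LS. f z = 0 \<or> f z = t \<or> f z = 1"
    by (rule extreme_point_two_levels[OF assms f])
  define A where "A s = {z \<in> unit_square. s \<le> f z}" for s
  have up: "up_set (A s)" for s unfolding A_def by (rule up_set_level[OF f(1)])
  have r: "regular (indicat_real (A s))" for s by (intro regular_mono up_set_mono up)
  show "\<exists>A A' t. up_set A \<and> up_set A' \<and> A' \<subseteq> A \<and> differ_by_at_most_rectangle A' A \<and>
            0 \<le> t \<and> t \<le> 1 \<and>
            rationalizes (\<lambda>x. t * indicat_real A x + (1 - t) * indicat_real A' x) q"
  proof (cases "t = 0 \<or> t = 1")
    case True
    \<comment> \<open>Here \<open>f\<close> is almost everywhere the indicator of
      \<open>A 1\<close>, and the empty difference qualifies. Only \<open>0 < t < 1\<close> leaves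
      room for perturbations on the level set \<open>t\<close>.\<close>
    have "rationalizes (\<lambda>z. 1 * indicat_real (A 1) z + (1 - 1) * indicat_real (A 1) z) q"
    proof (rule rationalizes_cong[OF f(2) regular_mono[OF f(1)]])
      show "AE z in LS. f z = 1 * indicat_real (A 1) z + (1 - 1) * indicat_real (A 1) z"
        using t(3) AE_space by eventually_elim (use True fb in \<open>auto simp: A_def indicator_def\<close>)
      show "regular (\<lambda>z. 1 * indicat_real (A 1) z + (1 - 1) * indicat_real (A 1) z)"
        by (intro regular_add regular_cmult r)
    qed (auto simp: indicator_def)
    with up[of 1] show ?thesis
      by (intro exI[of _ "A 1"] exI[of _ "1 :: real"]) (auto simp: differ_by_at_most_rectangle_def)
  next
    case False
    then have t': "0 < t" "t < 1" using t by auto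
    \<comment> \<open>Layer-cake form of \<open>f\<close>: the value \<open>t\<close> is produced by
      \<open>A t\<close> alone, the value 1 by both sets together.\<close>
    have "rationalizes (\<lambda>z. t * indicat_real (A t) z + (1 - t) * indicat_real (A 1) z) q"
    proof (rule rationalizes_cong[OF f(2) regular_mono[OF f(1)]])
      show "AE z in LS. f z = t * indicat_real (A t) z + (1 - t) * indicat_real (A 1) z"
        using t(3) AE_space by eventually_elim (use t' fb in \<open>auto simp: A_def indicator_def\<close>)
      show "regular (\<lambda>z. t * indicat_real (A t) z + (1 - t) * indicat_real (A 1) z)"
        by (intro regular_add regular_cmult r)
    qed (use t in \<open>auto simp: indicator_def\<close>)
    moreover have "A 1 \<subseteq> A t" using t by (auto simp: A_def)
    ultimately show ?thesis
      using extreme_point_rectangle_mixture[OF assms up up _ t'] t(1,2) by blast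
  qed
  show "\<forall>f g. mono_on unit_square f \<and> rationalizes f q \<and> mono_on unit_square g \<and> rationalizes g q \<longrightarrow>
            (AE x in lebesgue_on unit_square. f x = g x)"
    using extreme_point_unique_monotone[OF assms] by blast
qed

end
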